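(* Let $d\geq 1$ be a (standard) natural number, let $H\in{}^{\ast}\mathbb{N}\setminus\mathbb{N}$, let $U$ be a cut in $[1,H]$, and let $E$ be an internal subset of $[-H,H]^{d}$. Then $$\mu_{[-H,H]^{d}}\left(\left\{x\in E+\mathcal{U}^{d}: d_{E}(x)<1\right\}\right)=0,$$ where $\mathcal{U}=(-U)\cup\{0\}\cup U$ and $d_E(x)=\liminf_{\nu>U}\mu_{x+[-\nu,\nu]^d}\left((E+\mathcal{U}^d)\cap(x+[-\nu,\nu]^d)\right)$.
   Context: We work in a countably saturated nonstandard universe. $\mathbb{N}$ does not contain $0$, and intervals denote intervals in ${}^{\ast}\mathbb{Z}$. Loeb measure: for a nonempty internal hyperfinite set $F\subseteq{}^{\ast}\mathbb{Z}^d$ and internal $D\subseteq F$, $\mu_F(D)=\operatorname{st}(|D|/|F|)$ (with $|\cdot|$ internal cardinality and $\operatorname{st}$ the standard part); $\mu_F$ also denotes its canonical extension to the complete countably additive Loeb probability measure on the $\sigma$-algebra of Loeb measurable subsets of $F$. If $D\not\subseteq F$, $\mu_F(D)$ means $\mu_F(D\cap F)$. A cut $U$ in $[1,H]$ is a (nonempty) initial segment of $[1,H]$ that is closed under addition. Writing $\nu>U$ means $\nu>u$ for all $u\in U$. For a real-valued function $g$, $\liminf_{\nu>U}g(\nu)$ means $\sup_{\xi>U}\inf_{U<\nu<\xi}g(\nu)$, where $\xi,\nu$ range over hypernatural numbers. *)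

theory Defs
  imports "HOL-Analysis.Analysis"
begin

section \<open>Nonstandard universes\<close>

text \<open>
  The standard universe consists of the real numbers, the finitary relations between real
  numbers, and the finitary relations between objects of these two kinds. (HOL has no type for
  a full superstructure. A nonstandard extension of any superstructure over the reals restricts
  to one of this universe, with the same internal sets of tuples of hyperreals, the same
  internal cardinalities, and with countable saturation.)
\<close>

datatype 'a level = Elem 'a | Rel "'a list set"

type_synonym entity = "real level level"

definition num :: "real \<Rightarrow> entity" where
  "num r = Elem (Elem r)"

text \<open>
  First-order formulas with variables named by natural numbers and with every relation over
  the standard universe as a predicate symbol. A relation is a set of lists; only its
  lists of the right length matter for an atomic formula. The interpretation of the
  predicate symbols is the first argument of \<open>sat\<close>.
\<close>

datatype 's formula =
    Atom "'s list set" "nat list"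
  | Eql nat nat
  | Neg "'s formula"
  | Conj "'s formula" "'s formula"
  | Forall nat "'s formula"

primrec sat :: "('s list set \<Rightarrow> 'b list set) \<Rightarrow> 's formula \<Rightarrow> (nat \<Rightarrow> 'b) \<Rightarrow> bool" where
  "sat I (Atom R xs) v \<longleftrightarrow> map v xs \<in> I R"
| "sat I (Eql x y) v \<longleftrightarrow> v x = v y"
| "sat I (Neg p) v \<longleftrightarrow> \<not> sat I p v"
| "sat I (Conj p q) v \<longleftrightarrow> sat I p v \<and> sat I q v"
| "sat I (Forall x p) v \<longleftrightarrow> (\<forall>b. sat I p (v(x := b)))"

text \<open>
  Throughout, \<open>star s\<close> is the image of the standard object \<open>s\<close>, and \<open>ext R\<close> is the extension
  of the standard relation \<open>R\<close> to the type \<open>'b\<close> of all internal objects.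
\<close>

definition transfer_principle :: "('s \<Rightarrow> 'b) \<Rightarrow> ('s list set \<Rightarrow> 'b list set) \<Rightarrow> bool" where
  "transfer_principle star ext \<longleftrightarrow>
     (\<forall>p v. sat (\<lambda>R. R) p v \<longleftrightarrow> sat ext p (star \<circ> v))"

definition membership :: "entity list set" where
  "membership = {Rel B # map Elem xs | B xs. xs \<in> B}"

text \<open>
  An internal set of \<open>k\<close>-tuples is given by an element \<open>a\<close> of the star of the power set of
  \<open>X\<^sup>k\<close>, with \<open>X\<close> the set of objects below the top level (in particular, all reals).
\<close>

definition codes :: "(entity list set \<Rightarrow> 'b list set) \<Rightarrow> nat \<Rightarrow> 'b \<Rightarrow> 'b list set \<Rightarrow> bool" where
  "codes ext k a D \<longleftrightarrow>
     [a] \<in> ext {[Rel B] | B. \<forall>xs\<in>B. length xs = k} \<and>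
     D = {xs. length xs = k \<and> a # xs \<in> ext membership}"

definition internal :: "(entity list set \<Rightarrow> 'b list set) \<Rightarrow> nat \<Rightarrow> 'b list set \<Rightarrow> bool" where
  "internal ext k D \<longleftrightarrow> (\<exists>a. codes ext k a D)"

definition countably_saturated :: "(entity list set \<Rightarrow> 'b list set) \<Rightarrow> bool" where
  "countably_saturated ext \<longleftrightarrow>
     (\<forall>k (D :: nat \<Rightarrow> 'b list set).
        (\<forall>n. internal ext k (D n)) \<and> (\<forall>n. (\<Inter>i\<le>n. D i) \<noteq> {}) \<longrightarrow> (\<Inter>n. D n) \<noteq> {})"

locale nonstandard_universe =
  fixes star :: "entity \<Rightarrow> 'b"
    and ext :: "entity list set \<Rightarrow> 'b list set"
  assumes transfer: "transfer_principle star ext"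
    and saturation: "countably_saturated ext"


section \<open>Hyperreal arithmetic and internal cardinality\<close>

definition hints :: "(entity list set \<Rightarrow> 'b list set) \<Rightarrow> 'b set" where
  "hints ext = {x. [x] \<in> ext {[num (of_int i)] | i. True}}"

definition hypernats :: "(entity list set \<Rightarrow> 'b list set) \<Rightarrow> 'b set" where
  "hypernats ext = {x. [x] \<in> ext {[num (of_nat n)] | n. n \<ge> 1}}"

definition standard_nats :: "(entity \<Rightarrow> 'b) \<Rightarrow> 'b set" where
  "standard_nats star = {star (num (of_nat n)) | n. n \<ge> 1}"

definition hle :: "(entity list set \<Rightarrow> 'b list set) \<Rightarrow> 'b \<Rightarrow> 'b \<Rightarrow> bool" where
  "hle ext x y \<longleftrightarrow> [x, y] \<in> ext {[num r, num s] | r s. r \<le> s}"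

definition hless :: "(entity list set \<Rightarrow> 'b list set) \<Rightarrow> 'b \<Rightarrow> 'b \<Rightarrow> bool" where
  "hless ext x y \<longleftrightarrow> [x, y] \<in> ext {[num r, num s] | r s. r < s}"

definition hplus :: "(entity list set \<Rightarrow> 'b list set) \<Rightarrow> 'b \<Rightarrow> 'b \<Rightarrow> 'b" where
  "hplus ext x y = (THE z. [x, y, z] \<in> ext {[num r, num s, num (r + s)] | r s. True})"

definition hdivide :: "(entity list set \<Rightarrow> 'b list set) \<Rightarrow> 'b \<Rightarrow> 'b \<Rightarrow> 'b" where
  "hdivide ext x y = (THE z. [x, y, z] \<in> ext {[num r, num s, num (r / s)] | r s. True})"

definition huminus :: "(entity list set \<Rightarrow> 'b list set) \<Rightarrow> 'b \<Rightarrow> 'b" where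
  "huminus ext x = (THE z. [x, z] \<in> ext {[num r, num (- r)] | r. True})"

definition standard_part :: "(entity \<Rightarrow> 'b) \<Rightarrow> (entity list set \<Rightarrow> 'b list set) \<Rightarrow> 'b \<Rightarrow> real" where
  "standard_part star ext x =
     (THE r. \<forall>e>0. hless ext (star (num (r - e))) x \<and> hless ext x (star (num (r + e))))"

definition hinterval :: "(entity list set \<Rightarrow> 'b list set) \<Rightarrow> 'b \<Rightarrow> 'b \<Rightarrow> 'b set" where
  "hinterval ext a b = {x \<in> hints ext. hle ext a x \<and> hle ext x b}"

definition hcard :: "(entity list set \<Rightarrow> 'b list set) \<Rightarrow> nat \<Rightarrow> 'b list set \<Rightarrow> 'b" where
  "hcard ext k D =
     (THE n. \<exists>a. codes ext k a D \<and> [a, n] \<in> ext {[Rel B, num (of_nat (card B))] | B. finite B})"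


section \<open>Tuples\<close>

definition tuples :: "nat \<Rightarrow> 'b set \<Rightarrow> 'b list set" where
  "tuples d A = {xs. length xs = d \<and> set xs \<subseteq> A}"

definition tuple_plus :: "(entity list set \<Rightarrow> 'b list set) \<Rightarrow> 'b list \<Rightarrow> 'b list \<Rightarrow> 'b list" where
  "tuple_plus ext x y = map2 (hplus ext) x y"

definition sumset ::
    "(entity list set \<Rightarrow> 'b list set) \<Rightarrow> 'b list set \<Rightarrow> 'b list set \<Rightarrow> 'b list set" where
  "sumset ext A B = {tuple_plus ext x y | x y. x \<in> A \<and> y \<in> B}"

definition hbox :: "(entity list set \<Rightarrow> 'b list set) \<Rightarrow> nat \<Rightarrow> 'b \<Rightarrow> 'b list set" where
  "hbox ext d h = tuples d (hinterval ext (huminus ext h) h)"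


section \<open>Loeb measure\<close>

definition loeb ::
    "(entity \<Rightarrow> 'b) \<Rightarrow> (entity list set \<Rightarrow> 'b list set) \<Rightarrow> nat \<Rightarrow> 'b list set \<Rightarrow> 'b list measure" where
  "loeb star ext d F = completion
     (extend_measure F {D. internal ext d D \<and> D \<subseteq> F} (\<lambda>D. D)
        (\<lambda>D. ennreal (standard_part star ext (hdivide ext (hcard ext d D) (hcard ext d F)))))"


section \<open>Cuts and lower density along a cut\<close>

definition is_cut :: "(entity \<Rightarrow> 'b) \<Rightarrow> (entity list set \<Rightarrow> 'b list set) \<Rightarrow> 'b \<Rightarrow> 'b set \<Rightarrow> bool" where
  "is_cut star ext H U \<longleftrightarrow>
     U \<noteq> {} \<and> U \<subseteq> hinterval ext (star (num 1)) H \<and>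
     (\<forall>u\<in>U. \<forall>v\<in>hinterval ext (star (num 1)) H. hle ext v u \<longrightarrow> v \<in> U) \<and>
     (\<forall>u\<in>U. \<forall>v\<in>U. hplus ext u v \<in> U)"

definition symmetrized :: "(entity \<Rightarrow> 'b) \<Rightarrow> (entity list set \<Rightarrow> 'b list set) \<Rightarrow> 'b set \<Rightarrow> 'b set" where
  "symmetrized star ext U = huminus ext ` U \<union> {star (num 0)} \<union> U"

definition above :: "(entity list set \<Rightarrow> 'b list set) \<Rightarrow> 'b set \<Rightarrow> 'b set" where
  "above ext U = {v \<in> hypernats ext. \<forall>u\<in>U. hless ext u v}"

definition cut_liminf :: "(entity list set \<Rightarrow> 'b list set) \<Rightarrow> 'b set \<Rightarrow> ('b \<Rightarrow> real) \<Rightarrow> ereal" where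
  "cut_liminf ext U g =
     (SUP \<xi>\<in>above ext U. INF \<nu>\<in>{\<nu> \<in> above ext U. hless ext \<nu> \<xi>}. ereal (g \<nu>))"

definition cut_density ::
    "(entity \<Rightarrow> 'b) \<Rightarrow> (entity list set \<Rightarrow> 'b list set) \<Rightarrow> nat \<Rightarrow> 'b set \<Rightarrow> 'b list set \<Rightarrow> 'b list \<Rightarrow> ereal"
  where
  "cut_density star ext d U E x = cut_liminf ext U
     (\<lambda>\<nu>. let C = sumset ext {x} (hbox ext d \<nu>) in
        measure (loeb star ext d C)
          (sumset ext E (tuples d (symmetrized star ext U)) \<inter> C))"

end

theory Submission
  imports Defs
begin

text \<open>
  Write \<open>E\<^sub>u\<close> for the internal set \<open>E + [-u,u]\<^sup>d\<close>, so that \<open>A = E + \<U>\<^sup>d\<close> is the union of the \<open>E\<^sub>u\<close>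
  with \<open>u \<in> U\<close> and is contained in \<open>E\<^sub>v\<close> for every \<open>v > U\<close>. An increasing internal function with
  values in \<open>[0,1]\<close> cannot jump at \<open>U\<close> by a noninfinitesimal amount, for otherwise \<open>U\<close> would be
  internal. Hence \<open>A\<close> is Loeb measurable in every box, and for each \<open>\<delta> > 0\<close> there are \<open>u \<in> U\<close> and
  \<open>v > U\<close> such that \<open>E\<^sub>v - E\<^sub>u\<close> has relative size at most \<open>\<delta>\<close> in \<open>[-2H,2H]\<^sup>d\<close>.

  If \<open>x \<in> A\<close> has lower density less than \<open>\<rho> < 1\<close>, then some \<open>\<nu> > U\<close> with \<open>\<nu> < v / 2\<close> satisfies
  \<open>\<bar>E\<^sub>u \<inter> (x + [-\<nu>,\<nu>]\<^sup>d)\<bar> < \<rho> (2\<nu>+1)\<^sup>d\<close>, whereas the whole cube \<open>x + [-\<nu>,\<nu>]\<^sup>d\<close> lies in \<open>E\<^sub>v\<close>. By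
  Vitali's covering argument there are at most \<open>2\<^sup>d \<bar>E\<^sub>v - E\<^sub>u\<bar> / (1 - \<rho>)\<close> such points \<open>x\<close>, counted
  internally, so they are contained in internal sets of arbitrarily small Loeb measure.
\<close>

section \<open>Transfer and the types of internal tuples\<close>

text \<open>The universe is known only through transfer for formulas whose atoms are arbitrary
  standard relations; it need not be an ultrapower. Over finitely many parameters it behaves like
  one: the standard properties of the parameters form an ultrafilter \<open>ult\<close>, and
  numbers, points and internal sets determined by them are represented by standard functions or
  families along this filter. Transfer thus becomes reasoning with \<open>eventually\<close>:
  counting takes place among finitely many ordinary integer points and is applied to almost every
  instance, and a standard part is a limit along the filter. Only what refers to U stays external.
  This shapes the main argument: whatever is counted must be described without U, so the exceptional
  points are caught by asking for some radius n, not for a radius above U. The larger box [-2H,2H]^d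
  is there because v can be taken at most H, so that it contains all of E_v; the return to [-H,H]^d
  costs another factor 2^d.\<close>

lemma sat_foldr_Forall:
  "sat I (foldr Forall xs p) v \<longleftrightarrow> (\<forall>w. (\<forall>i. i \<notin> set xs \<longrightarrow> w i = v i) \<longrightarrow> sat I p w)"
proof (induction xs arbitrary: v)
  case Nil
  have "w = v" if "\<forall>i. w i = v i" for w using that by auto
  then show ?case by auto
next
  case (Cons a xs)
  show ?case
  proof
    assume "sat I (foldr Forall (a # xs) p) v"
    then have *: "sat I p w" if "\<forall>i. i \<notin> set xs \<longrightarrow> w i = (v(a := b)) i" for b w
      using \<open>sat I (foldr Forall (a # xs) p) v\<close> that by (auto simp add: Cons.IH simp del: fun_upd_apply)
    show "\<forall>w. (\<forall>i. i \<notin> set (a # xs) \<longrightarrow> w i = v i) \<longrightarrow> sat I p w"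
    proof (intro allI impI)
      fix w assume w: "\<forall>i. i \<notin> set (a # xs) \<longrightarrow> w i = v i"
      show "sat I p w"
        by (rule *[of w "w a"]) (use w in auto)
    qed
  qed (auto simp: Cons.IH)
qed

text \<open>Predicate symbols are sets of lists of mixed lengths. Cutting them down to one length
  makes relations that agree on this arity equal as sets, so that they can be rewritten under
  \<open>ext\<close>.\<close>

definition of_length :: "nat \<Rightarrow> ('a list \<Rightarrow> bool) \<Rightarrow> 'a list set" where
  "of_length n P = {xs. length xs = n \<and> P xs}"

definition Iff :: "'s formula \<Rightarrow> 's formula \<Rightarrow> 's formula" where
  "Iff p q = Conj (Neg (Conj p (Neg q))) (Neg (Conj q (Neg p)))"

lemma sat_Iff [simp]: "sat I (Iff p q) v \<longleftrightarrow> (sat I p v \<longleftrightarrow> sat I q v)"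
  by (auto simp: Iff_def)

lemma ex_length_Suc: "(\<exists>cs. length cs = Suc k \<and> Q cs) \<longleftrightarrow> (\<exists>b cs. length cs = k \<and> Q (b # cs))"
  by (metis length_Suc_conv)

section \<open>Splitting a concatenation back into blocks\<close>

primrec blocks :: "nat list \<Rightarrow> 'a list \<Rightarrow> 'a list list" where
  "blocks [] zs = []"
| "blocks (l # ls) zs = take l zs # blocks ls (drop l zs)"

lemma blocks_concat: "map length zss = ls \<Longrightarrow> blocks ls (concat zss) = zss"
  by (induction zss arbitrary: ls) auto

lemma concat_blocks: "length zs = sum_list ls \<Longrightarrow> concat (blocks ls zs) = zs"
  by (induction ls arbitrary: zs) auto

lemma map_length_blocks: "length zs = sum_list ls \<Longrightarrow> map length (blocks ls zs) = ls"
  by (induction ls arbitrary: zs) auto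

definition flat_index :: "nat list \<Rightarrow> nat \<times> nat \<Rightarrow> nat" where
  "flat_index ls = (\<lambda>(i, j). sum_list (take i ls) + j)"

lemma flat_index:
  "i < length zss \<Longrightarrow> j < length (zss ! i) \<Longrightarrow>
     concat zss ! flat_index (map length zss) (i, j) = zss ! i ! j \<and>
     flat_index (map length zss) (i, j) < length (concat zss)"
proof (induction zss arbitrary: i)
  case Nil
  then show ?case by simp
next
  case (Cons a zss)
  show ?case
  proof (cases i)
    case 0
    with Cons.prems show ?thesis by (auto simp: flat_index_def nth_append)
  next
    case (Suc k)
    with Cons.prems have "k < length zss" "j < length (zss ! k)" by auto
    from Cons.IH[OF this] Suc show ?thesis
      by (auto simp: flat_index_def nth_append)
  qed
qed

text \<open>A pattern \<open>iss\<close> of positions reads a new family of blocks off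
  \<open>zss\<close>, with repetition and regrouping allowed. Selecting blocks and isolating a
  coordinate of a point are both of this form.\<close>

definition entries :: "(nat \<times> nat) list list \<Rightarrow> 'a list list \<Rightarrow> 'a list list" where
  "entries iss zss = map (map (\<lambda>(i, j). zss ! i ! j)) iss"

section \<open>The extension map and the logical operations\<close>

context nonstandard_universe
begin

text \<open>The default is the image of a standard object because, outside the bound variables, a
  transferred valuation has the form \<open>star \<circ> v\<close>.\<close>

definition env :: "'b list \<Rightarrow> nat \<Rightarrow> 'b" where
  "env bs i = (if i < length bs then bs ! i else star undefined)"

lemma map_env: "map (env bs) [0..<length bs] = bs"
  by (rule nth_equalityI) (auto simp: env_def)

lemma map_env_nth: "set js \<subseteq> {..<length bs} \<Longrightarrow> map (env bs) js = map (nth bs) js"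
  by (auto simp: env_def subset_iff)

text \<open>Transfer speaks only of valuations by images of standard objects. Closing the formula
  universally first frees its variables to take arbitrary internal values.\<close>

lemma transfer_all:
  assumes "\<And>v. sat (\<lambda>R. R) p v"
  shows "sat ext p (env bs)"
proof -
  define v0 :: "nat \<Rightarrow> entity" where "v0 = (\<lambda>_. undefined)"
  have "sat (\<lambda>R. R) (foldr Forall [0..<length bs] p) v0"
    using assms by (simp add: sat_foldr_Forall)
  then have "sat ext (foldr Forall [0..<length bs] p) (star \<circ> v0)"
    using transfer[unfolded transfer_principle_def, rule_format,
      of "foldr Forall [0..<length bs] p" v0] by simp
  then have *: "(\<forall>i. i \<notin> set [0..<length bs] \<longrightarrow> w i = (star \<circ> v0) i) \<longrightarrow> sat ext p w" for w
    unfolding sat_foldr_Forall by (rule spec)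
  show ?thesis
    by (rule *[rule_format]) (simp add: env_def v0_def)
qed

text \<open>This and the next facts each transfer a valid biconditional between atoms. Every
  standard relation is itself a predicate symbol, so negation, conjunction, substitution of
  variables, equality and quantifiers can all be absorbed into the symbol.\<close>

lemma ext_not:
  "bs \<in> ext (of_length (length bs) (\<lambda>xs. \<not> P xs)) \<longleftrightarrow> bs \<notin> ext (of_length (length bs) P)"
  using transfer_all[of "Iff (Atom (of_length (length bs) (\<lambda>xs. \<not> P xs)) [0..<length bs])
      (Neg (Atom (of_length (length bs) P) [0..<length bs]))" bs]
  by (simp add: map_env) (simp add: of_length_def)

lemma ext_conj:
  "bs \<in> ext (of_length (length bs) (\<lambda>xs. P xs \<and> Q xs)) \<longleftrightarrow>
     bs \<in> ext (of_length (length bs) P) \<and> bs \<in> ext (of_length (length bs) Q)"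
  using transfer_all[of "Iff (Atom (of_length (length bs) (\<lambda>xs. P xs \<and> Q xs)) [0..<length bs])
      (Conj (Atom (of_length (length bs) P) [0..<length bs])
            (Atom (of_length (length bs) Q) [0..<length bs]))" bs]
  by (simp add: map_env) (auto simp: of_length_def)

lemma ext_nth:
  assumes js: "set js \<subseteq> {..<length bs}"
  shows "map (nth bs) js \<in> ext R \<longleftrightarrow> bs \<in> ext (of_length (length bs) (\<lambda>xs. map (nth xs) js \<in> R))"
proof -
  have eq: "map v js = map (nth (map v [0..<length bs])) js" for v :: "nat \<Rightarrow> entity"
    using js by (auto simp: subset_iff)
  have "sat (\<lambda>R. R) (Iff (Atom R js) (Atom (of_length (length bs) (\<lambda>xs. map (nth xs) js \<in> R))
      [0..<length bs])) v" for v
    by (simp add: of_length_def eq[symmetric] del: map_eq_conv)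
  from transfer_all[OF this, of bs] show ?thesis
    by (simp add: map_env map_env_nth[OF js])
qed

lemma ext_eq:
  assumes "i < length bs" "j < length bs"
  shows "bs ! i = bs ! j \<longleftrightarrow> bs \<in> ext (of_length (length bs) (\<lambda>xs. xs ! i = xs ! j))"
proof -
  have "sat (\<lambda>R. R) (Iff (Eql i j) (Atom (of_length (length bs) (\<lambda>xs. xs ! i = xs ! j))
      [0..<length bs])) v" for v
    using assms by (simp add: of_length_def)
  from transfer_all[OF this, of bs] have
    "env bs i = env bs j \<longleftrightarrow> bs \<in> ext (of_length (length bs) (\<lambda>xs. xs ! i = xs ! j))"
    unfolding sat_Iff sat.simps map_env .
  then show ?thesis
    using assms by (simp only: env_def if_True)
qed

lemma ext_ex1:
  "(\<exists>b. bs @ [b] \<in> ext (of_length (Suc (length bs)) P)) \<longleftrightarrow>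
     bs \<in> ext (of_length (length bs) (\<lambda>xs. \<exists>y. P (xs @ [y])))"
proof -
  let ?n = "length bs"
  have "sat (\<lambda>R. R) (Iff (Neg (Forall ?n (Neg (Atom (of_length (Suc ?n) P) [0..<Suc ?n]))))
      (Atom (of_length ?n (\<lambda>xs. \<exists>y. P (xs @ [y]))) [0..<?n])) v" for v
    by (simp add: of_length_def)
  from transfer_all[OF this, of bs] show ?thesis
    by (simp add: map_env del: map_map)
qed

lemma ext_ex:
  "(\<exists>cs. length cs = k \<and> bs @ cs \<in> ext (of_length (length bs + k) P)) \<longleftrightarrow>
     bs \<in> ext (of_length (length bs) (\<lambda>xs. \<exists>ys. length ys = k \<and> P (xs @ ys)))"
proof (induction k arbitrary: bs P)
  case 0
  then show ?case by simp
next
  case (Suc k)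
  have "(\<exists>cs. length cs = Suc k \<and> bs @ cs \<in> ext (of_length (length bs + Suc k) P)) \<longleftrightarrow>
     (\<exists>b cs. length cs = k \<and> (bs @ [b]) @ cs \<in> ext (of_length (length (bs @ [b]) + k) P))"
    by (simp add: ex_length_Suc)
  also have "\<dots> \<longleftrightarrow> (\<exists>b. bs @ [b] \<in> ext (of_length (Suc (length bs))
      (\<lambda>xs. \<exists>ys. length ys = k \<and> P (xs @ ys))))"
    using Suc.IH[of "bs @ [b]" P for b] by simp
  also have "\<dots> \<longleftrightarrow> bs \<in> ext (of_length (length bs) (\<lambda>xs. \<exists>y ys. length ys = k \<and> P (xs @ y # ys)))"
    by (simp add: ext_ex1)
  also have "(\<lambda>xs. \<exists>y ys. length ys = k \<and> P (xs @ y # ys)) =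
      (\<lambda>xs. \<exists>ys. length ys = Suc k \<and> P (xs @ ys))"
    by (simp add: ex_length_Suc fun_eq_iff)
  finally show ?case .
qed

lemma ext_star: "[star c] \<in> ext R \<longleftrightarrow> [c] \<in> R"
  using transfer[unfolded transfer_principle_def, rule_format, of "Atom R [0]" "\<lambda>_. c"] by simp

lemma ext_True: "bs \<in> ext (of_length (length bs) (\<lambda>_. True))"
  using ext_not[of bs "\<lambda>_. False"] ext_conj[of bs "\<lambda>_. True" "\<lambda>_. False"] by auto

lemma ext_mono:
  assumes "\<And>xs. length xs = length bs \<Longrightarrow> P xs \<Longrightarrow> Q xs" "bs \<in> ext (of_length (length bs) P)"
  shows "bs \<in> ext (of_length (length bs) Q)"
proof -
  have "of_length (length bs) P = of_length (length bs) (\<lambda>xs. P xs \<and> Q xs)"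
    using assms(1) by (auto simp: of_length_def)
  from assms(2)[unfolded this] show ?thesis
    by (simp only: ext_conj)
qed

text \<open>
  The type of a finite family of internal objects: the ultrafilter of the standard properties
  whose extensions hold of it. Arguments come in blocks so that single numbers
  (blocks of length one) and points of \<open>d\<close>-space (blocks of length \<open>d\<close>) are treated alike.
\<close>

definition ult :: "'b list list \<Rightarrow> entity list list filter" where
  "ult bss = Abs_filter (\<lambda>P. concat bss \<in>
     ext (of_length (length (concat bss)) (\<lambda>zs. P (blocks (map length bss) zs))))"

lemma eventually_ult:
  "eventually P (ult bss) \<longleftrightarrow> concat bss \<in>
     ext (of_length (length (concat bss)) (\<lambda>zs. P (blocks (map length bss) zs)))"
  unfolding ult_def
proof (rule eventually_Abs_filter, standard)
  let ?n = "length (concat bss)" and ?B = "blocks (map length bss)"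
  show "concat bss \<in> ext (of_length ?n (\<lambda>zs. True))" by (rule ext_True)
  show "concat bss \<in> ext (of_length ?n (\<lambda>zs. P (?B zs) \<and> Q (?B zs)))"
    if "concat bss \<in> ext (of_length ?n (\<lambda>zs. P (?B zs)))"
       "concat bss \<in> ext (of_length ?n (\<lambda>zs. Q (?B zs)))" for P Q
    using that by (simp only: ext_conj)
  show "concat bss \<in> ext (of_length ?n (\<lambda>zs. Q (?B zs)))"
    if "\<forall>x. P x \<longrightarrow> Q x" "concat bss \<in> ext (of_length ?n (\<lambda>zs. P (?B zs)))" for P Q
    by (rule ext_mono[OF _ that(2)]) (use that(1) in blast)
qed

text \<open>Maximality of the filter. With it \<open>eventually\<close> commutes with all
  connectives and acts as a truth predicate for statements about the internal objects
  \<open>bss\<close>.\<close>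

lemma ev_not: "eventually (\<lambda>zs. \<not> P zs) (ult bss) \<longleftrightarrow> \<not> eventually P (ult bss)"
  unfolding eventually_ult by (rule ext_not)

lemma ev_disj:
  "eventually (\<lambda>zs. P zs \<or> Q zs) (ult bss) \<longleftrightarrow> eventually P (ult bss) \<or> eventually Q (ult bss)"
  using ev_not[of "\<lambda>zs. P zs \<or> Q zs" bss] ev_not[of P bss] ev_not[of Q bss]
  by (auto simp: eventually_conj_iff)

lemma ev_length: "\<forall>\<^sub>F zs in ult bss. map length zs = map length bss"
  unfolding eventually_ult
  by (rule ext_mono[OF _ ext_True]) (simp add: map_length_blocks length_concat)

lemma ev_concat: "concat bss \<in> ext R \<longleftrightarrow> (\<forall>\<^sub>F zs in ult bss. concat zs \<in> R)"
proof -
  let ?n = "length (concat bss)"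
  have "concat bss \<in> ext R \<longleftrightarrow> map (nth (concat bss)) [0..<?n] \<in> ext R"
    by (simp only: map_nth)
  also have "\<dots> \<longleftrightarrow> concat bss \<in> ext (of_length ?n (\<lambda>xs. map (nth xs) [0..<?n] \<in> R))"
    by (rule ext_nth) auto
  also have "of_length ?n (\<lambda>xs. map (nth xs) [0..<?n] \<in> R) =
      of_length ?n (\<lambda>xs. concat (blocks (map length bss) xs) \<in> R)"
    by (auto simp: of_length_def length_concat concat_blocks) (metis map_nth)+
  finally show ?thesis
    by (simp only: eventually_ult)
qed

text \<open>The quantifier step of a Los theorem. It is the source of internal witnesses: what can
  be chosen in almost every standard instance is realized by an internal tuple.\<close>

lemma ev_ex:
  "(\<exists>c. length c = k \<and> eventually P (ult (bss @ [c]))) \<longleftrightarrow>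
     (\<forall>\<^sub>F zs in ult bss. \<exists>y. length y = k \<and> P (zs @ [y]))"
proof -
  let ?ls = "map length bss" and ?n = "length (concat bss)"
  have blocks_append: "blocks (?ls @ [k]) (xs @ ys) = blocks ?ls xs @ [ys]"
    if "length xs = ?n" "length ys = k" for xs ys :: "entity list"
    using that blocks_concat[of "blocks ?ls xs @ [ys]" "?ls @ [k]"]
    by (simp add: length_concat map_length_blocks concat_blocks)
  have "(\<exists>c. length c = k \<and> eventually P (ult (bss @ [c]))) \<longleftrightarrow>
     (\<exists>c. length c = k \<and> concat bss @ c \<in> ext (of_length (?n + k) (\<lambda>zs. P (blocks (?ls @ [k]) zs))))"
    unfolding eventually_ult by (intro ex_cong1) auto
  also have "\<dots> \<longleftrightarrow> concat bss \<in> ext (of_length ?n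
      (\<lambda>xs. \<exists>ys. length ys = k \<and> P (blocks (?ls @ [k]) (xs @ ys))))"
    by (rule ext_ex)
  also have "of_length ?n (\<lambda>xs. \<exists>ys. length ys = k \<and> P (blocks (?ls @ [k]) (xs @ ys))) =
      of_length ?n (\<lambda>xs. \<exists>ys. length ys = k \<and> P (blocks ?ls xs @ [ys]))"
    using blocks_append by (fastforce simp: of_length_def)
  finally show ?thesis
    by (simp only: eventually_ult)
qed

text \<open>Selection of entries is a substitution of variables, and this commutes with
  \<open>ext\<close>; hence the type of the selected family is the image of the original
  type.\<close>

lemma ult_entries:
  assumes "\<And>i j. (i, j) \<in> set (concat iss) \<Longrightarrow> i < length bss \<and> j < length (bss ! i)"
  shows "ult (entries iss bss) = filtermap (entries iss) (ult bss)"
proof (rule filter_eqI)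
  fix P :: "entity list list \<Rightarrow> bool"
  let ?ls = "map length bss" and ?n = "length (concat bss)"
  define js where "js = map (flat_index ?ls) (concat iss)"
  have flat: "map (nth (concat zss)) js = concat (entries iss zss)"
    if "map length zss = ?ls" for zss :: "'c list list"
  proof -
    have "length zss = length bss" using that map_eq_imp_length_eq by blast
    moreover have "length (zss ! i) = length (bss ! i)" if "i < length bss" for i
      using \<open>map length zss = ?ls\<close> that \<open>length zss = length bss\<close> by (metis nth_map)
    ultimately have "concat zss ! flat_index ?ls (i, j) = zss ! i ! j" if "(i, j) \<in> set (concat iss)" for i j
      using assms[OF that] flat_index[of i zss j] \<open>map length zss = ?ls\<close> by auto
    then have "map (nth (concat zss)) js = map (\<lambda>(i, j). zss ! i ! j) (concat iss)"
      by (auto simp: js_def)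
    then show ?thesis by (simp add: entries_def map_concat)
  qed
  have js: "set js \<subseteq> {..<?n}"
    using assms flat_index by (fastforce simp: js_def)
  have lens: "map length (entries iss zss) = map length iss" for zss :: "'c list list"
    by (simp add: entries_def)
  have len_js: "length (concat (entries iss bss)) = length js"
    using flat[of bss] by (metis length_map)
  have *: "map (nth zs) js \<in> of_length (length js) (\<lambda>zs. P (blocks (map length iss) zs)) \<longleftrightarrow>
      P (entries iss (blocks ?ls zs))" if "length zs = ?n" for zs
  proof -
    have "map length (blocks ?ls zs) = ?ls" "concat (blocks ?ls zs) = zs"
      using that by (simp_all add: map_length_blocks concat_blocks length_concat)
    with flat[of "blocks ?ls zs"] have "map (nth zs) js = concat (entries iss (blocks ?ls zs))"
      by simp
    then show ?thesis
      using blocks_concat[OF lens, of "blocks ?ls zs"]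
      by (simp add: of_length_def) (metis length_map)
  qed
  have "eventually P (ult (entries iss bss)) \<longleftrightarrow>
      map (nth (concat bss)) js \<in> ext (of_length (length js) (\<lambda>zs. P (blocks (map length iss) zs)))"
    by (simp only: eventually_ult flat[of bss] len_js) (simp add: entries_def comp_def)
  also have "\<dots> \<longleftrightarrow> concat bss \<in> ext (of_length ?n
      (\<lambda>zs. map (nth zs) js \<in> of_length (length js) (\<lambda>zs. P (blocks (map length iss) zs))))"
    by (rule ext_nth[OF js])
  also have "of_length ?n (\<lambda>zs. map (nth zs) js \<in> of_length (length js) (\<lambda>zs. P (blocks (map length iss) zs)))
      = of_length ?n (\<lambda>zs. P (entries iss (blocks ?ls zs)))"
    using * by (auto simp: of_length_def)
  also have "concat bss \<in> ext (of_length ?n (\<lambda>zs. P (entries iss (blocks ?ls zs)))) \<longleftrightarrow>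
      eventually P (filtermap (entries iss) (ult bss))"
    by (simp only: eventually_ult eventually_filtermap)
  finally show "eventually P (ult (entries iss bss)) \<longleftrightarrow>
      eventually P (filtermap (entries iss) (ult bss))" .
qed

lemma ult_sub:
  assumes "set js \<subseteq> {..<length bss}"
  shows "ult (map (nth bss) js) = filtermap (\<lambda>zs. map (nth zs) js) (ult bss)"
proof -
  define iss where "iss = map (\<lambda>i. map (Pair i) [0..<length (bss ! i)]) js"
  have entries: "entries iss zs = map (nth zs) js" if "map length zs = map length bss" for zs :: "'c list list"
  proof -
    have "length zs = length bss" using that map_eq_imp_length_eq by blast
    then have "length (zs ! i) = length (bss ! i)" if "i \<in> set js" for i
      using that assms \<open>map length zs = map length bss\<close> by (metis lessThan_iff nth_map subsetD)
    then show ?thesis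
      by (auto simp: entries_def iss_def comp_def intro: nth_equalityI)
  qed
  have "ult (map (nth bss) js) = ult (entries iss bss)"
    using entries[of bss] by simp
  also have "\<dots> = filtermap (entries iss) (ult bss)"
    by (rule ult_entries) (use assms in \<open>auto simp: iss_def subset_iff\<close>)
  also have "\<dots> = filtermap (\<lambda>zs. map (nth zs) js) (ult bss)"
  proof (rule filter_eqI)
    show "eventually P (filtermap (entries iss) (ult bss)) \<longleftrightarrow>
        eventually P (filtermap (\<lambda>zs. map (nth zs) js) (ult bss))" for P
      unfolding eventually_filtermap
      using ev_length[of bss] by (rule eventually_cong) (simp add: entries)
  qed
  finally show ?thesis .
qed

lemma ev_sub:
  assumes "eventually P (ult (map (nth bss) js))" "set js \<subseteq> {..<length bss}"
  shows "\<forall>\<^sub>F zs in ult bss. P (map (nth zs) js)"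
  using assms by (simp add: ult_sub eventually_filtermap)

lemma ev_eq: "b = c \<longleftrightarrow> (\<forall>\<^sub>F zs in ult [b, c]. zs ! 0 = zs ! 1)"
proof
  assume "b = c"
  then have "ult [b, c] = filtermap (\<lambda>zs. [zs ! 0, zs ! 0]) (ult [b])"
    using ult_sub[of "[0, 0]" "[b]"] by simp
  then show "\<forall>\<^sub>F zs in ult [b, c]. zs ! 0 = zs ! 1"
    by (simp add: eventually_filtermap)
next
  assume *: "\<forall>\<^sub>F zs in ult [b, c]. zs ! 0 = zs ! 1"
  have "\<forall>\<^sub>F zs in ult [b, c]. length b = length c"
    using * ev_length[of "[b, c]"]
  proof eventually_elim
    case (elim zs)
    then obtain y z where "zs = [y, z]" by (auto simp: map_eq_Cons_conv)
    with elim show ?case by simp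
  qed
  then have len: "length b = length c"
    using ev_not[of "\<lambda>_. False" "[b, c]"] by (cases "length b = length c") auto
  let ?n = "length b"
  show "b = c"
  proof (rule nth_equalityI[OF len])
    fix i assume i: "i < length b"
    have "(b @ c) ! i = (b @ c) ! (?n + i) \<longleftrightarrow>
        b @ c \<in> ext (of_length (length (b @ c)) (\<lambda>xs. xs ! i = xs ! (?n + i)))"
      by (rule ext_eq) (use i len in auto)
    moreover have "b @ c \<in> ext (of_length (length (b @ c)) (\<lambda>xs. xs ! i = xs ! (?n + i)))"
    proof (rule ext_mono)
      show "b @ c \<in> ext (of_length (length (b @ c))
          (\<lambda>xs. take ?n xs = take (length c) (drop ?n xs)))"
        using *[unfolded eventually_ult] by simp
      show "xs ! i = xs ! (?n + i)"
        if "length xs = length (b @ c)" "take ?n xs = take (length c) (drop ?n xs)" for xs :: "entity list"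
        using that i len by (metis nth_drop nth_take length_append le_add1)
    qed
    ultimately show "b ! i = c ! i"
      using i by (simp add: nth_append)
  qed
qed

lemma ev_const: "(\<forall>\<^sub>F zs in ult bss. Q) \<longleftrightarrow> Q"
  using ev_not[of "\<lambda>_. False" bss] by (cases Q) auto

end

section \<open>Values of standard functions at internal tuples\<close>

definition num_inv :: "entity \<Rightarrow> real" where
  "num_inv = inv num"

lemma num_inv_num [simp]: "num_inv (num r) = r"
  unfolding num_inv_def by (rule inv_f_f) (simp add: inj_def num_def)

lemma num_eq_iff [simp]: "num r = num s \<longleftrightarrow> r = s"
  by (simp add: num_def)

definition pt :: "int list \<Rightarrow> entity list" where
  "pt = map (\<lambda>i. num (of_int i))"

definition pt_inv :: "entity list \<Rightarrow> int list" where
  "pt_inv = map (\<lambda>e. \<lfloor>num_inv e\<rfloor>)"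

lemma pt_inv_pt [simp]: "pt_inv (pt z) = z"
  by (simp add: pt_def pt_inv_def comp_def)

lemma pt_eq_iff [simp]: "pt y = pt z \<longleftrightarrow> y = z"
  by (metis pt_inv_pt)

lemma length_pt [simp]: "length (pt z) = length z"
  by (simp add: pt_def)

lemma length_pt_inv [simp]: "length (pt_inv z) = length z"
  by (simp add: pt_inv_def)

lemma pt_image_iff [simp]: "pt z \<in> pt ` Y \<longleftrightarrow> z \<in> Y"
  by auto

definition mem :: "entity \<Rightarrow> entity list set" where
  "mem e = {xs. e # xs \<in> membership}"

text \<open>There is one \<open>Elem\<close> fewer than in \<open>pt\<close>: entries of a relation
  live one level below the entities, and \<open>membership\<close> supplies the missing
  \<open>Elem\<close>.\<close>

definition code :: "int list set \<Rightarrow> entity" where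
  "code Y = Rel (map (\<lambda>i. Elem (of_int i)) ` Y)"

text \<open>Total on entities: it is empty at an entity that is not a relation, and it ignores
  tuples that are not integer points of dimension \<open>d\<close>. So instances of a code can be
  used without a side condition.\<close>

definition zset :: "nat \<Rightarrow> entity \<Rightarrow> int list set" where
  "zset d e = {z. length z = d \<and> pt z \<in> mem e}"

lemma mem_code [simp]: "mem (code Y) = pt ` Y"
  by (force simp: mem_def code_def membership_def pt_def num_def)

lemma card_code: "card (map (\<lambda>i. Elem (real_of_int i)) ` Y) = card Y"
  by (intro card_image inj_onI) (auto dest!: map_injective simp: inj_def)

context nonstandard_universe
begin

lemma ev_take: "eventually P (ult bss) \<longleftrightarrow> (\<forall>\<^sub>F zs in ult (bss @ cs). P (take (length bss) zs))"
proof -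
  have "map (nth (bss @ cs)) [0..<length bss] = bss"
    by (rule nth_equalityI) (auto simp: nth_append)
  then have "ult bss = filtermap (\<lambda>zs. map (nth zs) [0..<length bss]) (ult (bss @ cs))"
    using ult_sub[of "[0..<length bss]" "bss @ cs"] by (auto simp: subset_iff)
  then have "eventually P (ult bss) \<longleftrightarrow>
      (\<forall>\<^sub>F zs in ult (bss @ cs). P (map (nth zs) [0..<length bss]))"
    by (metis eventually_filtermap)
  also have "\<dots> \<longleftrightarrow> (\<forall>\<^sub>F zs in ult (bss @ cs). P (take (length bss) zs))"
    using ev_length[of "bss @ cs"]
  proof (rule eventually_cong)
    fix zs :: "entity list list" assume "map length zs = map length (bss @ cs)"
    then have "length zs = length (bss @ cs)" by (rule map_eq_imp_length_eq)
    then have "map (nth zs) [0..<length bss] = take (length bss) zs"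
      by (intro nth_equalityI) auto
    then show "P (map (nth zs) [0..<length bss]) \<longleftrightarrow> P (take (length bss) zs)"
      by simp
  qed
  finally show ?thesis .
qed

lemma ev_drop: "eventually P (ult cs) \<longleftrightarrow> (\<forall>\<^sub>F zs in ult (bss @ cs). P (drop (length bss) zs))"
proof -
  let ?js = "[length bss..<length bss + length cs]"
  have "map (nth (bss @ cs)) ?js = cs"
    by (rule nth_equalityI) (auto simp: nth_append)
  then have "ult cs = filtermap (\<lambda>zs. map (nth zs) ?js) (ult (bss @ cs))"
    using ult_sub[of ?js "bss @ cs"] by (auto simp: subset_iff)
  then have "eventually P (ult cs) \<longleftrightarrow> (\<forall>\<^sub>F zs in ult (bss @ cs). P (map (nth zs) ?js))"
    by (metis eventually_filtermap)
  also have "\<dots> \<longleftrightarrow> (\<forall>\<^sub>F zs in ult (bss @ cs). P (drop (length bss) zs))"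
    using ev_length[of "bss @ cs"]
  proof (rule eventually_cong)
    fix zs :: "entity list list" assume "map length zs = map length (bss @ cs)"
    then have "length zs = length (bss @ cs)" by (rule map_eq_imp_length_eq)
    then have "map (nth zs) ?js = drop (length bss) zs"
      by (intro nth_equalityI) auto
    then show "P (map (nth zs) ?js) \<longleftrightarrow> P (drop (length bss) zs)"
      by simp
  qed
  finally show ?thesis .
qed

lemma ev_nth_length:
  "\<forall>\<^sub>F zs in ult bss. length zs = length bss \<and> (\<forall>i<length bss. length (zs ! i) = length (bss ! i))"
  using ev_length[of bss]
proof eventually_elim
  case (elim zs)
  then have "length zs = length bss" by (rule map_eq_imp_length_eq)
  with elim show ?case by (metis nth_map)
qed

lemma ev_snoc:
  "\<forall>\<^sub>F zs in ult (bss @ [c]). length zs = Suc (length bss) \<and> take (length bss) zs = butlast zs \<and>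
     drop (length bss) zs = [last zs] \<and> zs = butlast zs @ [last zs] \<and> length (last zs) = length c"
  using ev_nth_length[of "bss @ [c]"]
proof eventually_elim
  case (elim zs)
  then have "zs \<noteq> []" by auto
  then obtain ys y where zs: "zs = ys @ [y]" by (metis rev_exhaust)
  with elim show ?case
    by (auto simp: nth_append dest: spec[of _ "length bss"])
qed

lemma ev_butlast: "eventually P (ult bss) \<longleftrightarrow> (\<forall>\<^sub>F zs in ult (bss @ [c]). P (butlast zs))"
  unfolding ev_take[of P bss "[c]"]
  using ev_snoc[of bss c] by (rule eventually_cong) simp

text \<open>The block \<open>b\<close> is the value at \<open>bss\<close> of the extension of the standard function \<open>f\<close>.\<close>

definition val :: "'b list list \<Rightarrow> 'b list \<Rightarrow> (entity list list \<Rightarrow> entity list) \<Rightarrow> bool" where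
  "val bss b f \<longleftrightarrow> (\<forall>\<^sub>F zs in ult (bss @ [b]). last zs = f (butlast zs))"

lemma val_ex:
  assumes "\<forall>\<^sub>F zs in ult bss. length (f zs) = k"
  obtains b where "length b = k" "val bss b f"
proof -
  have "\<forall>\<^sub>F zs in ult bss. \<exists>y. length y = k \<and> last (zs @ [y]) = f (butlast (zs @ [y]))"
    using assms by eventually_elim auto
  then have "\<exists>c. length c = k \<and> val bss c f"
    unfolding val_def by (subst ev_ex)
  then show ?thesis
    using that by blast
qed

text \<open>A value of a standard function adds nothing to the type: each property of the longer
  list is a property of the parameters alone.\<close>

lemma val_snoc:
  assumes "val bss b f"
  shows "eventually P (ult (bss @ [b])) \<longleftrightarrow> (\<forall>\<^sub>F zs in ult bss. P (zs @ [f zs]))"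
  unfolding ev_butlast[of "\<lambda>zs. P (zs @ [f zs])" bss b]
proof -
  have "\<forall>\<^sub>F zs in ult (bss @ [b]). zs = butlast zs @ [f (butlast zs)]"
    using assms[unfolded val_def] ev_snoc[of bss b] by eventually_elim metis
  then show "eventually P (ult (bss @ [b])) \<longleftrightarrow>
      (\<forall>\<^sub>F zs in ult (bss @ [b]). P (butlast zs @ [f (butlast zs)]))"
    by (rule eventually_cong) metis
qed

lemma val_sub:
  assumes "set js \<subseteq> {..<length bss}" "val (map (nth bss) js) b f"
  shows "val bss b (\<lambda>zs. f (map (nth zs) js))"
proof -
  let ?js = "js @ [length bss]"
  have js: "map (nth (bss @ [b])) js = map (nth bss) js" "set ?js \<subseteq> {..<length (bss @ [b])}"
    using assms(1) by (auto simp: nth_append subset_iff)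
  have "\<forall>\<^sub>F zs in ult (map (nth (bss @ [b])) ?js). last zs = f (butlast zs)"
    using assms(2) unfolding val_def by (simp add: js(1))
  from ev_sub[OF this js(2)] have "\<forall>\<^sub>F zs in ult (bss @ [b]).
      zs ! length bss = f (map (nth zs) js)"
    by simp
  then show ?thesis
    unfolding val_def using ev_snoc[of bss b]
  proof eventually_elim
    case (elim zs)
    then have "zs ! length bss = last zs" by (metis nth_append_length length_butlast diff_Suc_1)
    moreover have "map (nth zs) js = map (nth (butlast zs)) js"
      using assms(1) elim by (auto simp: nth_butlast subset_iff)
    ultimately show ?case using elim by metis
  qed
qed

lemma val_weaken:
  assumes "val bss b f"
  shows "val (bss @ cs) b (\<lambda>zs. f (take (length bss) zs))"
proof -
  have "map (nth (bss @ cs)) [0..<length bss] = bss"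
    by (rule nth_equalityI) (auto simp: nth_append)
  then have "val (bss @ cs) b (\<lambda>zs. f (map (nth zs) [0..<length bss]))"
    using assms val_sub[of "[0..<length bss]" "bss @ cs" b f] by (auto simp: subset_iff)
  then have *: "\<forall>\<^sub>F zs in ult ((bss @ cs) @ [b]). last zs = f (map (nth (butlast zs)) [0..<length bss])"
    unfolding val_def .
  show ?thesis
    unfolding val_def using * ev_snoc[of "bss @ cs" b]
  proof eventually_elim
    case (elim zs)
    then have "length (butlast zs) = length (bss @ cs)" by simp
    then have "map (nth (butlast zs)) [0..<length bss] = take (length bss) (butlast zs)"
      by (intro nth_equalityI) auto
    with elim show ?case by simp
  qed
qed

lemma val_cong:
  assumes "\<forall>\<^sub>F zs in ult bss. f zs = g zs"
  shows "val bss b f \<longleftrightarrow> val bss b g"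
  unfolding val_def
  using assms[unfolded ev_butlast[of _ bss b]] by (rule eventually_cong) simp

lemma val_list:
  assumes "list_all2 (val bss) bs fs"
  shows "eventually P (ult (bss @ bs)) \<longleftrightarrow> (\<forall>\<^sub>F zs in ult bss. P (zs @ map (\<lambda>f. f zs) fs))"
  using assms
proof (induction bs arbitrary: fs P rule: rev_induct)
  case Nil
  then show ?case by simp
next
  case (snoc b bs)
  from snoc.prems obtain gs g where fs: "fs = gs @ [g]" and gs: "list_all2 (val bss) bs gs" "val bss b g"
    by (auto simp: list_all2_append1 list_all2_Cons1)
  have "eventually P (ult ((bss @ bs) @ [b])) \<longleftrightarrow>
      (\<forall>\<^sub>F zs in ult (bss @ bs). P (zs @ [g (take (length bss) zs)]))"
    by (rule val_snoc[OF val_weaken[OF gs(2)]])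
  also have "\<dots> \<longleftrightarrow> (\<forall>\<^sub>F zs in ult bss. P ((zs @ map (\<lambda>f. f zs) gs) @
      [g (take (length bss) (zs @ map (\<lambda>f. f zs) gs))]))"
    by (rule snoc.IH[OF gs(1)])
  also have "\<dots> \<longleftrightarrow> (\<forall>\<^sub>F zs in ult bss. P (zs @ map (\<lambda>f. f zs) fs))"
    using ev_nth_length[of bss] by (rule eventually_cong) (simp add: fs)
  finally show ?case by simp
qed

text \<open>Change of parameters. Later arguments put all objects in play into one list
  \<open>bss\<close> and pull every known fact back to its type, where the facts can be combined by
  \<open>eventually_elim\<close>.\<close>

lemma val_ev:
  assumes "list_all2 (val bss) bs fs"
  shows "eventually P (ult bs) \<longleftrightarrow> (\<forall>\<^sub>F zs in ult bss. P (map (\<lambda>f. f zs) fs))"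
  unfolding ev_drop[of P bs bss] val_list[OF assms]
  using ev_nth_length[of bss] by (rule eventually_cong) simp

lemma val_ext:
  assumes "list_all2 (val bss) bs fs"
  shows "concat bs \<in> ext R \<longleftrightarrow> (\<forall>\<^sub>F zs in ult bss. concat (map (\<lambda>f. f zs) fs) \<in> R)"
  unfolding ev_concat val_ev[OF assms] ..

lemma val_eq_iff:
  assumes "val bss b f" "val bss c g"
  shows "b = c \<longleftrightarrow> (\<forall>\<^sub>F zs in ult bss. f zs = g zs)"
  using val_ev[of bss "[b, c]" "[f, g]" "\<lambda>zs. zs ! 0 = zs ! 1"] assms by (simp add: ev_eq)

lemma val_unique: "val bss b f \<Longrightarrow> val bss c f \<Longrightarrow> b = c"
  by (simp add: val_eq_iff[of bss b f c f])

lemma val_length: "val bss b f \<Longrightarrow> \<forall>\<^sub>F zs in ult bss. length (f zs) = length b"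
  unfolding val_def ev_butlast[of _ bss b] using ev_snoc[of bss b] eventually_elim2 by force

lemma val_nth: "i < length bss \<Longrightarrow> val bss (bss ! i) (\<lambda>zs. zs ! i)"
proof -
  assume i: "i < length bss"
  have "val [bss ! i] (bss ! i) (\<lambda>zs. zs ! 0)"
  proof -
    have "\<forall>\<^sub>F zs in ult [bss ! i, bss ! i]. zs ! 0 = zs ! 1"
      using ev_eq by blast
    then have "\<forall>\<^sub>F zs in ult [bss ! i, bss ! i]. last zs = butlast zs ! 0"
      using ev_nth_length[of "[bss ! i, bss ! i]"]
      by eventually_elim (auto simp: length_Suc_conv)
    then show ?thesis
      by (simp add: val_def)
  qed
  with val_sub[of "[i]" bss "bss ! i" "\<lambda>zs. zs ! 0"] i show ?thesis by simp
qed

lemma val_last: "val (bss @ [c]) c last"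
proof -
  have "val (bss @ [c]) c (\<lambda>zs. zs ! length bss)"
    using val_nth[of "length bss" "bss @ [c]"] by simp
  moreover have "\<forall>\<^sub>F zs in ult (bss @ [c]). zs ! length bss = last zs"
    using ev_snoc[of bss c] by eventually_elim (metis nth_append_length length_butlast diff_Suc_1)
  ultimately show ?thesis
    by (rule val_cong[THEN iffD1, rotated])
qed

lemma val_butlast: "val bss b f \<Longrightarrow> val (bss @ [c]) b (\<lambda>zs. f (butlast zs))"
proof -
  assume "val bss b f"
  then have "val (bss @ [c]) b (\<lambda>zs. f (take (length bss) zs))" by (rule val_weaken)
  moreover have "\<forall>\<^sub>F zs in ult (bss @ [c]). f (take (length bss) zs) = f (butlast zs)"
    using ev_snoc[of bss c] by eventually_elim simp
  ultimately show ?thesis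
    by (rule val_cong[THEN iffD1, rotated])
qed

lemma list_all2_butlast:
  "list_all2 (val bss) bs fs \<Longrightarrow>
     list_all2 (val (bss @ [c])) bs (map (\<lambda>f zs. f (butlast zs)) fs)"
  by (auto simp: list_all2_conv_all_nth intro: val_butlast)

lemma val_comp:
  assumes "list_all2 (val bss) bs fs" "val bs c g"
  shows "val bss c (\<lambda>zs. g (map (\<lambda>f. f zs) fs))"
proof -
  let ?h = "\<lambda>zs. g (map (\<lambda>f. f zs) fs)"
  have "\<forall>\<^sub>F zs in ult bss. length (?h zs) = length c"
    using val_length[OF assms(2)] unfolding val_ev[OF assms(1)] .
  then obtain c' where c': "val bss c' ?h" by (rule val_ex)
  then have "list_all2 (val bss) (bs @ [c']) (fs @ [?h])"
    using assms(1) by (simp add: list_all2_appendI)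
  from val_ev[OF this, of "\<lambda>zs. last zs = g (butlast zs)"] have "val bs c' g"
    unfolding val_def by simp
  with assms(2) c' show ?thesis
    using val_unique by blast
qed

text \<open>Together with \<open>val_of_coords\<close> this passes between a point and its
  coordinates: boxes and sums are defined entry by entry, whereas the counting treats points as
  wholes.\<close>

lemma val_coord:
  assumes "val bss b f" "i < length b"
  shows "val bss [b ! i] (\<lambda>zs. [f zs ! i])"
proof -
  have "ult [b, [b ! i]] = filtermap (entries [map (Pair 0) [0..<length b], [(0, i)]]) (ult [b])"
  proof -
    have "entries [map (Pair 0) [0..<length b], [(0, i)]] [b] = [b, [b ! i]]"
      by (simp add: entries_def comp_def map_nth)
    with ult_entries[of "[map (Pair 0) [0..<length b], [(0, i)]]" "[b]"] assms(2) show ?thesis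
      by fastforce
  qed
  moreover have "\<forall>\<^sub>F zs in ult [b]. last (entries [map (Pair 0) [0..<length b], [(0, i)]] zs) =
      [butlast (entries [map (Pair 0) [0..<length b], [(0, i)]] zs) ! 0 ! i]"
    using ev_nth_length[of "[b]"] by eventually_elim (use assms(2) in \<open>auto simp: entries_def\<close>)
  ultimately have "val [b] [b ! i] (\<lambda>zs. [zs ! 0 ! i])"
    by (simp add: val_def eventually_filtermap)
  from val_comp[OF _ this, of bss "[f]"] assms(1) show ?thesis by simp
qed

lemma val_of_coords:
  assumes "\<And>i. i < length b \<Longrightarrow> val bss [b ! i] (\<lambda>zs. [f zs ! i])"
    and "\<forall>\<^sub>F zs in ult bss. length (f zs) = length b"
  shows "val bss b f"
proof -
  obtain c where c: "length c = length b" "val bss c f"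
    using assms(2) by (rule val_ex)
  have "c = b"
    by (rule nth_equalityI[OF c(1)]) (metis assms(1) c val_coord val_unique list.inject)
  with c show ?thesis by simp
qed

text \<open>The singleton relation \<open>{[c]}\<close> is a predicate symbol too, and its extension
  holds of \<open>star c\<close>.\<close>

lemma val_star: "val bss [star c] (\<lambda>_. [c])"
proof -
  have "concat [[star c]] \<in> ext {[c]}" by (simp add: ext_star)
  then have "\<forall>\<^sub>F zs in ult [[star c]]. zs ! 0 = [c]"
    unfolding ev_concat using ev_nth_length[of "[[star c]]"]
    by eventually_elim (auto simp: length_Suc_conv)
  have "\<forall>\<^sub>F zs in ult [[star c]]. last zs = [c]"
    using \<open>\<forall>\<^sub>F zs in ult [[star c]]. zs ! 0 = [c]\<close> ev_nth_length[of "[[star c]]"]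
    by eventually_elim (auto simp: length_Suc_conv)
  then have "val [] [star c] (\<lambda>_. [c])"
    by (simp add: val_def)
  from val_weaken[OF this, of bss] show ?thesis by simp
qed

text \<open>Hyperreal operations and internal cardinality are definite descriptions over the
  extended graph of a standard function. Existence is \<open>val_ex\<close>, uniqueness is
  \<open>val_unique\<close>, and the described object turns out to be the expected value.\<close>

lemma val_THE:
  assumes "list_all2 (val bss) bs fs"
    and "\<forall>\<^sub>F zs in ult bss. \<forall>y. concat (map (\<lambda>f. f zs) fs) @ [y] \<in> R \<longleftrightarrow> y = h zs"
  shows "val bss [THE z. concat bs @ [z] \<in> ext R] (\<lambda>zs. [h zs])"
proof -
  obtain c where "length c = 1" "val bss c (\<lambda>zs. [h zs])"
    by (rule val_ex[of "\<lambda>zs. [h zs]" 1 bss]) auto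
  then obtain z where z: "val bss [z] (\<lambda>zs. [h zs])" by (auto simp: length_Suc_conv)
  have iff: "concat bs @ [z'] \<in> ext R \<longleftrightarrow> val bss [z'] (\<lambda>zs. [h zs])" for z'
  proof -
    have "list_all2 (val (bss @ [[z']])) (bs @ [[z']]) (map (\<lambda>f zs. f (butlast zs)) fs @ [last])"
      by (intro list_all2_appendI list_all2_butlast assms(1)) (simp add: val_last)
    from val_ext[OF this, of R] have "concat bs @ [z'] \<in> ext R \<longleftrightarrow>
        (\<forall>\<^sub>F zs in ult (bss @ [[z']]). concat (map (\<lambda>f. f (butlast zs)) fs) @ last zs \<in> R)"
      by (simp add: comp_def)
    also have "\<dots> \<longleftrightarrow> (\<forall>\<^sub>F zs in ult (bss @ [[z']]). last zs = [h (butlast zs)])"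
      using eventually_conj[OF assms(2)[unfolded ev_butlast[of _ bss "[z']"]] ev_snoc[of bss "[z']"]]
      by (rule eventually_cong) (auto simp: length_Suc_conv)
    finally show ?thesis by (simp add: val_def)
  qed
  have "(THE z. concat bs @ [z] \<in> ext R) = z"
    by (rule the_equality) (use z iff val_unique in blast)+
  with z show ?thesis by simp
qed

end

section \<open>Hyperreal arithmetic and internal sets\<close>

lemma pt_singleton [simp]: "pt [k] = [num (of_int k)]"
  by (simp add: pt_def)

lemma range_pt_iff: "xs \<in> range pt \<longleftrightarrow> (\<forall>i<length xs. \<exists>k. xs ! i = num (of_int k))"
proof
  assume "\<forall>i<length xs. \<exists>k::int. xs ! i = num (of_int k)"
  then obtain k :: "nat \<Rightarrow> int" where "\<forall>i<length xs. xs ! i = num (of_int (k i))"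
    by metis
  then have "xs = pt (map k [0..<length xs])"
    by (intro nth_equalityI) (auto simp: pt_def)
  then show "xs \<in> range pt" by blast
qed (auto simp: pt_def)

lemma range_pt_imp: "xs \<in> range pt \<Longrightarrow> pt (pt_inv xs) = xs"
  by auto

lemma mem_membership: "b # xs \<in> membership \<longleftrightarrow> xs \<in> mem b"
  by (simp add: mem_def)

context nonstandard_universe
begin

lemma ult_neq_bot [simp]: "ult bss \<noteq> bot"
  using ev_const[of False bss] by (metis eventually_bot)

lemma ev_iff:
  "(\<forall>\<^sub>F zs in ult bss. P zs \<longleftrightarrow> Q zs) \<longleftrightarrow> (eventually P (ult bss) \<longleftrightarrow> eventually Q (ult bss))"
proof (cases "eventually P (ult bss)")
  case True
  then have "(\<forall>\<^sub>F zs in ult bss. P zs \<longleftrightarrow> Q zs) \<longleftrightarrow> eventually Q (ult bss)"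
    by (rule eventually_cong) simp
  with True show ?thesis by simp
next
  case False
  then have "\<forall>\<^sub>F zs in ult bss. \<not> P zs" by (simp only: ev_not not_False_eq_True)
  then have "(\<forall>\<^sub>F zs in ult bss. P zs \<longleftrightarrow> Q zs) \<longleftrightarrow> (\<forall>\<^sub>F zs in ult bss. \<not> Q zs)"
    by (rule eventually_cong) simp
  with False show ?thesis by (simp add: ev_not)
qed

text \<open>A bounded function converges along an ultrafilter; the limit is the supremum of its
  eventual lower bounds.\<close>

lemma ev_tendsto:
  fixes p :: "entity list list \<Rightarrow> real"
  assumes "\<forall>\<^sub>F zs in ult bss. 0 \<le> p zs \<and> p zs \<le> 1"
  obtains r where "(p \<longlongrightarrow> r) (ult bss)"
proof -
  define S where "S = {q::real. \<forall>\<^sub>F zs in ult bss. q \<le> p zs}"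
  have bdd: "q \<le> 1" if "q \<in> S" for q
  proof -
    have "\<forall>\<^sub>F zs in ult bss. q \<le> 1"
      using that[unfolded S_def mem_Collect_eq] assms by eventually_elim simp
    then show ?thesis by (simp only: ev_const)
  qed
  have "0 \<in> S"
    using assms unfolding S_def mem_Collect_eq by eventually_elim simp
  have "(p \<longlongrightarrow> Sup S) (ult bss)"
    unfolding tendsto_iff
  proof (intro allI impI)
    fix e :: real assume e: "0 < e"
    obtain q where "q \<in> S" "Sup S - e < q"
      using less_cSupD[of S "Sup S - e"] \<open>0 \<in> S\<close> e by auto
    have "Sup S + e / 2 \<notin> S"
      using cSup_upper[of "Sup S + e / 2" S] bdd e by (auto simp: bdd_above_def)
    then have "\<forall>\<^sub>F zs in ult bss. \<not> Sup S + e / 2 \<le> p zs"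
      unfolding S_def mem_Collect_eq ev_not .
    then show "\<forall>\<^sub>F zs in ult bss. dist (p zs) (Sup S) < e"
      using \<open>q \<in> S\<close>[unfolded S_def mem_Collect_eq]
      by eventually_elim (use \<open>Sup S - e < q\<close> e in \<open>auto simp: dist_real_def\<close>)
  qed
  then show ?thesis by (rule that)
qed

section \<open>Order, arithmetic and standard parts along a type\<close>

lemma hle_val:
  assumes "val bss [x] (\<lambda>zs. [num (p zs)])" "val bss [y] (\<lambda>zs. [num (q zs)])"
  shows "hle ext x y \<longleftrightarrow> (\<forall>\<^sub>F zs in ult bss. p zs \<le> q zs)"
  using val_ext[of bss "[[x], [y]]" "[\<lambda>zs. [num (p zs)], \<lambda>zs. [num (q zs)]]"] assms
  by (simp add: hle_def)

lemma hless_val: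
  assumes "val bss [x] (\<lambda>zs. [num (p zs)])" "val bss [y] (\<lambda>zs. [num (q zs)])"
  shows "hless ext x y \<longleftrightarrow> (\<forall>\<^sub>F zs in ult bss. p zs < q zs)"
  using val_ext[of bss "[[x], [y]]" "[\<lambda>zs. [num (p zs)], \<lambda>zs. [num (q zs)]]"] assms
  by (simp add: hless_def)

lemma hplus_val:
  assumes "val bss [x] (\<lambda>zs. [num (p zs)])" "val bss [y] (\<lambda>zs. [num (q zs)])"
  shows "val bss [hplus ext x y] (\<lambda>zs. [num (p zs + q zs)])"
  using val_THE[of bss "[[x], [y]]" "[\<lambda>zs. [num (p zs)], \<lambda>zs. [num (q zs)]]" _
      "\<lambda>zs. num (p zs + q zs)"] assms
  by (simp add: hplus_def)

lemma hdivide_val: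
  assumes "val bss [x] (\<lambda>zs. [num (p zs)])" "val bss [y] (\<lambda>zs. [num (q zs)])"
  shows "val bss [hdivide ext x y] (\<lambda>zs. [num (p zs / q zs)])"
  using val_THE[of bss "[[x], [y]]" "[\<lambda>zs. [num (p zs)], \<lambda>zs. [num (q zs)]]" _
      "\<lambda>zs. num (p zs / q zs)"] assms
  by (simp add: hdivide_def)

lemma huminus_val:
  assumes "val bss [x] (\<lambda>zs. [num (p zs)])"
  shows "val bss [huminus ext x] (\<lambda>zs. [num (- p zs)])"
  using val_THE[of bss "[[x]]" "[\<lambda>zs. [num (p zs)]]" _ "\<lambda>zs. num (- p zs)"] assms
  by (simp add: huminus_def)

text \<open>The inequalities that define the standard part say exactly that \<open>p\<close> tends
  to it along the type, so estimates up to infinitesimals become limit rules.\<close>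

lemma standard_part_val:
  assumes "val bss [x] (\<lambda>zs. [num (p zs)])" "\<forall>\<^sub>F zs in ult bss. 0 \<le> p zs \<and> p zs \<le> 1"
  shows "(p \<longlongrightarrow> standard_part star ext x) (ult bss)"
proof -
  obtain r where r: "(p \<longlongrightarrow> r) (ult bss)"
    using assms(2) by (rule ev_tendsto)
  have iff: "(\<forall>e>0. hless ext (star (num (s - e))) x \<and> hless ext x (star (num (s + e)))) \<longleftrightarrow>
      (p \<longlongrightarrow> s) (ult bss)" for s
  proof -
    have "hless ext (star (num (s - e))) x \<and> hless ext x (star (num (s + e))) \<longleftrightarrow>
        (\<forall>\<^sub>F zs in ult bss. dist (p zs) s < e)" for e
      using hless_val[OF val_star assms(1)] hless_val[OF assms(1) val_star]
      by (auto simp: eventually_conj_iff[symmetric] dist_real_def abs_less_iff algebra_simps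
          elim!: eventually_mono)
    then show ?thesis by (simp add: tendsto_iff)
  qed
  have "standard_part star ext x = r"
    unfolding standard_part_def iff using r tendsto_unique[OF ult_neq_bot] by blast
  with r show ?thesis by simp
qed

lemma hints_val:
  assumes "val bss [x] f"
  shows "x \<in> hints ext \<longleftrightarrow> (\<forall>\<^sub>F zs in ult bss. \<exists>k. f zs = pt [k])"
  using val_ext[of bss "[[x]]" "[f]"] assms by (simp add: hints_def)

lemma hypernats_val:
  assumes "val bss [x] f"
  shows "x \<in> hypernats ext \<longleftrightarrow> (\<forall>\<^sub>F zs in ult bss. \<exists>k\<ge>1. f zs = pt [k])"
proof -
  have eq: "{[num (real n)] | n. n \<ge> 1} = {[num (real_of_int k)] | k. k \<ge> 1}"
  proof (intro set_eqI iffI)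
    fix xs assume "xs \<in> {[num (real n)] | n. n \<ge> 1}"
    then obtain n where "xs = [num (real n)]" "n \<ge> 1" by auto
    then show "xs \<in> {[num (real_of_int k)] | k. k \<ge> 1}"
      by (intro CollectI exI[of _ "int n"]) auto
  next
    fix xs assume "xs \<in> {[num (real_of_int k)] | k. k \<ge> 1}"
    then obtain k where "xs = [num (real_of_int k)]" "k \<ge> 1" by auto
    then show "xs \<in> {[num (real n)] | n. n \<ge> 1}"
      by (intro CollectI exI[of _ "nat k"]) auto
  qed
  show ?thesis
    unfolding hypernats_def eq
    using val_ext[of bss "[[x]]" "[f]" "{[num (real_of_int k)] | k. k \<ge> 1}"] assms
    by (simp add: conj_commute)
qed

lemma hints_tuple:
  assumes "val bss b f"
  shows "set b \<subseteq> hints ext \<longleftrightarrow> (\<forall>\<^sub>F zs in ult bss. f zs \<in> range pt)"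
proof -
  have "set b \<subseteq> hints ext \<longleftrightarrow> (\<forall>i\<in>{..<length b}. b ! i \<in> hints ext)"
    by (auto simp: set_conv_nth)
  also have "\<dots> \<longleftrightarrow> (\<forall>i\<in>{..<length b}. \<forall>\<^sub>F zs in ult bss. \<exists>k. [f zs ! i] = pt [k])"
    using hints_val[OF val_coord[OF assms]] by (intro ball_cong) auto
  also have "\<dots> \<longleftrightarrow> (\<forall>\<^sub>F zs in ult bss. \<forall>i\<in>{..<length b}. \<exists>k. [f zs ! i] = pt [k])"
    by (simp add: eventually_ball_finite_distrib)
  also have "\<dots> \<longleftrightarrow> (\<forall>\<^sub>F zs in ult bss. f zs \<in> range pt)"
    using val_length[OF assms] by (rule eventually_cong) (auto simp: range_pt_iff)
  finally show ?thesis .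
qed

lemma hinterval_val:
  assumes "val bss [x] f" "val bss [a] (\<lambda>zs. pt [p zs])" "val bss [b] (\<lambda>zs. pt [q zs])"
  shows "x \<in> hinterval ext a b \<longleftrightarrow> (\<forall>\<^sub>F zs in ult bss. \<exists>k. f zs = pt [k] \<and> p zs \<le> k \<and> k \<le> q zs)"
proof (cases "x \<in> hints ext")
  case True
  then have f: "\<forall>\<^sub>F zs in ult bss. \<exists>k. f zs = pt [k]"
    using hints_val[OF assms(1)] by simp
  define h where "h zs = \<lfloor>num_inv (hd (f zs))\<rfloor>" for zs
  have h: "\<forall>\<^sub>F zs in ult bss. f zs = [num (of_int (h zs))]"
    using f by eventually_elim (auto simp: h_def)
  then have x: "val bss [x] (\<lambda>zs. [num (of_int (h zs))])"
    by (rule val_cong[THEN iffD1]) (rule assms(1))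
  have "x \<in> hinterval ext a b \<longleftrightarrow> (\<forall>\<^sub>F zs in ult bss. p zs \<le> h zs) \<and> (\<forall>\<^sub>F zs in ult bss. h zs \<le> q zs)"
    using True hle_val[OF _ x, of a "\<lambda>zs. of_int (p zs)"] hle_val[OF x, of b "\<lambda>zs. of_int (q zs)"]
      assms(2,3) by (simp add: hinterval_def)
  also have "\<dots> \<longleftrightarrow> (\<forall>\<^sub>F zs in ult bss. \<exists>k. f zs = pt [k] \<and> p zs \<le> k \<and> k \<le> q zs)"
    unfolding eventually_conj_iff[symmetric] using h by (rule eventually_cong) auto
  finally show ?thesis .
next
  case False
  then have "\<not> (\<forall>\<^sub>F zs in ult bss. \<exists>k. f zs = pt [k])"
    using hints_val[OF assms(1)] by simp
  with False show ?thesis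
    using eventually_mono[of "\<lambda>zs. \<exists>k. f zs = pt [k] \<and> p zs \<le> k \<and> k \<le> q zs" "ult bss" "\<lambda>zs. \<exists>k. f zs = pt [k]"]
    by (auto simp: hinterval_def)
qed

text \<open>The value at \<open>bss\<close> of the star extension of a standard family
  \<open>f\<close> of sets of integer points, described by its elements instead of a code. All
  internal sets below are brought to this form.\<close>

definition internal_set :: "nat \<Rightarrow> (entity list list \<Rightarrow> int list set) \<Rightarrow> 'b list list \<Rightarrow> 'b list set" where
  "internal_set d f bss =
     {x. length x = d \<and> (\<forall>\<^sub>F zs in ult (bss @ [x]). last zs \<in> pt ` f (butlast zs))}"

lemma internal_set_val:
  assumes "val bss x h"
  shows "x \<in> internal_set d f bss \<longleftrightarrow> length x = d \<and> (\<forall>\<^sub>F zs in ult bss. h zs \<in> pt ` f zs)"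
  by (simp add: internal_set_def val_snoc[OF assms])

lemma internal_set_reparam:
  assumes "list_all2 (val bss) bs fs"
  shows "internal_set d g bs = internal_set d (\<lambda>zs. g (map (\<lambda>f. f zs) fs)) bss"
proof -
  have "eventually (\<lambda>zs. last zs \<in> pt ` g (butlast zs)) (ult (bs @ [x])) \<longleftrightarrow>
      (\<forall>\<^sub>F zs in ult (bss @ [x]). last zs \<in> pt ` g (map (\<lambda>f. f (butlast zs)) fs))" for x
  proof -
    have "list_all2 (val (bss @ [x])) (bs @ [x]) (map (\<lambda>f zs. f (butlast zs)) fs @ [last])"
      by (intro list_all2_appendI list_all2_butlast assms) (simp add: val_last)
    from val_ev[OF this, of "\<lambda>zs. last zs \<in> pt ` g (butlast zs)"] show ?thesis
      by (simp add: comp_def)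
  qed
  then show ?thesis by (simp add: internal_set_def)
qed

lemma codes_internal_set:
  assumes "val bss [a] (\<lambda>zs. [code (f zs)])" "\<forall>\<^sub>F zs in ult bss. \<forall>z\<in>f zs. length z = d"
  shows "codes ext d a (internal_set d f bss)"
proof -
  have "concat [[a]] \<in> ext {[Rel B] | B. \<forall>xs\<in>B. length xs = d}"
  proof (subst val_ext)
    show "list_all2 (val bss) [[a]] [\<lambda>zs. [code (f zs)]]" using assms(1) by simp
    show "\<forall>\<^sub>F zs in ult bss. concat (map (\<lambda>f. f zs) [\<lambda>zs. [code (f zs)]]) \<in>
        {[Rel B] | B. \<forall>xs\<in>B. length xs = d}"
      using assms(2) by eventually_elim (auto simp: code_def)
  qed
  moreover have "a # x \<in> ext membership \<longleftrightarrow> (\<forall>\<^sub>F zs in ult (bss @ [x]). last zs \<in> pt ` f (butlast zs))" for x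
  proof -
    have "list_all2 (val (bss @ [x])) [[a], x] [\<lambda>zs. [code (f (butlast zs))], last]"
      using val_butlast[OF assms(1)] val_last by simp
    from val_ext[OF this, of membership] show ?thesis
      by (simp add: mem_membership)
  qed
  ultimately show ?thesis
    by (simp add: codes_def internal_set_def)
qed

lemma internal_internal_set:
  assumes "\<forall>\<^sub>F zs in ult bss. \<forall>z\<in>f zs. length z = d"
  shows "internal ext d (internal_set d f bss)"
proof -
  obtain b where "length b = 1" "val bss b (\<lambda>zs. [code (f zs)])"
    by (rule val_ex[of "\<lambda>zs. [code (f zs)]" 1 bss]) auto
  then obtain a where "val bss [a] (\<lambda>zs. [code (f zs)])"
    by (auto simp: length_Suc_conv)
  with codes_internal_set[OF this assms] show ?thesis
    by (auto simp: internal_def)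
qed

text \<open>For the direction from the internal sets to the fibres: if the fibres fail to be
  included in almost every instance, a counterexample chosen in each instance is realized by one
  internal point.\<close>

lemma internal_set_subset_iff:
  assumes "\<forall>\<^sub>F zs in ult bss. \<forall>z\<in>f zs. length z = d"
  shows "internal_set d f bss \<subseteq> internal_set d g bss \<longleftrightarrow> (\<forall>\<^sub>F zs in ult bss. f zs \<subseteq> g zs)"
proof
  assume *: "\<forall>\<^sub>F zs in ult bss. f zs \<subseteq> g zs"
  show "internal_set d f bss \<subseteq> internal_set d g bss"
  proof
    fix x assume "x \<in> internal_set d f bss"
    then have "length x = d" and x: "\<forall>\<^sub>F zs in ult (bss @ [x]). last zs \<in> pt ` f (butlast zs)"
      by (auto simp: internal_set_def)
    moreover have "\<forall>\<^sub>F zs in ult (bss @ [x]). last zs \<in> pt ` g (butlast zs)"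
      using x *[unfolded ev_butlast[of _ bss x]] by eventually_elim blast
    ultimately show "x \<in> internal_set d g bss"
      by (simp add: internal_set_def)
  qed
next
  assume *: "internal_set d f bss \<subseteq> internal_set d g bss"
  show "\<forall>\<^sub>F zs in ult bss. f zs \<subseteq> g zs"
  proof (rule ccontr)
    assume "\<not> ?thesis"
    then have "\<forall>\<^sub>F zs in ult bss. \<not> f zs \<subseteq> g zs"
      by (simp add: ev_not)
    then have "\<forall>\<^sub>F zs in ult bss. \<exists>y. length y = d \<and> last (zs @ [y]) \<in> pt ` f (butlast (zs @ [y])) \<and>
        last (zs @ [y]) \<notin> pt ` g (butlast (zs @ [y]))"
      using assms
    proof eventually_elim
      case (elim zs)
      then obtain z where "z \<in> f zs" "z \<notin> g zs" by blast
      with elim show ?case by (intro exI[of _ "pt z"]) auto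
    qed
    then have "\<exists>x. length x = d \<and> (\<forall>\<^sub>F zs in ult (bss @ [x]).
        last zs \<in> pt ` f (butlast zs) \<and> last zs \<notin> pt ` g (butlast zs))"
      by (subst ev_ex)
    then obtain x where "length x = d" and
      x: "\<forall>\<^sub>F zs in ult (bss @ [x]). last zs \<in> pt ` f (butlast zs) \<and> last zs \<notin> pt ` g (butlast zs)"
      by blast
    then have "x \<in> internal_set d f bss" "x \<notin> internal_set d g bss"
      by (auto simp: internal_set_def eventually_conj_iff ev_not)
    with * show False by blast
  qed
qed

lemma internal_set_Un:
  "internal_set d f bss \<union> internal_set d g bss = internal_set d (\<lambda>zs. f zs \<union> g zs) bss"
  by (auto simp: internal_set_def image_Un ev_disj)

lemma internal_set_Int:
  "internal_set d f bss \<inter> internal_set d g bss = internal_set d (\<lambda>zs. f zs \<inter> g zs) bss"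
proof -
  have "pt ` (A \<inter> B) = pt ` A \<inter> pt ` B" for A B by (rule image_Int) (simp add: inj_def)
  then show ?thesis by (auto simp: internal_set_def eventually_conj_iff)
qed

lemma internal_set_Diff:
  "internal_set d f bss - internal_set d g bss = internal_set d (\<lambda>zs. f zs - g zs) bss"
proof -
  have "pt ` (A - B) = pt ` A - pt ` B" for A B by (rule image_set_diff) (simp add: inj_def)
  then show ?thesis by (auto simp: internal_set_def eventually_conj_iff ev_not)
qed

lemma internal_set_empty: "internal_set d (\<lambda>_. {}) bss = {}"
  by (simp add: internal_set_def ev_const)

text \<open>Normal form: an arbitrary internal set of hyperinteger points is the standard family
  \<open>zset\<close> evaluated at the code of the set. The entries must be hyperintegers because
  \<open>zset\<close> sees no other tuples.\<close>

lemma internal_imp_internal_set: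
  assumes "internal ext d D" "\<And>x. x \<in> D \<Longrightarrow> set x \<subseteq> hints ext"
  obtains a where "D = internal_set d (\<lambda>zs. zset d (hd (zs ! 0))) [[a]]"
proof -
  obtain a where a: "codes ext d a D"
    using assms(1) by (auto simp: internal_def)
  have "x \<in> D \<longleftrightarrow> x \<in> internal_set d (\<lambda>zs. zset d (hd (zs ! 0))) [[a]]" for x
  proof (cases "set x \<subseteq> hints ext \<and> length x = d")
    case True
    have "\<forall>\<^sub>F zs in ult [[a], x]. zs ! 1 \<in> range pt"
      using hints_tuple[OF val_nth[of 1 "[[a], x]"]] True by simp
    then have "a # x \<in> ext membership \<longleftrightarrow>
        (\<forall>\<^sub>F zs in ult ([[a]] @ [x]). last zs \<in> pt ` zset d (hd (butlast zs ! 0)))"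
    proof -
      have "\<forall>\<^sub>F zs in ult [[a], x]. concat zs \<in> membership \<longleftrightarrow> last zs \<in> pt ` zset d (hd (butlast zs ! 0))"
        using \<open>\<forall>\<^sub>F zs in ult [[a], x]. zs ! 1 \<in> range pt\<close> ev_nth_length[of "[[a], x]"]
      proof eventually_elim
        case (elim zs)
        then have "length zs = 2" "length (zs ! 0) = 1" "length (zs ! 1) = d"
          using True by auto
        moreover obtain z where "zs ! 1 = pt z" using elim by auto
        moreover obtain e where "zs ! 0 = [e]"
          using \<open>length (zs ! 0) = 1\<close> by (auto simp: length_Suc_conv)
        ultimately have "zs = [[e], pt z]" "length z = d"
          by (auto simp: length_Suc_conv numeral_2_eq_2)
        then show ?case by (simp add: mem_membership zset_def)
      qed
      then show ?thesis
        using ev_concat[of "[[a], x]" membership] unfolding ev_iff by simp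
    qed
    with True a show ?thesis
      by (auto simp: codes_def internal_set_def)
  next
    case False
    have "x \<notin> D" using False a assms(2) by (auto simp: codes_def)
    moreover have "x \<notin> internal_set d (\<lambda>zs. zset d (hd (zs ! 0))) [[a]]"
    proof
      assume "x \<in> internal_set d (\<lambda>zs. zset d (hd (zs ! 0))) [[a]]"
      then have "length x = d" and x: "\<forall>\<^sub>F zs in ult ([[a]] @ [x]). last zs \<in> pt ` zset d (hd (butlast zs ! 0))"
        by (auto simp: internal_set_def)
      then have "\<forall>\<^sub>F zs in ult ([[a]] @ [x]). last zs \<in> range pt"
        by (auto elim!: eventually_mono)
      then show False
        using False \<open>length x = d\<close> hints_tuple[OF val_last[of "[[a]]" x]] by simp
    qed
    ultimately show ?thesis by simp
  qed
  then show ?thesis using that by blast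
qed

text \<open>Extensionality for internal sets. If two codes differ, so do the relations in almost
  every instance; a tuple that separates these is realized internally and separates the coded sets.
  The description in \<open>hcard\<close> is well defined by this.\<close>

lemma codes_unique:
  assumes "codes ext k a D" "codes ext k a' D"
  shows "a = a'"
proof (rule ccontr)
  assume "a \<noteq> a'"
  then have "\<not> (\<forall>\<^sub>F zs in ult [[a], [a']]. zs ! 0 = zs ! 1)"
    using ev_eq[of "[a]" "[a']"] by simp
  then have ne: "\<forall>\<^sub>F zs in ult [[a], [a']]. zs ! 0 \<noteq> zs ! 1"
    by (simp add: ev_not)
  let ?R = "{[Rel B] | B :: real level list set. \<forall>xs\<in>B. length xs = k}"
  have rel0: "\<forall>\<^sub>F zs in ult [[a], [a']]. zs ! 0 \<in> ?R"
    using val_ext[of "[[a], [a']]" "[[a]]" "[\<lambda>zs. zs ! 0]" ?R] val_nth[of 0 "[[a], [a']]"] assms(1)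
    by (simp add: codes_def)
  have rel1: "\<forall>\<^sub>F zs in ult [[a], [a']]. zs ! 1 \<in> ?R"
    using val_ext[of "[[a], [a']]" "[[a']]" "[\<lambda>zs. zs ! 1]" ?R] val_nth[of 1 "[[a], [a']]"] assms(2)
    by (simp add: codes_def)
  have "\<forall>\<^sub>F zs in ult [[a], [a']]. \<exists>y. length y = k \<and>
      (concat [(zs @ [y]) ! 0, (zs @ [y]) ! 2] \<in> membership) \<noteq>
      (concat [(zs @ [y]) ! 1, (zs @ [y]) ! 2] \<in> membership)"
    using ne rel0 rel1 ev_nth_length[of "[[a], [a']]"]
  proof eventually_elim
    case (elim zs)
    then obtain B B' where B: "zs ! 0 = [Rel B]" "zs ! 1 = [Rel B']" "length zs = 2"
      "\<forall>xs\<in>B. length xs = k" "\<forall>xs\<in>B'. length xs = k"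
      by auto
    with elim have "B \<noteq> B'" by auto
    then obtain xs where xs: "(xs \<in> B) \<noteq> (xs \<in> B')" by blast
    have "Rel X # map Elem xs \<in> membership \<longleftrightarrow> xs \<in> X" for X :: "real level list set"
      by (auto simp: membership_def dest!: map_injective simp: inj_def)
    with B xs show ?case
      by (intro exI[of _ "map Elem xs"]) (auto simp: nth_append)
  qed
  then have "\<exists>x. length x = k \<and> (\<forall>\<^sub>F zs in ult ([[a], [a']] @ [x]).
      (concat [zs ! 0, zs ! 2] \<in> membership) \<noteq> (concat [zs ! 1, zs ! 2] \<in> membership))"
    by (subst ev_ex)
  then obtain x where x: "length x = k" "\<forall>\<^sub>F zs in ult ([[a], [a']] @ [x]).
      (concat [zs ! 0, zs ! 2] \<in> membership) \<noteq> (concat [zs ! 1, zs ! 2] \<in> membership)"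
    by blast
  have "a # x \<in> ext membership \<longleftrightarrow> (\<forall>\<^sub>F zs in ult [[a], [a'], x]. concat [zs ! 0, zs ! 2] \<in> membership)"
    using val_ext[of "[[a], [a'], x]" "[[a], x]" "[\<lambda>zs. zs ! 0, \<lambda>zs. zs ! 2]" membership]
      val_nth[of 0 "[[a], [a'], x]"] val_nth[of 2 "[[a], [a'], x]"] by simp
  moreover have "a' # x \<in> ext membership \<longleftrightarrow> (\<forall>\<^sub>F zs in ult [[a], [a'], x]. concat [zs ! 1, zs ! 2] \<in> membership)"
    using val_ext[of "[[a], [a'], x]" "[[a'], x]" "[\<lambda>zs. zs ! 1, \<lambda>zs. zs ! 2]" membership]
      val_nth[of 1 "[[a], [a'], x]"] val_nth[of 2 "[[a], [a'], x]"] by simp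
  moreover have "a # x \<in> ext membership \<longleftrightarrow> a' # x \<in> ext membership"
    using assms x(1) by (auto simp: codes_def)
  ultimately have "(\<forall>\<^sub>F zs in ult [[a], [a'], x]. concat [zs ! 0, zs ! 2] \<in> membership) \<longleftrightarrow>
      (\<forall>\<^sub>F zs in ult [[a], [a'], x]. concat [zs ! 1, zs ! 2] \<in> membership)"
    by simp
  then have "\<forall>\<^sub>F zs in ult [[a], [a'], x]. concat [zs ! 0, zs ! 2] \<in> membership \<longleftrightarrow>
      concat [zs ! 1, zs ! 2] \<in> membership"
    by (simp only: ev_iff)
  then have "\<forall>\<^sub>F zs in ult [[a], [a'], x]. False"
    using x(2)[simplified append_Cons append_Nil] by eventually_elim blast
  then show False by (simp add: ev_const)
qed

lemma hcard_val:
  assumes "\<forall>\<^sub>F zs in ult bss. finite (f zs) \<and> (\<forall>z\<in>f zs. length z = d)"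
  shows "val bss [hcard ext d (internal_set d f bss)] (\<lambda>zs. [num (real (card (f zs)))])"
proof -
  obtain b where "length b = 1" "val bss b (\<lambda>zs. [code (f zs)])"
    by (rule val_ex[of "\<lambda>zs. [code (f zs)]" 1 bss]) auto
  then obtain a where a: "val bss [a] (\<lambda>zs. [code (f zs)])"
    by (auto simp: length_Suc_conv)
  let ?R = "{[Rel B, num (real (card B))] | B :: real level list set. finite B}"
  have "codes ext d a (internal_set d f bss)"
    by (rule codes_internal_set[OF a]) (use assms in \<open>auto elim!: eventually_mono\<close>)
  then have ex_codes: "(\<exists>a. codes ext d a (internal_set d f bss) \<and> [a, n] \<in> ext ?R) \<longleftrightarrow> [a, n] \<in> ext ?R" for n
    using codes_unique by blast
  then have "hcard ext d (internal_set d f bss) = (THE n. concat [[a]] @ [n] \<in> ext ?R)"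
    unfolding hcard_def by simp
  moreover have "\<forall>\<^sub>F zs in ult bss. \<forall>y. concat (map (\<lambda>f. f zs) [\<lambda>zs. [code (f zs)]]) @ [y] \<in> ?R \<longleftrightarrow>
      y = num (real (card (f zs)))"
    using assms by eventually_elim (auto simp: code_def card_code)
  ultimately show ?thesis
    using val_THE[of bss "[[a]]" "[\<lambda>zs. [code (f zs)]]" ?R] a by simp
qed

text \<open>The bridge from ordinary counting to Loeb measure: bounds on quotients of finite
  cardinalities in almost every instance pass to the limit.\<close>

lemma ratio_tendsto:
  assumes "\<forall>\<^sub>F zs in ult bss. finite (g zs) \<and> (\<forall>z\<in>g zs. length z = d)"
    and "\<forall>\<^sub>F zs in ult bss. f zs \<subseteq> g zs"
  shows "((\<lambda>zs. real (card (f zs)) / real (card (g zs))) \<longlongrightarrow> standard_part star ext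
     (hdivide ext (hcard ext d (internal_set d f bss)) (hcard ext d (internal_set d g bss)))) (ult bss)"
proof (rule standard_part_val)
  have "\<forall>\<^sub>F zs in ult bss. finite (f zs) \<and> (\<forall>z\<in>f zs. length z = d)"
    using assms by eventually_elim (auto intro: finite_subset)
  then show "val bss [hdivide ext (hcard ext d (internal_set d f bss)) (hcard ext d (internal_set d g bss))]
      (\<lambda>zs. [num (real (card (f zs)) / real (card (g zs)))])"
    by (intro hdivide_val hcard_val assms)
  show "\<forall>\<^sub>F zs in ult bss. 0 \<le> real (card (f zs)) / real (card (g zs)) \<and>
      real (card (f zs)) / real (card (g zs)) \<le> 1"
    using assms by eventually_elim (auto simp: divide_le_eq_1 card_mono)
qed

end

section \<open>Loeb measure\<close>

context nonstandard_universe
begin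

abbreviation loeb_ratio :: "nat \<Rightarrow> 'b list set \<Rightarrow> 'b list set \<Rightarrow> real" where
  "loeb_ratio d D F \<equiv> standard_part star ext (hdivide ext (hcard ext d D) (hcard ext d F))"

definition hyperfinite :: "nat \<Rightarrow> 'b list set \<Rightarrow> bool" where
  "hyperfinite d F \<longleftrightarrow> (\<exists>bss g. F = internal_set d g bss \<and>
     (\<forall>\<^sub>F zs in ult bss. finite (g zs) \<and> g zs \<noteq> {} \<and> (\<forall>z\<in>g zs. length z = d)))"

lemma internal_set_hints: "x \<in> internal_set d g bss \<Longrightarrow> length x = d \<and> set x \<subseteq> hints ext"
proof -
  assume "x \<in> internal_set d g bss"
  then have "length x = d" and x: "\<forall>\<^sub>F zs in ult (bss @ [x]). last zs \<in> pt ` g (butlast zs)"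
    by (auto simp: internal_set_def)
  from x have "\<forall>\<^sub>F zs in ult (bss @ [x]). last zs \<in> range pt"
    by eventually_elim auto
  with \<open>length x = d\<close> show ?thesis
    using hints_tuple[OF val_last] by blast
qed

text \<open>The three sets come with parameters of their own. Joining the lists puts their fibres
  over one type, where unions, differences and cardinalities can be compared instance by
  instance.\<close>

lemma common_parameters:
  assumes "hyperfinite d F" "internal ext d D1" "D1 \<subseteq> F" "internal ext d D2" "D2 \<subseteq> F"
  obtains bs g f1 f2 where
    "F = internal_set d g bs" "D1 = internal_set d f1 bs" "D2 = internal_set d f2 bs"
    "\<forall>\<^sub>F zs in ult bs. finite (g zs) \<and> (\<forall>z\<in>g zs. length z = d)"
    "\<forall>\<^sub>F zs in ult bs. f1 zs \<subseteq> g zs" "\<forall>\<^sub>F zs in ult bs. f2 zs \<subseteq> g zs"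
proof -
  obtain bss g where g: "F = internal_set d g bss"
    "\<forall>\<^sub>F zs in ult bss. finite (g zs) \<and> g zs \<noteq> {} \<and> (\<forall>z\<in>g zs. length z = d)"
    using assms(1) by (auto simp: hyperfinite_def)
  have hints: "set x \<subseteq> hints ext" if "x \<in> F" for x
    using that g(1) internal_set_hints by blast
  let ?z = "\<lambda>zs. zset d (hd (zs ! 0))"
  obtain a1 where a1: "D1 = internal_set d ?z [[a1]]"
    using internal_imp_internal_set[OF assms(2)] assms(3) hints by blast
  obtain a2 where a2: "D2 = internal_set d ?z [[a2]]"
    using internal_imp_internal_set[OF assms(4)] assms(5) hints by blast
  define bs where "bs = bss @ [[a1], [a2]]"
  let ?n = "length bss"
  have n: "length bs = ?n + 2" "bs ! ?n = [a1]" "bs ! Suc ?n = [a2]"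
    by (auto simp: bs_def nth_append)
  define g' where "g' zs = g (map (nth zs) [0..<?n])" for zs
  define f1 where "f1 zs = zset d (hd (zs ! ?n))" for zs
  define f2 where "f2 zs = zset d (hd (zs ! Suc ?n))" for zs
  have D1: "D1 = internal_set d f1 bs"
    unfolding a1 using internal_set_reparam[of bs "[[a1]]" "[\<lambda>zs. zs ! ?n]" d ?z] val_nth[of ?n bs] n
    by (simp add: f1_def[abs_def])
  have D2: "D2 = internal_set d f2 bs"
    unfolding a2 using internal_set_reparam[of bs "[[a2]]" "[\<lambda>zs. zs ! Suc ?n]" d ?z] val_nth[of "Suc ?n" bs] n
    by (simp add: f2_def[abs_def])
  have vals: "list_all2 (val bs) bss (map (\<lambda>i zs. zs ! i) [0..<?n])"
  proof (rule list_all2_all_nthI)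
    fix i assume "i < length bss"
    then have "bs ! i = bss ! i" "i < length bs" by (auto simp: bs_def nth_append)
    with val_nth[of i bs] \<open>i < length bss\<close> show "val bs (bss ! i) (map (\<lambda>i zs. zs ! i) [0..<?n] ! i)"
      by simp
  qed simp
  have F: "F = internal_set d g' bs"
    unfolding g(1) using internal_set_reparam[OF vals, of d g] by (simp add: g'_def[abs_def] comp_def)
  have g': "\<forall>\<^sub>F zs in ult bs. finite (g' zs) \<and> g' zs \<noteq> {} \<and> (\<forall>z\<in>g' zs. length z = d)"
    using g(2) unfolding val_ev[OF vals] by (simp add: g'_def comp_def)
  show ?thesis
  proof (rule that[OF F D1 D2])
    show "\<forall>\<^sub>F zs in ult bs. finite (g' zs) \<and> (\<forall>z\<in>g' zs. length z = d)"
      using g' by eventually_elim simp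
    show "\<forall>\<^sub>F zs in ult bs. f1 zs \<subseteq> g' zs"
      using assms(3) unfolding D1 F by (subst (asm) internal_set_subset_iff) (simp_all add: f1_def zset_def)
    show "\<forall>\<^sub>F zs in ult bs. f2 zs \<subseteq> g' zs"
      using assms(5) unfolding D2 F by (subst (asm) internal_set_subset_iff) (simp_all add: f2_def zset_def)
  qed
qed

lemma internal_Un_Diff:
  assumes "hyperfinite d F" "internal ext d D1" "D1 \<subseteq> F" "internal ext d D2" "D2 \<subseteq> F"
  shows "internal ext d (D1 \<union> D2)" "internal ext d (D1 - D2)"
proof -
  obtain bs g f1 f2 where "F = internal_set d g bs" and
    D: "D1 = internal_set d f1 bs" "D2 = internal_set d f2 bs"
    and g: "\<forall>\<^sub>F zs in ult bs. finite (g zs) \<and> (\<forall>z\<in>g zs. length z = d)"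
    and f: "\<forall>\<^sub>F zs in ult bs. f1 zs \<subseteq> g zs" "\<forall>\<^sub>F zs in ult bs. f2 zs \<subseteq> g zs"
    by (rule common_parameters[OF assms])
  have "\<forall>\<^sub>F zs in ult bs. \<forall>z\<in>f1 zs \<union> f2 zs. length z = d" "\<forall>\<^sub>F zs in ult bs. \<forall>z\<in>f1 zs - f2 zs. length z = d"
    using g f by (eventually_elim, blast)+
  then show "internal ext d (D1 \<union> D2)" "internal ext d (D1 - D2)"
    unfolding D internal_set_Un internal_set_Diff by (simp_all add: internal_internal_set)
qed

lemma internal_empty: "internal ext d {}"
  using internal_internal_set[of "\<lambda>_. {}" d "[]"] by (simp add: internal_set_empty)

lemma hyperfinite_internal: "hyperfinite d F \<Longrightarrow> internal ext d F"
proof -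
  assume "hyperfinite d F"
  then obtain bss g where F: "F = internal_set d g bss"
    and g: "\<forall>\<^sub>F zs in ult bss. finite (g zs) \<and> g zs \<noteq> {} \<and> (\<forall>z\<in>g zs. length z = d)"
    by (auto simp: hyperfinite_def)
  from g have "\<forall>\<^sub>F zs in ult bss. \<forall>z\<in>g zs. length z = d"
    by eventually_elim blast
  then show ?thesis
    unfolding F by (rule internal_internal_set)
qed

lemma loeb_ratio_nonneg:
  assumes "hyperfinite d F" "internal ext d D" "D \<subseteq> F"
  shows "0 \<le> loeb_ratio d D F"
proof -
  obtain bs g f f2 where
    D: "F = internal_set d g bs" "D = internal_set d f bs" and "D = internal_set d f2 bs"
    and g: "\<forall>\<^sub>F zs in ult bs. finite (g zs) \<and> (\<forall>z\<in>g zs. length z = d)"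
    and f: "\<forall>\<^sub>F zs in ult bs. f zs \<subseteq> g zs" and "\<forall>\<^sub>F zs in ult bs. f2 zs \<subseteq> g zs"
    by (rule common_parameters[OF assms assms(2,3)])
  show ?thesis
    using tendsto_lowerbound[OF ratio_tendsto[OF g f], of 0] unfolding D by simp
qed

lemma loeb_ratio_empty:
  assumes "hyperfinite d F"
  shows "loeb_ratio d {} F = 0"
proof -
  obtain bs g where D: "F = internal_set d g bs"
    and g': "\<forall>\<^sub>F zs in ult bs. finite (g zs) \<and> g zs \<noteq> {} \<and> (\<forall>z\<in>g zs. length z = d)"
    using assms by (auto simp: hyperfinite_def)
  from g' have g: "\<forall>\<^sub>F zs in ult bs. finite (g zs) \<and> (\<forall>z\<in>g zs. length z = d)"
    by eventually_elim blast
  have "((\<lambda>zs. 0) \<longlongrightarrow> loeb_ratio d {} F) (ult bs)"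
    using ratio_tendsto[OF g, of "\<lambda>_. {}"] unfolding D internal_set_empty by simp
  then show ?thesis
    using tendsto_const_iff[of "ult bs" "0::real" "loeb_ratio d {} F"] by simp
qed

lemma loeb_ratio_Un:
  assumes "hyperfinite d F" "internal ext d D1" "D1 \<subseteq> F" "internal ext d D2" "D2 \<subseteq> F" "D1 \<inter> D2 = {}"
  shows "loeb_ratio d (D1 \<union> D2) F = loeb_ratio d D1 F + loeb_ratio d D2 F"
proof -
  obtain bs g f1 f2 where
    D: "F = internal_set d g bs" "D1 = internal_set d f1 bs" "D2 = internal_set d f2 bs"
    and g: "\<forall>\<^sub>F zs in ult bs. finite (g zs) \<and> (\<forall>z\<in>g zs. length z = d)"
    and f: "\<forall>\<^sub>F zs in ult bs. f1 zs \<subseteq> g zs" "\<forall>\<^sub>F zs in ult bs. f2 zs \<subseteq> g zs"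
    by (rule common_parameters[OF assms(1-5)])
  have "internal_set d (\<lambda>zs. f1 zs \<inter> f2 zs) bs \<subseteq> internal_set d (\<lambda>_. {}) bs"
    using assms(6) unfolding D internal_set_Int by simp
  moreover have "\<forall>\<^sub>F zs in ult bs. \<forall>z\<in>f1 zs \<inter> f2 zs. length z = d"
    using g f(1) by eventually_elim blast
  ultimately have disj: "\<forall>\<^sub>F zs in ult bs. f1 zs \<inter> f2 zs = {}"
    using internal_set_subset_iff[of "\<lambda>zs. f1 zs \<inter> f2 zs" d bs "\<lambda>_. {}"] by simp
  have un: "\<forall>\<^sub>F zs in ult bs. f1 zs \<union> f2 zs \<subseteq> g zs"
    using f by eventually_elim blast
  have "((\<lambda>zs. real (card (f1 zs)) / real (card (g zs)) + real (card (f2 zs)) / real (card (g zs)))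
      \<longlongrightarrow> loeb_ratio d D1 F + loeb_ratio d D2 F) (ult bs)"
    unfolding D by (intro tendsto_add ratio_tendsto g f)
  moreover have "\<forall>\<^sub>F zs in ult bs. real (card (f1 zs)) / real (card (g zs)) +
      real (card (f2 zs)) / real (card (g zs)) = real (card (f1 zs \<union> f2 zs)) / real (card (g zs))"
    using g f disj
  proof eventually_elim
    case (elim zs)
    then have "card (f1 zs \<union> f2 zs) = card (f1 zs) + card (f2 zs)"
      by (intro card_Un_disjoint) (auto intro: finite_subset)
    then show ?case by (simp add: add_divide_distrib)
  qed
  ultimately have "((\<lambda>zs. real (card (f1 zs \<union> f2 zs)) / real (card (g zs)))
      \<longlongrightarrow> loeb_ratio d D1 F + loeb_ratio d D2 F) (ult bs)"
    by (rule Lim_transform_eventually)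
  from tendsto_unique[OF ult_neq_bot ratio_tendsto[OF g un] this] show ?thesis
    unfolding D internal_set_Un .
qed

definition loeb_base :: "nat \<Rightarrow> 'b list set \<Rightarrow> 'b list measure" where
  "loeb_base d F = extend_measure F {D. internal ext d D \<and> D \<subseteq> F} (\<lambda>D. D)
     (\<lambda>D. ennreal (loeb_ratio d D F))"

lemma loeb_eq: "loeb star ext d F = completion (loeb_base d F)"
  by (simp add: loeb_def loeb_base_def)

lemma space_loeb_base [simp]: "space (loeb_base d F) = F"
  unfolding loeb_base_def by (rule space_extend_measure) auto

lemma sets_loeb_base: "sets (loeb_base d F) = sigma_sets F {D. internal ext d D \<and> D \<subseteq> F}"
  unfolding loeb_base_def by (subst sets_extend_measure) auto

lemma internal_in_sets: "internal ext d D \<Longrightarrow> D \<subseteq> F \<Longrightarrow> D \<in> sets (loeb_base d F)"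
  unfolding sets_loeb_base by (rule sigma_sets.Basic) simp

text \<open>\<open>extend_measure\<close> has the prescribed values only if some measure has them,
  and is the zero measure otherwise. Caratheodory's theorem supplies such a measure.\<close>

lemma emeasure_loeb_base:
  assumes F: "hyperfinite d F" and D: "internal ext d D" "D \<subseteq> F"
  shows "emeasure (loeb_base d F) D = ennreal (loeb_ratio d D F)"
proof -
  let ?M = "{D. internal ext d D \<and> D \<subseteq> F}"
  let ?f = "\<lambda>D. ennreal (loeb_ratio d D F)"
  interpret ring_of_sets F ?M
    unfolding ring_of_sets_iff using internal_Un_Diff[OF F] internal_empty by auto
  have "\<exists>\<mu>. (\<forall>s\<in>?M. \<mu> s = ?f s) \<and> measure_space F (sigma_sets F ?M) \<mu>"
  proof (rule caratheodory_empty_continuous)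
    show "positive ?M ?f"
      by (simp add: positive_def loeb_ratio_empty[OF F])
    show "additive ?M ?f"
      unfolding additive_def
      using loeb_ratio_Un[OF F] loeb_ratio_nonneg[OF F] by auto
    fix A :: "nat \<Rightarrow> 'b list set"
    assume A: "range A \<subseteq> ?M" "decseq A" "(\<Inter>i. A i) = {}"
    \<comment> \<open>By countable saturation, internal sets whose countable intersection is empty
      already have an empty finite intersection. Continuity at the empty set then concerns a
      sequence that is eventually empty.\<close>
    have "\<exists>n. (\<Inter>i\<le>n. A i) = {}"
    proof (rule ccontr)
      assume "\<nexists>n. (\<Inter>i\<le>n. A i) = {}"
      moreover have "internal ext d (A n)" for n
        using A(1) by blast
      ultimately have "(\<Inter>n. A n) \<noteq> {}"
        by (intro saturation[unfolded countably_saturated_def, rule_format, of d A]) auto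
      with A(3) show False by simp
    qed
    then obtain n where "(\<Inter>i\<le>n. A i) = {}" ..
    moreover have "A n \<subseteq> (\<Inter>i\<le>n. A i)"
      using A(2) by (auto simp: decseq_def)
    ultimately have "A i = {}" if "n \<le> i" for i
      using decseqD[OF A(2) that] by simp
    then have "\<forall>\<^sub>F i in sequentially. ?f (A i) = 0"
      using loeb_ratio_empty[OF F] unfolding eventually_sequentially by (intro exI[of _ n]) simp
    then show "(\<lambda>i. ?f (A i)) \<longlonglongrightarrow> 0"
      by (rule tendsto_eventually)
  qed simp
  then obtain \<mu> where \<mu>: "\<forall>s\<in>?M. \<mu> s = ?f s" "measure_space F (sigma_sets F ?M) \<mu>"
    by blast
  show ?thesis
    by (rule emeasure_extend_measure[of _ F ?M "\<lambda>D. D" ?f \<mu>])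
      (use \<mu> D in \<open>auto simp: loeb_base_def[symmetric] sets_loeb_base measure_space_def\<close>)
qed

lemma loeb_internal:
  assumes "hyperfinite d F" "internal ext d D" "D \<subseteq> F"
  shows "D \<in> fmeasurable (loeb star ext d F)" "measure (loeb star ext d F) D = loeb_ratio d D F"
proof -
  have "D \<in> sets (loeb star ext d F)"
    using internal_in_sets[OF assms(2,3)] by (simp add: loeb_eq)
  moreover have "emeasure (loeb star ext d F) D = ennreal (loeb_ratio d D F)"
    using emeasure_loeb_base[OF assms] internal_in_sets[OF assms(2,3)]
    by (simp add: loeb_eq main_part_sets)
  ultimately show "D \<in> fmeasurable (loeb star ext d F)" "measure (loeb star ext d F) D = loeb_ratio d D F"
    using loeb_ratio_nonneg[OF assms] by (auto simp: fmeasurable_def measure_def)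
qed

lemma loeb_fmeasurable:
  assumes "hyperfinite d F" "A \<in> sets (loeb star ext d F)"
  shows "A \<in> fmeasurable (loeb star ext d F)"
proof (rule fmeasurableI2)
  show "F \<in> fmeasurable (loeb star ext d F)"
    using loeb_internal(1)[OF assms(1) hyperfinite_internal[OF assms(1)]] by simp
  show "A \<subseteq> F"
    using sets.sets_into_space[OF assms(2)] by (simp add: loeb_eq)
qed (rule assms(2))

text \<open>The union of the inner sets and the intersection of the outer sets are measurable with
  equal measure, and the completed measure contains every set caught between two such sets.\<close>

lemma loeb_sandwich:
  assumes F: "hyperfinite d F"
    and approx: "\<And>e. 0 < e \<Longrightarrow> \<exists>I K. internal ext d I \<and> internal ext d K \<and> I \<subseteq> X \<and> X \<subseteq> K \<and> K \<subseteq> F \<and>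
      loeb_ratio d K F \<le> loeb_ratio d I F + e"
  shows "X \<in> sets (loeb star ext d F)"
proof -
  let ?L = "loeb star ext d F"
  have "\<forall>n::nat. \<exists>I K. internal ext d I \<and> internal ext d K \<and> I \<subseteq> X \<and> X \<subseteq> K \<and> K \<subseteq> F \<and>
      loeb_ratio d K F \<le> loeb_ratio d I F + 1 / real (Suc n)"
    by (intro allI approx) simp
  then obtain I K where IK: "\<And>n. internal ext d (I n)" "\<And>n. internal ext d (K n)"
    "\<And>n. I n \<subseteq> X" "\<And>n. X \<subseteq> K n" "\<And>n. K n \<subseteq> F"
    "\<And>n. loeb_ratio d (K n) F \<le> loeb_ratio d (I n) F + 1 / real (Suc n)"
    by metis
  have I: "I n \<in> fmeasurable ?L" "measure ?L (I n) = loeb_ratio d (I n) F" for n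
    using loeb_internal[OF F IK(1)] IK(3-5) by blast+
  have K: "K n \<in> fmeasurable ?L" "measure ?L (K n) = loeb_ratio d (K n) F" for n
    using loeb_internal[OF F IK(2)] IK(5) by blast+
  have "range I \<subseteq> sets ?L" "range K \<subseteq> sets ?L"
    using fmeasurableD[OF I(1)] fmeasurableD[OF K(1)] by blast+
  then have A: "(\<Union>n. I n) \<in> fmeasurable ?L" and B: "(\<Inter>n. K n) \<in> fmeasurable ?L"
    using sets.countable_UN[of I UNIV ?L] sets.countable_INT[of K UNIV ?L]
    by (simp_all add: loeb_fmeasurable[OF F])
  have "measure ?L (\<Inter>n. K n) \<le> measure ?L (\<Union>n. I n) + 1 / real (Suc n)" for n
  proof -
    have "measure ?L (\<Inter>n. K n) \<le> measure ?L (K n)"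
      by (rule measure_mono_fmeasurable) (use K B in auto)
    also have "\<dots> \<le> measure ?L (I n) + 1 / real (Suc n)"
      using IK(6) I K by simp
    also have "measure ?L (I n) \<le> measure ?L (\<Union>n. I n)"
      by (rule measure_mono_fmeasurable) (use I A in auto)
    finally show ?thesis by simp
  qed
  then have close: "measure ?L (\<Inter>n. K n) \<le> measure ?L (\<Union>n. I n) + 1 / real (Suc n)" for n .
  have "measure ?L (\<Inter>n. K n) \<le> measure ?L (\<Union>n. I n)"
  proof (rule field_le_epsilon)
    fix e :: real assume "0 < e"
    then obtain n where "1 / real (Suc n) < e" by (rule nat_approx_posE)
    with close[of n] show "measure ?L (\<Inter>n. K n) \<le> measure ?L (\<Union>n. I n) + e"
      by linarith
  qed
  moreover have sub: "(\<Union>n. I n) \<subseteq> X" "X \<subseteq> (\<Inter>n. K n)"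
    using IK(3,4) by blast+
  moreover have "measure ?L (\<Union>n. I n) \<le> measure ?L (\<Inter>n. K n)"
    by (rule measure_mono_fmeasurable[OF _ fmeasurableD[OF A] B]) (use sub in blast)
  ultimately have "measure ?L (\<Union>n. I n) = measure ?L (\<Inter>n. K n)"
    by simp
  then have "X \<in> fmeasurable ?L"
    using completion.complete_sets_sandwich_fmeasurable[of "\<Union>n. I n" "loeb_base d F" "\<Inter>n. K n" X]
      A B sub unfolding loeb_eq by blast
  then show ?thesis by (rule fmeasurableD)
qed

lemma loeb_null:
  assumes F: "hyperfinite d F"
    and approx: "\<And>e. 0 < e \<Longrightarrow> \<exists>K. internal ext d K \<and> X \<subseteq> K \<and> K \<subseteq> F \<and> loeb_ratio d K F \<le> e"
  shows "X \<in> null_sets (loeb star ext d F)"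
proof -
  have "X \<in> sets (loeb star ext d F)"
  proof (rule loeb_sandwich[OF F])
    fix e :: real assume "0 < e"
    then show "\<exists>I K. internal ext d I \<and> internal ext d K \<and> I \<subseteq> X \<and> X \<subseteq> K \<and> K \<subseteq> F \<and>
      loeb_ratio d K F \<le> loeb_ratio d I F + e"
      using approx[of e] internal_empty loeb_ratio_empty[OF F] by (metis add_0 empty_subsetI)
  qed
  then have X: "X \<in> fmeasurable (loeb star ext d F)"
    by (rule loeb_fmeasurable[OF F])
  have "measure (loeb star ext d F) X \<le> e" if e: "0 < e" for e
  proof -
    obtain K where K: "internal ext d K" "X \<subseteq> K" "K \<subseteq> F" "loeb_ratio d K F \<le> e"
      using approx[OF e] by blast
    have "measure (loeb star ext d F) X \<le> measure (loeb star ext d F) K"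
      by (rule measure_mono_fmeasurable) (use K X loeb_internal[OF F] in auto)
    with K loeb_internal(2)[OF F] show ?thesis by simp
  qed
  then have "measure (loeb star ext d F) X = 0"
    using field_le_epsilon[of "measure (loeb star ext d F) X" 0] by (intro antisym) auto
  with X show ?thesis
    by (simp add: null_sets_def emeasure_eq_measure2 fmeasurableD)
qed

end

section \<open>Cubes in the integer lattice\<close>

text \<open>Sup-norm distance at most \<open>n\<close>; \<open>list_all2\<close> also makes the
  dimensions agree.\<close>

definition near :: "int \<Rightarrow> int list \<Rightarrow> int list \<Rightarrow> bool" where
  "near n = list_all2 (\<lambda>a b. \<bar>a - b\<bar> \<le> n)"

definition cube :: "int list \<Rightarrow> int \<Rightarrow> int list set" where
  "cube x n = {z. near n x z}"

definition thicken :: "int list set \<Rightarrow> int \<Rightarrow> int list set" where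
  "thicken B n = (\<Union>y\<in>B. cube y n)"

lemma near_length: "near n x y \<Longrightarrow> length y = length x"
  by (simp add: near_def list_all2_lengthD)

lemma near_refl: "0 \<le> n \<Longrightarrow> near n x x"
  by (simp add: near_def list_all2_same)

lemma near_sym: "near n x y \<Longrightarrow> near n y x"
  by (simp add: near_def list_all2_conv_all_nth abs_minus_commute)

lemma near_trans: "near m x y \<Longrightarrow> near n y z \<Longrightarrow> near (m + n) x z"
  unfolding near_def by (rule list_all2_trans) (auto simp: algebra_simps)

lemma near_mono: "near m x y \<Longrightarrow> m \<le> n \<Longrightarrow> near n x y"
  unfolding near_def by (erule list_all2_mono) simp

lemma cube_card:
  assumes "0 \<le> n"
  shows "finite (cube x n) \<and> card (cube x n) = nat (2 * n + 1) ^ length x"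
proof (induction x)
  case Nil
  have "cube [] n = {[]}" by (auto simp: cube_def near_def)
  then show ?case by simp
next
  case (Cons a x)
  have eq: "cube (a # x) n = (\<lambda>(b, z). b # z) ` ({a - n..a + n} \<times> cube x n)"
    by (auto simp: cube_def near_def list_all2_Cons1 image_iff)
  have inj: "inj_on (\<lambda>(b, z). b # z) ({a - n..a + n} \<times> cube x n)"
    by (auto simp: inj_on_def)
  have "card ({a - n..a + n} \<times> cube x n) = nat (2 * n + 1) * nat (2 * n + 1) ^ length x"
    using Cons assms by (simp add: card_cartesian_product algebra_simps)
  with Cons show ?case
    unfolding eq by (simp add: card_image[OF inj])
qed

text \<open>The doubling constant comes from \<open>4n + 1 \<le> 2(2n + 1)\<close> in each
  coordinate.\<close>

lemma cube_double:
  assumes "0 \<le> n"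
  shows "card (cube x (2 * n)) \<le> 2 ^ length x * card (cube x n)"
proof -
  have "nat (2 * (2 * n) + 1) \<le> 2 * nat (2 * n + 1)"
    using assms by linarith
  then have "nat (2 * (2 * n) + 1) ^ length x \<le> (2 * nat (2 * n + 1)) ^ length x"
    by (rule power_mono) simp
  then show ?thesis
    using cube_card[of n x] cube_card[of "2 * n" x] assms by (simp only: power_mult_distrib)
qed

text \<open>Greedy choice: take a cube of largest radius, discard the centres whose cubes meet it,
  and recurse. A discarded centre has radius at most \<open>r x\<close>, hence lies within
  \<open>2 * r x\<close> of \<open>x\<close>. Only centres have to be covered, so the factor is 2
  and not the usual 3.\<close>

lemma vitali:
  fixes r :: "int list \<Rightarrow> int"
  assumes "finite X" "\<And>x. x \<in> X \<Longrightarrow> 0 \<le> r x"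
  obtains Y where "Y \<subseteq> X" "disjoint_family_on (\<lambda>y. cube y (r y)) Y"
    "X \<subseteq> (\<Union>y\<in>Y. cube y (2 * r y))"
proof -
  have "\<exists>Y\<subseteq>X. disjoint_family_on (\<lambda>y. cube y (r y)) Y \<and> X \<subseteq> (\<Union>y\<in>Y. cube y (2 * r y))"
    using assms
  proof (induction X rule: finite_psubset_induct)
    case (psubset X)
    show ?case
    proof (cases "X = {}")
      case False
      have "Max (r ` X) \<in> r ` X"
        using psubset.hyps False by (intro Max_in) auto
      then obtain x where x: "x \<in> X" and "r x = Max (r ` X)" by force
      then have max: "r y \<le> r x" if "y \<in> X" for y
        using psubset.hyps that by simp
      define X' where "X' = {y \<in> X. cube y (r y) \<inter> cube x (r x) = {}}"
      have self: "y \<in> cube y (r y)" if "y \<in> X" for y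
        using psubset.prems[OF that] by (simp add: cube_def near_refl)
      then have "X' \<subset> X"
        using x by (auto simp: X'_def)
      from psubset.IH[OF this] psubset.prems obtain Y where Y: "Y \<subseteq> X'"
        "disjoint_family_on (\<lambda>y. cube y (r y)) Y" "X' \<subseteq> (\<Union>y\<in>Y. cube y (2 * r y))"
        unfolding X'_def by auto
      have "X - X' \<subseteq> cube x (2 * r x)"
      proof
        fix y assume y: "y \<in> X - X'"
        then obtain z where "near (r y) y z" "near (r x) x z"
          by (auto simp: X'_def cube_def)
        then have "near (r x + r y) x y"
          using near_trans near_sym by blast
        then show "y \<in> cube x (2 * r x)"
          using near_mono max[of y] y by (auto simp: cube_def)
      qed
      then have "X \<subseteq> (\<Union>y\<in>insert x Y. cube y (2 * r y))"
        using Y(3) by blast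
      moreover have "disjoint_family_on (\<lambda>y. cube y (r y)) (insert x Y)"
        using Y(1,2) unfolding disjoint_family_on_def X'_def by blast
      moreover have "insert x Y \<subseteq> X"
        using x Y(1) by (auto simp: X'_def)
      ultimately show ?thesis by blast
    qed (auto simp: disjoint_family_on_def)
  qed
  with that show ?thesis by blast
qed

text \<open>Each of Vitali's disjoint cubes lies in \<open>T\<close> and has more than the share
  \<open>1 - \<rho>\<close> of its points outside \<open>S\<close>, so together they hold at most
  \<open>card (T - S) / (1 - \<rho>)\<close> points. Doubling them to cover \<open>X\<close> costs
  the factor \<open>2 ^ d\<close>.\<close>

lemma sparse_points_bound:
  fixes \<rho> :: real
  assumes "finite X" "finite T" "0 < \<rho>" "\<rho> < 1"
    and X: "\<And>x. x \<in> X \<Longrightarrow> length x = d \<and>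
      (\<exists>n\<ge>0. cube x n \<subseteq> T \<and> real (card (S \<inter> cube x n)) < \<rho> * real (card (cube x n)))"
  shows "(1 - \<rho>) * real (card X) \<le> 2 ^ d * real (card (T - S))"
proof -
  define Q where "Q x n \<longleftrightarrow> 0 \<le> n \<and> cube x n \<subseteq> T \<and>
      real (card (S \<inter> cube x n)) < \<rho> * real (card (cube x n))" for x n
  have "\<forall>x\<in>X. \<exists>n. Q x n"
    using X by (simp add: Q_def)
  then obtain r where "\<forall>x\<in>X. Q x (r x)"
    by (auto dest: bchoice)
  then have r: "\<And>x. x \<in> X \<Longrightarrow> 0 \<le> r x \<and> cube x (r x) \<subseteq> T \<and>
      real (card (S \<inter> cube x (r x))) < \<rho> * real (card (cube x (r x)))"
    by (simp add: Q_def)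
  obtain Y where Y: "Y \<subseteq> X" "disjoint_family_on (\<lambda>y. cube y (r y)) Y"
    "X \<subseteq> (\<Union>y\<in>Y. cube y (2 * r y))"
    by (rule vitali[OF assms(1), of r]) (use r in auto)
  have finY: "finite Y" using Y(1) assms(1) finite_subset by blast
  have fin: "finite (cube y (c * r y))" if "y \<in> Y" "c \<ge> 0" for y c
    using that Y(1) r cube_card[of "c * r y" y] by (auto simp: subset_iff)
  have "card X \<le> card (\<Union>y\<in>Y. cube y (2 * r y))"
    using Y(3) finY fin by (intro card_mono) auto
  also have "\<dots> \<le> (\<Sum>y\<in>Y. card (cube y (2 * r y)))"
    by (rule card_UN_le[OF finY])
  also have "\<dots> \<le> (\<Sum>y\<in>Y. 2 ^ d * card (cube y (r y)))"
  proof (rule sum_mono)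
    fix y assume "y \<in> Y"
    then have "y \<in> X" using Y(1) by blast
    then show "card (cube y (2 * r y)) \<le> 2 ^ d * card (cube y (r y))"
      using cube_double[of "r y" y] r[of y] X[of y] by simp
  qed
  finally have "real (card X) \<le> 2 ^ d * (\<Sum>y\<in>Y. real (card (cube y (r y))))"
    by (simp add: sum_distrib_left of_nat_le_iff[where 'a = real, symmetric] del: of_nat_le_iff)
  then have "(1 - \<rho>) * real (card X) \<le> (1 - \<rho>) * (2 ^ d * (\<Sum>y\<in>Y. real (card (cube y (r y)))))"
    using assms(4) by (intro mult_left_mono) auto
  also have "\<dots> = 2 ^ d * (\<Sum>y\<in>Y. (1 - \<rho>) * real (card (cube y (r y))))"
    by (simp add: sum_distrib_left algebra_simps)
  also have "(\<Sum>y\<in>Y. (1 - \<rho>) * real (card (cube y (r y)))) \<le> (\<Sum>y\<in>Y. real (card (cube y (r y) - S)))"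
  proof (rule sum_mono)
    fix y assume "y \<in> Y"
    then have y: "y \<in> X" "finite (cube y (r y))" using Y(1) fin[of y 1] by auto
    have "card (cube y (r y) - S) + card (S \<inter> cube y (r y)) = card (cube y (r y))"
      using y(2) by (metis Int_commute card_Int_Diff add.commute)
    then show "(1 - \<rho>) * real (card (cube y (r y))) \<le> real (card (cube y (r y) - S))"
      using r[OF y(1)] by (simp add: algebra_simps of_nat_add[symmetric] del: of_nat_add)
  qed
  also have "(\<Sum>y\<in>Y. real (card (cube y (r y) - S))) = real (card (\<Union>y\<in>Y. cube y (r y) - S))"
    using finY fin[of _ 1] Y(2)
    by (subst card_UN_disjoint) (auto simp: disjoint_family_on_def)
  also have "\<dots> \<le> real (card (T - S))"
    using r Y(1) assms(2) by (intro of_nat_mono card_mono) auto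
  finally show ?thesis by simp
qed

section \<open>Densities of thickened sets in cubes\<close>

lemma cube_mono: "m \<le> n \<Longrightarrow> cube x m \<subseteq> cube x n"
  using near_mono by (auto simp: cube_def)

lemma thicken_mono: "m \<le> n \<Longrightarrow> thicken B m \<subseteq> thicken B n"
  using cube_mono by (fastforce simp: thicken_def)

lemma finite_cube: "finite (cube x n)"
  using cube_card[of "\<bar>n\<bar>" x] cube_mono[of n "\<bar>n\<bar>" x] finite_subset by fastforce

lemma card_cube_pos: "0 \<le> n \<Longrightarrow> 0 < card (cube x n)"
  by (simp add: cube_card)

lemma cube_length: "z \<in> cube x n \<Longrightarrow> length z = length x"
  by (simp add: cube_def near_length)

text \<open>The thickness \<open>k\<close> is the last argument because the density is studied as a
  function of it: it is increasing with values in [0,1], as \<open>no_gap\<close> requires.\<close>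

definition cube_density :: "int list set \<Rightarrow> int list \<Rightarrow> int \<Rightarrow> int \<Rightarrow> real" where
  "cube_density B x n k = real (card (thicken B k \<inter> cube x n)) / real (card (cube x n))"

lemma cube_density_nonneg: "0 \<le> cube_density B x n k"
  by (simp add: cube_density_def)

lemma cube_density_le_1: "cube_density B x n k \<le> 1"
proof -
  have "card (thicken B k \<inter> cube x n) \<le> card (cube x n)"
    by (intro card_mono finite_cube) auto
  then show ?thesis by (auto simp: cube_density_def divide_le_eq_1)
qed

lemma cube_density_mono: "j \<le> k \<Longrightarrow> cube_density B x n j \<le> cube_density B x n k"
proof -
  assume "j \<le> k"
  then have "card (thicken B j \<inter> cube x n) \<le> card (thicken B k \<inter> cube x n)"
    using thicken_mono finite_cube by (intro card_mono) auto
  then show ?thesis by (simp add: cube_density_def divide_right_mono)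
qed

text \<open>Since \<open>v \<le> h\<close>, both thickenings of \<open>B\<close> lie inside the cube
  of radius \<open>2 * h\<close>, so the densities there count them completely. The constant is
  \<open>2 ^ d\<close> from the covering argument times \<open>2 ^ d\<close> from comparing the
  cubes of radius \<open>2 * h\<close> and \<open>h\<close>.\<close>

lemma sparse_cube_bound:
  fixes \<rho> :: real
  assumes B: "B \<subseteq> cube (replicate d 0) h" and uvh: "u \<le> v" "v \<le> h" "0 \<le> h" and \<rho>: "0 < \<rho>" "\<rho> < 1"
    and gap: "cube_density B (replicate d 0) (2 * h) v \<le> cube_density B (replicate d 0) (2 * h) u + \<delta>"
  shows "real (card {x \<in> cube (replicate d 0) h. \<exists>n\<ge>0. cube x n \<subseteq> thicken B v \<and>
      real (card (thicken B u \<inter> cube x n)) < \<rho> * real (card (cube x n))}) / real (card (cube (replicate d 0) h))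
    \<le> 4 ^ d * \<delta> / (1 - \<rho>)" (is "real (card ?X) / ?c \<le> _")
proof -
  let ?C = "cube (replicate d 0) (2 * h)"
  let ?S = "thicken B u" and ?T = "thicken B v"
  have T: "?T \<subseteq> ?C"
  proof
    fix z assume "z \<in> ?T"
    then obtain y where "y \<in> B" "near v y z" by (auto simp: thicken_def cube_def)
    with B have "near (h + v) (replicate d 0) z"
      using near_trans by (auto simp: cube_def)
    with uvh show "z \<in> ?C" by (auto simp: cube_def intro: near_mono)
  qed
  have ST: "?S \<subseteq> ?T" using uvh thicken_mono by blast
  have fin: "finite ?T" using T finite_cube finite_subset by blast
  have c: "0 < ?c" and C: "0 < real (card ?C)"
    using card_cube_pos uvh by simp_all
  have "real (card ?T) / real (card ?C) \<le> real (card ?S) / real (card ?C) + \<delta>"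
    using gap T ST by (simp add: cube_density_def Int_absorb2)
  then have "real (card ?T) - real (card ?S) \<le> \<delta> * real (card ?C)"
    using C by (simp add: field_simps)
  then have diff: "real (card (?T - ?S)) \<le> \<delta> * real (card ?C)"
    using card_Diff_subset[OF finite_subset[OF ST fin] ST] card_mono[OF fin ST] by (simp add: of_nat_diff)
  \<comment> \<open>The sign of \<delta> follows from the gap hypothesis, which bounds a cardinality
    by a multiple of it.\<close>
  have "0 \<le> \<delta> * real (card ?C)" using diff by (rule order_trans[rotated]) simp
  then have "0 \<le> \<delta>" using C by (simp add: zero_le_mult_iff)
  have "card ?C \<le> 2 ^ d * card (cube (replicate d 0) h)"
    using cube_double[OF uvh(3), of "replicate d 0"] by simp
  then have double: "real (card ?C) \<le> 2 ^ d * ?c"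
    by (metis of_nat_le_iff of_nat_mult of_nat_numeral of_nat_power)
  have "(1 - \<rho>) * real (card ?X) \<le> 2 ^ d * real (card (?T - ?S))"
    by (rule sparse_points_bound[OF _ fin \<rho>]) (auto simp: finite_cube dest: cube_length)
  also have "\<dots> \<le> 2 ^ d * (\<delta> * (2 ^ d * ?c))"
    using diff mult_left_mono[OF double \<open>0 \<le> \<delta>\<close>] by (intro mult_left_mono) auto
  also have "\<dots> = 4 ^ d * \<delta> * ?c"
    by (simp add: power_mult_distrib[symmetric] flip: mult.assoc)
  finally show ?thesis
    using c \<rho> by (simp add: divide_le_eq pos_le_divide_eq mult.commute mult.left_commute)
qed

section \<open>Boxes\<close>

declare pt_singleton [simp del]

text \<open>From here on hyperintegers are kept as points \<open>pt [k]\<close> of dimension one,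
  and \<open>sc\<close> reads the integer back.\<close>

definition sc :: "entity list \<Rightarrow> int" where
  "sc b = hd (pt_inv b)"

lemma sc_pt [simp]: "sc (pt [k]) = k"
  by (simp add: sc_def)

text \<open>Ordinary induction on the integers, applied later in each instance, takes the place of
  an internal induction over hyperintegers.\<close>

lemma first_crossing:
  fixes g :: "int \<Rightarrow> real"
  assumes "a \<le> b" "\<not> c \<le> g a" "c \<le> g b"
  shows "\<exists>m\<ge>a. m < b \<and> \<not> c \<le> g m \<and> c \<le> g (m + 1)"
  using assms(1,3)
proof (induction b rule: int_ge_induct)
  case base
  with assms(2) show ?case by simp
next
  case (step i)
  show ?case
  proof (cases "c \<le> g i")
    case True
    with step.IH show ?thesis by force
  next
    case False
    with step show ?thesis by force
  qed
qed

context nonstandard_universe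
begin

lemma internal_set_val_list:
  assumes "list_all2 (val bss) bs fs" "val bss x h"
  shows "x \<in> internal_set d g bs \<longleftrightarrow>
     length x = d \<and> (\<forall>\<^sub>F zs in ult bss. h zs \<in> pt ` g (map (\<lambda>f. f zs) fs))"
  unfolding internal_set_reparam[OF assms(1)] internal_set_val[OF assms(2)] ..

lemma point_val:
  assumes "val bss x f" "set x \<subseteq> hints ext"
  shows "\<forall>\<^sub>F zs in ult bss. f zs = pt (pt_inv (f zs))"
  using assms(2) unfolding hints_tuple[OF assms(1)] by eventually_elim (auto simp: range_pt_imp)

lemma scalar_val:
  assumes "val bss [u] f" "u \<in> hints ext"
  shows "\<forall>\<^sub>F zs in ult bss. f zs = pt [sc (f zs)]"
  using assms(2) unfolding hints_val[OF assms(1)] by eventually_elim auto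

lemma hint_of_val: "val bss [u] (\<lambda>zs. pt [p zs]) \<Longrightarrow> u \<in> hints ext"
  by (subst hints_val) auto

lemma hypernats_hints: "u \<in> hypernats ext \<Longrightarrow> u \<in> hints ext"
proof -
  assume u: "u \<in> hypernats ext"
  have "val [[u]] [u] (\<lambda>zs. zs ! 0)" using val_nth[of 0 "[[u]]"] by simp
  then show ?thesis
    using u by (simp add: hints_val hypernats_val) (auto elim!: eventually_mono)
qed

lemma int_val_ex: obtains u where "val bss [u] (\<lambda>zs. pt [p zs])"
proof -
  obtain b where "length b = 1" "val bss b (\<lambda>zs. pt [p zs])"
    by (rule val_ex[of "\<lambda>zs. pt [p zs]" 1 bss]) auto
  then show ?thesis using that by (auto simp: length_Suc_conv)
qed

lemma hle_int:
  "val bss [x] (\<lambda>zs. pt [p zs]) \<Longrightarrow> val bss [y] (\<lambda>zs. pt [q zs]) \<Longrightarrow>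
     hle ext x y \<longleftrightarrow> (\<forall>\<^sub>F zs in ult bss. p zs \<le> q zs)"
  using hle_val[of bss x "\<lambda>zs. of_int (p zs)" y "\<lambda>zs. of_int (q zs)"] by (simp add: pt_singleton)

lemma hless_int:
  "val bss [x] (\<lambda>zs. pt [p zs]) \<Longrightarrow> val bss [y] (\<lambda>zs. pt [q zs]) \<Longrightarrow>
     hless ext x y \<longleftrightarrow> (\<forall>\<^sub>F zs in ult bss. p zs < q zs)"
  using hless_val[of bss x "\<lambda>zs. of_int (p zs)" y "\<lambda>zs. of_int (q zs)"] by (simp add: pt_singleton)

lemma hplus_int:
  "val bss [x] (\<lambda>zs. pt [p zs]) \<Longrightarrow> val bss [y] (\<lambda>zs. pt [q zs]) \<Longrightarrow>
     val bss [hplus ext x y] (\<lambda>zs. pt [p zs + q zs])"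
  using hplus_val[of bss x "\<lambda>zs. of_int (p zs)" y "\<lambda>zs. of_int (q zs)"] by (simp add: pt_singleton)

lemma huminus_int:
  "val bss [x] (\<lambda>zs. pt [p zs]) \<Longrightarrow> val bss [huminus ext x] (\<lambda>zs. pt [- p zs])"
  using huminus_val[of bss x "\<lambda>zs. of_int (p zs)"] by (simp add: pt_singleton)

lemma hypernats_int:
  "val bss [x] (\<lambda>zs. pt [p zs]) \<Longrightarrow> x \<in> hypernats ext \<longleftrightarrow> (\<forall>\<^sub>F zs in ult bss. 1 \<le> p zs)"
  by (subst hypernats_val) auto

lemma scalar_val':
  assumes "val bss [u] f" "u \<in> hints ext"
  shows "val bss [u] (\<lambda>zs. pt [sc (f zs)])"
  using val_cong[THEN iffD1, OF scalar_val[OF assms] assms(1)] .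

lemma scalar_nth:
  "i < length bss \<Longrightarrow> bss ! i = [u] \<Longrightarrow> u \<in> hints ext \<Longrightarrow> val bss [u] (\<lambda>zs. pt [sc (zs ! i)])"
  using scalar_val'[of bss u "\<lambda>zs. zs ! i"] val_nth[of i bss] by simp

lemma point_nth:
  assumes "i < length bss" "bss ! i = x" "set x \<subseteq> hints ext"
  shows "val bss x (\<lambda>zs. pt (pt_inv (zs ! i)))"
proof -
  have "val bss x (\<lambda>zs. zs ! i)" using val_nth[of i bss] assms by simp
  from val_cong[THEN iffD1, OF point_val[OF this assms(3)] this] show ?thesis .
qed

lemma hle_trans:
  assumes "x \<in> hints ext" "y \<in> hints ext" "z \<in> hints ext" "hle ext x y" "hle ext y z"
  shows "hle ext x z"
proof -
  let ?b = "[[x], [y], [z]]"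
  have v: "val ?b [x] (\<lambda>zs. pt [sc (zs ! 0)])" "val ?b [y] (\<lambda>zs. pt [sc (zs ! 1)])"
    "val ?b [z] (\<lambda>zs. pt [sc (zs ! 2)])"
    by (rule scalar_nth; use assms in simp)+
  show ?thesis
    using assms(4,5) unfolding hle_int[OF v(1,2)] hle_int[OF v(2,3)] hle_int[OF v(1,3)]
    by eventually_elim simp
qed

lemma hle_iff_not_hless:
  assumes "x \<in> hints ext" "y \<in> hints ext"
  shows "hle ext x y \<longleftrightarrow> \<not> hless ext y x"
proof -
  let ?b = "[[x], [y]]"
  have v: "val ?b [x] (\<lambda>zs. pt [sc (zs ! 0)])" "val ?b [y] (\<lambda>zs. pt [sc (zs ! 1)])"
    by (rule scalar_nth; use assms in simp)+
  show ?thesis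
    unfolding hle_int[OF v] hless_int[OF v(2,1)] ev_not[symmetric] by (simp add: not_less)
qed

lemma hless_imp_hle:
  assumes "x \<in> hints ext" "y \<in> hints ext" "hless ext x y"
  shows "hle ext x y"
proof -
  let ?b = "[[x], [y]]"
  have v: "val ?b [x] (\<lambda>zs. pt [sc (zs ! 0)])" "val ?b [y] (\<lambda>zs. pt [sc (zs ! 1)])"
    by (rule scalar_nth; use assms in simp)+
  show ?thesis
    using assms(3) unfolding hle_int[OF v] hless_int[OF v] by eventually_elim simp
qed

text \<open>Lets one property be compared at several scalars over the same parameters
  \<open>bss\<close>: each scalar is expressed over the longer list, where the auxiliary objects
  \<open>A\<close> stand in front and are dropped.\<close>

lemma val_prefix:
  assumes "val (A @ bss) [u] (\<lambda>zs. pt [p zs])"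
  shows "(\<forall>\<^sub>F zs in ult ([u] # bss). P (sc (zs ! 0)) (tl zs)) \<longleftrightarrow>
     (\<forall>\<^sub>F zs in ult (A @ bss). P (p zs) (drop (length A) zs))"
proof -
  let ?n = "length bss" and ?k = "length A"
  have "list_all2 (val (A @ bss)) bss (map (\<lambda>i zs. zs ! (?k + i)) [0..<?n])"
  proof (rule list_all2_all_nthI)
    fix i assume "i < ?n"
    with val_nth[of "?k + i" "A @ bss"]
    show "val (A @ bss) (bss ! i) (map (\<lambda>i zs. zs ! (?k + i)) [0..<?n] ! i)"
      by (simp add: nth_append)
  qed simp
  with assms have "list_all2 (val (A @ bss)) ([u] # bss)
      ((\<lambda>zs. pt [p zs]) # map (\<lambda>i zs. zs ! (?k + i)) [0..<?n])"
    by simp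
  from val_ev[OF this] have "(\<forall>\<^sub>F zs in ult ([u] # bss). P (sc (zs ! 0)) (tl zs)) \<longleftrightarrow>
      (\<forall>\<^sub>F zs in ult (A @ bss). P (p zs) (map (\<lambda>i. zs ! (?k + i)) [0..<?n]))"
    by (simp add: comp_def)
  also have "\<dots> \<longleftrightarrow> (\<forall>\<^sub>F zs in ult (A @ bss). P (p zs) (drop (length A) zs))"
    using ev_nth_length[of "A @ bss"]
  proof (rule eventually_cong)
    fix zs :: "entity list list"
    assume "length zs = length (A @ bss) \<and> (\<forall>i<length (A @ bss). length (zs ! i) = length ((A @ bss) ! i))"
    then have "map (\<lambda>i. zs ! (?k + i)) [0..<?n] = drop ?k zs"
      by (intro nth_equalityI) auto
    then show "P (p zs) (map (\<lambda>i. zs ! (?k + i)) [0..<?n]) \<longleftrightarrow> P (p zs) (drop ?k zs)"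
      by simp
  qed
  finally show ?thesis .
qed

lemma coord_val:
  assumes "val bss x (\<lambda>zs. pt (f zs))" "i < length x"
  shows "val bss [x ! i] (\<lambda>zs. pt [f zs ! i])"
proof -
  have "\<forall>\<^sub>F zs in ult bss. [pt (f zs) ! i] = pt [f zs ! i]"
    using val_length[OF assms(1)] by eventually_elim (use assms(2) in \<open>simp add: pt_def\<close>)
  with val_coord[OF assms] show ?thesis
    by (rule val_cong[THEN iffD1, rotated])
qed

lemma tuple_plus_val:
  assumes "val bss y (\<lambda>zs. pt (f zs))" "val bss w (\<lambda>zs. pt (g zs))" "length w = length y"
  shows "val bss (tuple_plus ext y w) (\<lambda>zs. pt (map2 (+) (f zs) (g zs)))"
proof (rule val_of_coords)
  have len: "\<forall>\<^sub>F zs in ult bss. length (f zs) = length y \<and> length (g zs) = length y"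
    using val_length[OF assms(1)] val_length[OF assms(2)] by eventually_elim (simp add: assms(3))
  then show "\<forall>\<^sub>F zs in ult bss. length (pt (map2 (+) (f zs) (g zs))) = length (tuple_plus ext y w)"
    by eventually_elim (simp add: tuple_plus_def assms(3))
  fix i assume "i < length (tuple_plus ext y w)"
  then have i: "i < length y" "i < length w" by (auto simp: tuple_plus_def)
  have "val bss [y ! i] (\<lambda>zs. pt [f zs ! i])" "val bss [w ! i] (\<lambda>zs. pt [g zs ! i])"
    by (rule coord_val[OF assms(1) i(1)], rule coord_val[OF assms(2) i(2)])
  then have "val bss [hplus ext (y ! i) (w ! i)] (\<lambda>zs. pt [f zs ! i + g zs ! i])"
    by (rule hplus_int)
  moreover have "\<forall>\<^sub>F zs in ult bss. pt [f zs ! i + g zs ! i] = [pt (map2 (+) (f zs) (g zs)) ! i]"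
    using len by eventually_elim (use i in \<open>simp add: pt_def\<close>)
  ultimately show "val bss [tuple_plus ext y w ! i] (\<lambda>zs. [pt (map2 (+) (f zs) (g zs)) ! i])"
    using i by (simp add: tuple_plus_def val_cong)
qed

section \<open>Boxes and their translates as internal sets\<close>

lemma hbox_val:
  assumes "val bss w (\<lambda>zs. pt (f zs))" "val bss [h] (\<lambda>zs. pt [p zs])"
  shows "w \<in> hbox ext d h \<longleftrightarrow> length w = d \<and> (\<forall>\<^sub>F zs in ult bss. near (p zs) (replicate d 0) (f zs))"
proof (cases "length w = d")
  case True
  have len: "\<forall>\<^sub>F zs in ult bss. length (f zs) = d"
    using val_length[OF assms(1)] True by simp
  have "w \<in> hbox ext d h \<longleftrightarrow> (\<forall>i\<in>{..<d}. w ! i \<in> hinterval ext (huminus ext h) h)"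
    using True by (auto simp: hbox_def tuples_def set_conv_nth)
  also have "\<dots> \<longleftrightarrow> (\<forall>i\<in>{..<d}. \<forall>\<^sub>F zs in ult bss. \<exists>k. pt [f zs ! i] = pt [k] \<and> - p zs \<le> k \<and> k \<le> p zs)"
    using hinterval_val[OF coord_val[OF assms(1)] huminus_int[OF assms(2)] assms(2)] True
    by (intro ball_cong) auto
  also have "\<dots> \<longleftrightarrow> (\<forall>\<^sub>F zs in ult bss. \<forall>i\<in>{..<d}. \<exists>k. pt [f zs ! i] = pt [k] \<and> - p zs \<le> k \<and> k \<le> p zs)"
    by (simp add: eventually_ball_finite_distrib)
  also have "\<dots> \<longleftrightarrow> (\<forall>\<^sub>F zs in ult bss. near (p zs) (replicate d 0) (f zs))"
  proof -
    have "- p zs \<le> a \<longleftrightarrow> - a \<le> p zs" for zs a by linarith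
    then show ?thesis
      by (intro eventually_cong[OF len]) (auto simp: near_def list_all2_conv_all_nth abs_le_iff)
  qed
  finally show ?thesis using True by simp
qed (simp add: hbox_def tuples_def)

lemma hbox_eq:
  assumes "h \<in> hints ext"
  shows "hbox ext d h = internal_set d (\<lambda>zs. cube (replicate d 0) (sc (zs ! 0))) [[h]]"
proof (rule set_eqI)
  fix x
  let ?b = "[[h], x]"
  have v: "val ?b [h] (\<lambda>zs. pt [sc (zs ! 0)])"
    by (rule scalar_nth; use assms in simp)
  have v0: "val ?b [h] (\<lambda>zs. zs ! 0)" and v1: "val ?b x (\<lambda>zs. zs ! 1)"
    using val_nth[of 0 ?b] val_nth[of 1 ?b] by auto
  show "x \<in> hbox ext d h \<longleftrightarrow> x \<in> internal_set d (\<lambda>zs. cube (replicate d 0) (sc (zs ! 0))) [[h]]"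
  proof (cases "set x \<subseteq> hints ext")
    case True
    have "val ?b x (\<lambda>zs. pt (pt_inv (zs ! 1)))"
      by (rule point_nth; use True in simp)
    from hbox_val[OF this v] internal_set_val_list[of ?b "[[h]]" "[\<lambda>zs. zs ! 0]", OF _ this] v0
    show ?thesis by (simp add: cube_def)
  next
    case False
    then have "x \<notin> internal_set d (\<lambda>zs. cube (replicate d 0) (sc (zs ! 0))) [[h]]"
      using internal_set_hints by blast
    moreover have "x \<notin> hbox ext d h"
      using False by (auto simp: hbox_def tuples_def hinterval_def)
    ultimately show ?thesis by simp
  qed
qed

lemma hbox_translate_eq:
  assumes "length x = d" "set x \<subseteq> hints ext" "n \<in> hints ext"
  shows "sumset ext {x} (hbox ext d n) =
     internal_set d (\<lambda>zs. cube (pt_inv (zs ! 0)) (sc (zs ! 1))) [x, [n]]"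
proof (intro set_eqI iffI)
  fix z assume "z \<in> sumset ext {x} (hbox ext d n)"
  then obtain w where w: "w \<in> hbox ext d n" and z: "z = tuple_plus ext x w"
    by (auto simp: sumset_def)
  have lw: "length w = d" "set w \<subseteq> hints ext"
    using w by (auto simp: hbox_def tuples_def hinterval_def)
  let ?b = "[x, [n], w]"
  have v: "val ?b x (\<lambda>zs. pt (pt_inv (zs ! 0)))" "val ?b w (\<lambda>zs. pt (pt_inv (zs ! 2)))"
    by (rule point_nth; use assms lw in simp)+
  have vn: "val ?b [n] (\<lambda>zs. pt [sc (zs ! 1)])"
    by (rule scalar_nth; use assms in simp)
  have "val ?b z (\<lambda>zs. pt (map2 (+) (pt_inv (zs ! 0)) (pt_inv (zs ! 2))))"
    unfolding z by (rule tuple_plus_val[OF v]) (simp add: lw assms)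
  moreover have "\<forall>\<^sub>F zs in ult ?b. map2 (+) (pt_inv (zs ! 0)) (pt_inv (zs ! 2)) \<in> cube (pt_inv (zs ! 0)) (sc (zs ! 1))"
  proof -
    have "\<forall>\<^sub>F zs in ult ?b. near (sc (zs ! 1)) (replicate d 0) (pt_inv (zs ! 2))"
      using w hbox_val[OF v(2) vn] by simp
    then show ?thesis
      using val_length[OF v(1)] by eventually_elim
        (auto simp: cube_def near_def list_all2_conv_all_nth assms(1))
  qed
  moreover have "length z = d"
    by (simp add: z tuple_plus_def assms lw)
  ultimately show "z \<in> internal_set d (\<lambda>zs. cube (pt_inv (zs ! 0)) (sc (zs ! 1))) [x, [n]]"
    using internal_set_val_list[of ?b "[x, [n]]" "[\<lambda>zs. zs ! 0, \<lambda>zs. zs ! 1]"] val_nth[of 0 ?b] val_nth[of 1 ?b]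
    by simp
next
  fix z assume z: "z \<in> internal_set d (\<lambda>zs. cube (pt_inv (zs ! 0)) (sc (zs ! 1))) [x, [n]]"
  then have lz: "length z = d" "set z \<subseteq> hints ext"
    using internal_set_hints by auto
  let ?b = "[x, [n], z]"
  have v: "val ?b x (\<lambda>zs. pt (pt_inv (zs ! 0)))" "val ?b z (\<lambda>zs. pt (pt_inv (zs ! 2)))"
    by (rule point_nth; use assms lz in simp)+
  have vn: "val ?b [n] (\<lambda>zs. pt [sc (zs ! 1)])"
    by (rule scalar_nth; use assms in simp)
  have len: "\<forall>\<^sub>F zs in ult ?b. length (zs ! 0) = d \<and> length (zs ! 2) = d"
    using val_length[OF v(1)] val_length[OF v(2)] by eventually_elim (simp add: assms lz)
  have near: "\<forall>\<^sub>F zs in ult ?b. near (sc (zs ! 1)) (pt_inv (zs ! 0)) (pt_inv (zs ! 2))"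
    using internal_set_val_list[of ?b "[x, [n]]" "[\<lambda>zs. zs ! 0, \<lambda>zs. zs ! 1]", OF _ v(2)] z
      val_nth[of 0 ?b] val_nth[of 1 ?b] by (simp add: cube_def)
  \<comment> \<open>The summand in the box is the difference of \<open>z\<close> and
    \<open>x\<close>, formed in each instance and then realized internally.\<close>
  let ?w = "\<lambda>zs. map2 (-) (pt_inv (zs ! 2)) (pt_inv (zs ! 0))"
  have "\<forall>\<^sub>F zs in ult ?b. length (pt (?w zs)) = d"
    using len by eventually_elim simp
  then obtain w where w: "length w = d" "val ?b w (\<lambda>zs. pt (?w zs))"
    by (rule val_ex)
  have "\<forall>\<^sub>F zs in ult ?b. near (sc (zs ! 1)) (replicate d 0) (?w zs)"
    using near len by eventually_elim
      (auto simp: near_def list_all2_conv_all_nth abs_minus_commute)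
  then have "w \<in> hbox ext d n"
    using hbox_val[OF w(2) vn] w(1) by simp
  moreover have "tuple_plus ext x w = z"
  proof (rule val_unique[OF tuple_plus_val[OF v(1) w(2)]])
    show "length w = length x" by (simp add: w assms)
    have "\<forall>\<^sub>F zs in ult ?b. pt (pt_inv (zs ! 2)) = pt (map2 (+) (pt_inv (zs ! 0)) (?w zs))"
      using len by eventually_elim (auto intro: nth_equalityI)
    from val_cong[THEN iffD1, OF this v(2)]
    show "val ?b z (\<lambda>zs. pt (map2 (+) (pt_inv (zs ! 0)) (?w zs)))" .
  qed
  ultimately show "z \<in> sumset ext {x} (hbox ext d n)"
    by (auto simp: sumset_def)
qed

end

section \<open>Cuts\<close>

locale cut_of_universe = nonstandard_universe star ext
  for star :: "entity \<Rightarrow> 'b" and ext :: "entity list set \<Rightarrow> 'b list set" +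
  fixes H :: 'b and U :: "'b set"
  assumes H: "H \<in> hypernats ext" and cut: "is_cut star ext H U"
begin

lemma hinterval_iff: "x \<in> hinterval ext (star (num 1)) H \<longleftrightarrow> x \<in> hypernats ext \<and> hle ext x H"
proof (cases "x \<in> hints ext")
  case True
  have v: "val [[x]] [x] (\<lambda>zs. pt [sc (zs ! 0)])" by (rule scalar_nth; use True in simp)
  have "val [[x]] [star (num 1)] (\<lambda>zs. pt [1])"
    using val_star[of "[[x]]" "num 1"] by (simp add: pt_singleton)
  from hle_int[OF this v] hypernats_int[OF v] True show ?thesis
    by (simp add: hinterval_def)
qed (use hypernats_hints in \<open>auto simp: hinterval_def\<close>)

lemma U_hypernats: "u \<in> U \<Longrightarrow> u \<in> hypernats ext \<and> hle ext u H"
  using cut hinterval_iff unfolding is_cut_def by blast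

lemma U_hints: "u \<in> U \<Longrightarrow> u \<in> hints ext"
  using U_hypernats hypernats_hints by blast

lemma U_initial: "u \<in> U \<Longrightarrow> v \<in> hypernats ext \<Longrightarrow> hle ext v u \<Longrightarrow> v \<in> U"
proof -
  assume *: "u \<in> U" "v \<in> hypernats ext" "hle ext v u"
  then have "hle ext v H"
    using hle_trans[of v u H] U_hypernats[of u] hypernats_hints H by blast
  with * show ?thesis
    using cut unfolding is_cut_def by (auto simp: hinterval_iff)
qed

lemma U_plus: "u \<in> U \<Longrightarrow> v \<in> U \<Longrightarrow> hplus ext u v \<in> U"
  using cut unfolding is_cut_def by blast

lemma U_nonempty: "U \<noteq> {}"
  using cut unfolding is_cut_def by blast

lemma above_hypernats: "v \<in> above ext U \<Longrightarrow> v \<in> hypernats ext \<and> v \<in> hints ext"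
  using hypernats_hints by (auto simp: above_def)

lemma U_less_above: "u \<in> U \<Longrightarrow> v \<in> above ext U \<Longrightarrow> hless ext u v"
  by (auto simp: above_def)

text \<open>The order is linear, so what is not in the initial segment exceeds all of it. That U is
  initial only within [1,H] does no harm, since anything below an element of U is at most H.\<close>

lemma above_iff:
  assumes "v \<in> hypernats ext"
  shows "v \<in> above ext U \<longleftrightarrow> v \<notin> U"
proof
  assume "v \<in> above ext U"
  then show "v \<notin> U"
    using hle_iff_not_hless[of v v] hypernats_hints[OF assms] U_less_above[of v v]
      hless_imp_hle[of v v] by auto
next
  assume "v \<notin> U"
  then have "\<not> hle ext v u" if "u \<in> U" for u
    using U_initial[OF that assms] by blast
  then show "v \<in> above ext U"
    using assms hle_iff_not_hless hypernats_hints U_hints by (auto simp: above_def)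
qed

lemma U_sum_bound:
  assumes "u \<in> U" "v \<in> U" "val bss [u] (\<lambda>zs. pt [p zs])" "val bss [v] (\<lambda>zs. pt [q zs])"
    and "val bss [w] (\<lambda>zs. pt [r zs])" "\<forall>\<^sub>F zs in ult bss. 1 \<le> r zs \<and> r zs \<le> p zs + q zs"
  shows "w \<in> U"
proof (rule U_initial[OF U_plus[OF assms(1,2)]])
  show "w \<in> hypernats ext"
    unfolding hypernats_int[OF assms(5)] using assms(6) by eventually_elim simp
  show "hle ext w (hplus ext u v)"
    unfolding hle_int[OF assms(5) hplus_int[OF assms(3,4)]] using assms(6) by eventually_elim simp
qed

lemma U_pos: "u \<in> U \<Longrightarrow> val bss [u] (\<lambda>zs. pt [p zs]) \<Longrightarrow> \<forall>\<^sub>F zs in ult bss. 1 \<le> p zs"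
  using U_hypernats hypernats_int by blast

text \<open>If H were in U, closure under addition would put \<open>H + H\<close> into U as well,
  beyond the bound H.\<close>

lemma H_above: "H \<in> above ext U"
proof -
  have v: "val [[H]] [H] (\<lambda>zs. pt [sc (zs ! 0)])"
    by (rule scalar_nth; use H hypernats_hints in simp)
  have "H \<notin> U"
  proof
    assume "H \<in> U"
    then have "hle ext (hplus ext H H) H"
      using U_plus U_hypernats by blast
    then have "\<forall>\<^sub>F zs in ult [[H]]. sc (zs ! 0) + sc (zs ! 0) \<le> sc (zs ! 0)"
      unfolding hle_int[OF hplus_int[OF v v] v] .
    then have "\<forall>\<^sub>F zs in ult [[H]]. False"
      using U_pos[OF \<open>H \<in> U\<close> v] by eventually_elim simp
    then show False by (simp add: ev_const)
  qed
  with H above_iff show ?thesis by blast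
qed

lemma U_upper_bound: "finite S \<Longrightarrow> S \<subseteq> U \<Longrightarrow> \<exists>u\<in>U. \<forall>s\<in>S. hle ext s u"
proof (induction S rule: finite_induct)
  case empty
  then show ?case using U_nonempty by blast
next
  case (insert s S)
  then obtain u where u: "u \<in> U" "\<forall>s\<in>S. hle ext s u" by blast
  have s: "s \<in> U" using insert.prems by simp
  show ?case
  proof (cases "hle ext s u")
    case True
    with u show ?thesis by blast
  next
    case False
    then have "hle ext u s" "hle ext s s"
      using hle_iff_not_hless hless_imp_hle U_hints s u(1) by blast+
    then have "\<forall>t\<in>insert s S. hle ext t s"
      using hle_trans[of _ u s] u U_hints insert.prems by blast
    with s show ?thesis by blast
  qed
qed

text \<open>
  If the conclusion failed, then \<open>U\<close> would be the set of all \<open>k \<le> H\<close> with \<open>g k < c\<close> for some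
  standard \<open>c\<close>. Such an internal set has a largest element, while \<open>U\<close> is closed under addition.
\<close>

lemma no_gap:
  fixes g :: "entity list list \<Rightarrow> int \<Rightarrow> real"
  assumes g: "\<And>zs k. 0 \<le> g zs k" "\<And>zs k. g zs k \<le> 1" "\<And>zs j k. j \<le> k \<Longrightarrow> g zs j \<le> g zs k"
    and e: "0 < e"
  obtains u v where "u \<in> U" "v \<in> above ext U" "hle ext v H"
    "\<forall>\<^sub>F zs in ult ([[u], [v]] @ bss). g (drop 2 zs) (sc (zs ! 1)) \<le> g (drop 2 zs) (sc (zs ! 0)) + e"
proof (rule ccontr)
  assume "\<not> thesis"
  with that have gap: "\<not> (\<forall>\<^sub>F zs in ult ([[u], [v]] @ bss).
      g (drop 2 zs) (sc (zs ! 1)) \<le> g (drop 2 zs) (sc (zs ! 0)) + e)"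
    if "u \<in> U" "v \<in> above ext U" "hle ext v H" for u v
    using that by blast
  define big where "big c u \<longleftrightarrow> (\<forall>\<^sub>F zs in ult ([u] # bss). c \<le> g (tl zs) (sc (zs ! 0)))" for c u
  \<comment> \<open>Values are measured in steps of \<open>e / 2\<close>, and \<open>k\<close> will
    be the last level reached on U. Elements of U then stay below level \<open>k + 1\<close>, while
    above U the assumed jump by more than \<open>e\<close> from level \<open>k\<close> passes it.
    Boundedness by 1 makes the number of levels finite.\<close>
  define P where "P k \<longleftrightarrow> (\<exists>u\<in>U. big (real k * e / 2) u)" for k
  have "P 0"
    using U_nonempty g(1) by (auto simp: P_def big_def)
  obtain n :: nat where n: "2 / e < real n" using reals_Archimedean2 by blast
  have "\<not> P n"
  proof
    assume "P n"
    then obtain u where "\<forall>\<^sub>F zs in ult ([u] # bss). real n * e / 2 \<le> g (tl zs) (sc (zs ! 0))"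
      by (auto simp: P_def big_def)
    then have "\<forall>\<^sub>F zs in ult ([u] # bss). real n * e / 2 \<le> 1"
      by eventually_elim (use g(2) order_trans in blast)
    then have "real n * e / 2 \<le> 1" by (simp only: ev_const)
    with n e show False by (simp add: field_simps)
  qed
  have "\<exists>k. P k \<and> \<not> P (Suc k)"
  proof (rule ccontr)
    assume *: "\<nexists>k. P k \<and> \<not> P (Suc k)"
    have "P m" for m by (induction m) (use \<open>P 0\<close> * in auto)
    with \<open>\<not> P n\<close> show False by blast
  qed
  then obtain k where k: "P k" "\<not> P (Suc k)" by blast
  define c where "c = real (Suc k) * e / 2"
  obtain u where u: "u \<in> U" "big (real k * e / 2) u" using k(1) by (auto simp: P_def)
  have small: "\<not> big c v" if "v \<in> U" for v using k(2) that by (auto simp: P_def c_def)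
  have large: "big c v" if v: "v \<in> above ext U" "hle ext v H" for v
  proof -
    let ?b = "[[u], [v]] @ bss"
    have vu: "val ?b [u] (\<lambda>zs. pt [sc (zs ! 0)])"
      by (rule scalar_nth; use U_hints[OF u(1)] in simp)
    have vv: "val ?b [v] (\<lambda>zs. pt [sc (zs ! 1)])"
      by (rule scalar_nth; use above_hypernats[OF v(1)] in simp)
    have "\<forall>\<^sub>F zs in ult ?b. \<not> g (drop 2 zs) (sc (zs ! 1)) \<le> g (drop 2 zs) (sc (zs ! 0)) + e"
      using gap[OF u(1) v] by (simp only: ev_not not_False_eq_True)
    moreover have "\<forall>\<^sub>F zs in ult ?b. real k * e / 2 \<le> g (drop 2 zs) (sc (zs ! 0))"
      using u(2) val_prefix[OF vu, of "\<lambda>i zs. real k * e / 2 \<le> g zs i"]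
      by (simp add: big_def numeral_2_eq_2)
    ultimately have "\<forall>\<^sub>F zs in ult ?b. c \<le> g (drop 2 zs) (sc (zs ! 1))"
      by eventually_elim (use e in \<open>simp add: c_def field_simps\<close>)
    then show ?thesis
      using val_prefix[OF vv, of "\<lambda>i zs. c \<le> g zs i"] by (simp add: big_def numeral_2_eq_2)
  qed
  let ?b = "[[u], [H]] @ bss"
  have vu: "val ?b [u] (\<lambda>zs. pt [sc (zs ! 0)])"
    by (rule scalar_nth; use U_hints[OF u(1)] in simp)
  have vH: "val ?b [H] (\<lambda>zs. pt [sc (zs ! 1)])"
    by (rule scalar_nth; use hypernats_hints[OF H] in simp)
  have big_iff: "big c x \<longleftrightarrow> (\<forall>\<^sub>F zs in ult ?b. c \<le> g (drop 2 zs) (p zs))"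
    if "val ?b [x] (\<lambda>zs. pt [p zs])" for x p
    using val_prefix[OF that, of "\<lambda>i zs. c \<le> g zs i"] by (simp add: big_def numeral_2_eq_2)
  have HH: "hle ext H H"
    unfolding hle_int[OF vH vH] by simp
  \<comment> \<open>The crossing of the threshold between \<open>u\<close>, where \<open>g\<close>
    is below \<open>c\<close>, and \<open>H\<close>, where it is not. Being chosen in each instance,
    it defines an internal number: the largest one below the threshold.\<close>
  define \<mu> where "\<mu> zs = (SOME m. sc (zs ! 0) \<le> m \<and> m < sc (zs ! 1) \<and>
      \<not> c \<le> g (drop 2 zs) m \<and> c \<le> g (drop 2 zs) (m + 1))" for zs
  have nu: "\<forall>\<^sub>F zs in ult ?b. \<not> c \<le> g (drop 2 zs) (sc (zs ! 0))"
    using small[OF u(1)] unfolding big_iff[OF vu] ev_not .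
  have nH: "\<forall>\<^sub>F zs in ult ?b. c \<le> g (drop 2 zs) (sc (zs ! 1))"
    using large[OF H_above HH] unfolding big_iff[OF vH] .
  have \<mu>: "\<forall>\<^sub>F zs in ult ?b. sc (zs ! 0) \<le> \<mu> zs \<and> \<mu> zs < sc (zs ! 1) \<and>
      \<not> c \<le> g (drop 2 zs) (\<mu> zs) \<and> c \<le> g (drop 2 zs) (\<mu> zs + 1)"
    using nu nH
  proof eventually_elim
    case (elim zs)
    then have "sc (zs ! 0) \<le> sc (zs ! 1)"
      using g(3)[of "sc (zs ! 1)" "sc (zs ! 0)" "drop 2 zs"] by linarith
    from first_crossing[OF this elim] show ?case
      unfolding \<mu>_def by (rule someI2_ex) auto
  qed
  obtain x where x: "val ?b [x] (\<lambda>zs. pt [\<mu> zs])" by (rule int_val_ex)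
  obtain x' where x': "val ?b [x'] (\<lambda>zs. pt [\<mu> zs + 1])" by (rule int_val_ex)
  have pos: "\<forall>\<^sub>F zs in ult ?b. 1 \<le> \<mu> zs"
    using \<mu> U_pos[OF u(1) vu] by eventually_elim simp
  then have "x \<in> hypernats ext"
    using hypernats_int[OF x] by simp
  moreover have "hle ext x H"
    unfolding hle_int[OF x vH] using \<mu> by eventually_elim simp
  moreover have "\<not> big c x"
    unfolding big_iff[OF x] ev_not[symmetric] using \<mu> by eventually_elim simp
  ultimately have "x \<in> U"
    using large above_iff by blast
  \<comment> \<open>Here \<open>x'\<close> is \<open>x + 1\<close>, which is at most
    \<open>x + x\<close> because \<open>x\<close> is positive.\<close>
  then have "x' \<in> U"
    by (rule U_sum_bound[OF _ _ x x x']) (use \<open>x \<in> U\<close> pos in \<open>auto elim!: eventually_mono\<close>)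
  moreover have "big c x'"
    unfolding big_iff[OF x'] using \<mu> by eventually_elim simp
  ultimately show False using small by blast
qed

section \<open>The symmetrized cut as a union of intervals\<close>

lemma symmetrized_bound:
  assumes "w \<in> symmetrized star ext U"
  obtains u where "u \<in> U" "w \<in> hints ext" "hle ext (huminus ext u) w" "hle ext w u"
proof -
  note result = that
  have *: thesis if u: "u \<in> U" and w: "val [[u]] [w] (\<lambda>zs. pt [p zs])"
    "\<And>zs. 1 \<le> sc (zs ! 0) \<Longrightarrow> \<bar>p zs\<bar> \<le> sc (zs ! 0)" for u p
  proof (rule result)
    have v: "val [[u]] [u] (\<lambda>zs. pt [sc (zs ! 0)])"
      by (rule scalar_nth; use U_hints[OF u(1)] in simp)
    show "u \<in> U" by fact
    show "w \<in> hints ext" using w(1) by (rule hint_of_val)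
    show "hle ext (huminus ext u) w"
      unfolding hle_int[OF huminus_int[OF v] w(1)] using U_pos[OF u v]
      by eventually_elim (use w(2) in fastforce)
    show "hle ext w u"
      unfolding hle_int[OF w(1) v] using U_pos[OF u v]
      by eventually_elim (use w(2) in fastforce)
  qed
  have v: "val [[u]] [u] (\<lambda>zs. pt [sc (zs ! 0)])" if "u \<in> U" for u
    by (rule scalar_nth; use U_hints[OF that] in simp)
  from assms consider u where "u \<in> U" "w = huminus ext u" | "w = star (num 0)" | "w \<in> U"
    by (auto simp: symmetrized_def)
  then show thesis
  proof cases
    case 1
    show thesis
      by (rule *[OF 1(1)]) (use huminus_int[OF v[OF 1(1)]] 1 in auto)
  next
    case 2
    obtain u where "u \<in> U" using U_nonempty by blast
    moreover have "val [[u]] [w] (\<lambda>zs. pt [0])"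
      using val_star[of "[[u]]" "num 0"] by (simp add: pt_singleton 2)
    ultimately show thesis
      using *[of u "\<lambda>_. 0"] by simp
  next
    case 3
    show thesis
      by (rule *[OF 3 v[OF 3]]) auto
  qed
qed

lemma symmetrizedI:
  assumes "u \<in> U" "val bss [u] (\<lambda>zs. pt [q zs])" "val bss [w] (\<lambda>zs. pt [p zs])"
    and bound: "\<forall>\<^sub>F zs in ult bss. \<bar>p zs\<bar> \<le> q zs"
  shows "w \<in> symmetrized star ext U"
proof -
  have "\<forall>\<^sub>F zs in ult bss. 1 \<le> p zs \<or> p zs = 0 \<or> 1 \<le> - p zs"
    by (rule always_eventually) linarith
  \<comment> \<open>The sign may vary between instances, but the ultrafilter selects exactly one of
    the three cases.\<close>
  then consider "\<forall>\<^sub>F zs in ult bss. 1 \<le> p zs" | "\<forall>\<^sub>F zs in ult bss. p zs = 0" | "\<forall>\<^sub>F zs in ult bss. 1 \<le> - p zs"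
    by (auto simp only: ev_disj)
  then show ?thesis
  proof cases
    case 1
    then have "w \<in> hypernats ext" by (simp add: hypernats_int[OF assms(3)])
    moreover have "hle ext w u"
      unfolding hle_int[OF assms(3,2)] using bound by eventually_elim simp
    ultimately have "w \<in> U" using U_initial[OF assms(1)] by blast
    then show ?thesis by (simp add: symmetrized_def)
  next
    case 2
    then have "\<forall>\<^sub>F zs in ult bss. [num 0] = pt [p zs]"
      by eventually_elim (simp add: pt_singleton)
    from val_cong[THEN iffD1, OF this val_star] have "star (num 0) = w"
      using val_unique[OF assms(3)] by blast
    then show ?thesis by (auto simp: symmetrized_def)
  next
    case 3
    obtain y where y: "val bss [y] (\<lambda>zs. pt [- p zs])" by (rule int_val_ex)
    have "y \<in> hypernats ext" using 3 by (simp add: hypernats_int[OF y])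
    moreover have "hle ext y u"
      unfolding hle_int[OF y assms(2)] using bound by eventually_elim simp
    ultimately have "y \<in> U" using U_initial[OF assms(1)] by blast
    moreover have "w = huminus ext y"
      using val_unique[OF assms(3), of "[huminus ext y]"] huminus_int[OF y] by simp
    ultimately show ?thesis by (auto simp: symmetrized_def)
  qed
qed

end

section \<open>Density along a cut\<close>

lemma zset_length: "z \<in> zset d e \<Longrightarrow> length z = d"
  by (simp add: zset_def)

lemma thicken_zset_length: "z \<in> thicken (zset d e) n \<Longrightarrow> length z = d"
  by (auto simp: thicken_def dest!: cube_length zset_length)

locale internal_set_and_cut = cut_of_universe star ext H U
  for star :: "entity \<Rightarrow> 'b" and ext :: "entity list set \<Rightarrow> 'b list set" and H U +
  fixes d :: nat and e :: 'b and E :: "'b list set"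
  assumes E: "E = internal_set d (\<lambda>zs. zset d (hd (zs ! 0))) [[e]]"
begin

abbreviation monad_sum :: "'b list set" where
  "monad_sum \<equiv> sumset ext E (tuples d (symmetrized star ext U))"

text \<open>The internal set called \<open>E_u\<close> in the overview, with the code of E and the
  number \<open>u\<close> as parameters.\<close>

definition thick :: "'b \<Rightarrow> 'b list set" where
  "thick u = internal_set d (\<lambda>zs. thicken (zset d (hd (zs ! 0))) (sc (zs ! 1))) [[e], [u]]"

definition box_at :: "'b list \<Rightarrow> 'b \<Rightarrow> 'b list set" where
  "box_at x n = internal_set d (\<lambda>zs. cube (pt_inv (zs ! 0)) (sc (zs ! 1))) [x, [n]]"

lemma thick_val:
  assumes "val bss [e] f" "val bss [u] h" "val bss x (\<lambda>zs. pt (p zs))"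
  shows "x \<in> thick u \<longleftrightarrow> length x = d \<and>
    (\<forall>\<^sub>F zs in ult bss. p zs \<in> thicken (zset d (hd (f zs))) (sc (h zs)))"
  unfolding thick_def using internal_set_val_list[of bss "[[e], [u]]" "[f, h]"] assms by simp

lemma thick_reparam:
  assumes "val bss [e] f" "val bss [u] h"
  shows "thick u = internal_set d (\<lambda>zs. thicken (zset d (hd (f zs))) (sc (h zs))) bss"
  unfolding thick_def using internal_set_reparam[of bss "[[e], [u]]" "[f, h]"] assms by simp

lemma box_at_reparam:
  assumes "val bss x f" "val bss [n] h"
  shows "box_at x n = internal_set d (\<lambda>zs. cube (pt_inv (f zs)) (sc (h zs))) bss"
  unfolding box_at_def using internal_set_reparam[of bss "[x, [n]]" "[f, h]"] assms by simp

section \<open>Internal sets below and above the external sumset\<close>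

lemma thick_mono:
  assumes "u \<in> hints ext" "v \<in> hints ext" "hle ext u v"
  shows "thick u \<subseteq> thick v"
proof -
  let ?b = "[[e], [u], [v]]"
  have vals: "val ?b [e] (\<lambda>zs. zs ! 0)" "val ?b [u] (\<lambda>zs. zs ! 1)" "val ?b [v] (\<lambda>zs. zs ! 2)"
    using val_nth[of 0 ?b] val_nth[of 1 ?b] val_nth[of 2 ?b] by auto
  have ints: "val ?b [u] (\<lambda>zs. pt [sc (zs ! 1)])" "val ?b [v] (\<lambda>zs. pt [sc (zs ! 2)])"
    by (rule scalar_nth; use assms in simp)+
  have "\<forall>\<^sub>F zs in ult ?b. thicken (zset d (hd (zs ! 0))) (sc (zs ! 1)) \<subseteq> thicken (zset d (hd (zs ! 0))) (sc (zs ! 2))"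
    using assms(3) unfolding hle_int[OF ints] by eventually_elim (rule thicken_mono)
  then show ?thesis
    unfolding thick_reparam[OF vals(1,2)] thick_reparam[OF vals(1,3)]
    by (subst internal_set_subset_iff) (auto simp: thicken_zset_length)
qed

text \<open>Each coordinate of the infinitesimal summand has its own bound in U. The dimension is a
  standard number, so finitely many bounds have a common one in U.\<close>

lemma monad_sum_subset: "monad_sum \<subseteq> (\<Union>u\<in>U. thick u)"
proof
  fix x assume "x \<in> monad_sum"
  then obtain y w where y: "y \<in> E" and w: "length w = d" "set w \<subseteq> symmetrized star ext U"
    and x: "x = tuple_plus ext y w"
    by (auto simp: sumset_def tuples_def)
  have "\<forall>a\<in>set w. \<exists>u\<in>U. a \<in> hints ext \<and> hle ext (huminus ext u) a \<and> hle ext a u"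
    using w(2) symmetrized_bound by (metis subsetD)
  then obtain b where b: "\<forall>a\<in>set w. b a \<in> U \<and> a \<in> hints ext \<and> hle ext (huminus ext (b a)) a \<and> hle ext a (b a)"
    by metis
  then obtain u where u: "u \<in> U" "\<forall>a\<in>set w. hle ext (b a) u"
    using U_upper_bound[of "b ` set w"] by auto
  have y_hints: "length y = d" "set y \<subseteq> hints ext"
    using y internal_set_hints unfolding E by blast+
  let ?b = "[[e], [u], y, w]"
  have w_hints: "set w \<subseteq> hints ext" using b by blast
  have vals: "val ?b [e] (\<lambda>zs. zs ! 0)" "val ?b [u] (\<lambda>zs. zs ! 1)"
    using val_nth[of 0 ?b] val_nth[of 1 ?b] by auto
  have vu: "val ?b [u] (\<lambda>zs. pt [sc (zs ! 1)])"
    by (rule scalar_nth; use U_hints[OF u(1)] in simp)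
  have vy: "val ?b y (\<lambda>zs. pt (pt_inv (zs ! 2)))" and vw: "val ?b w (\<lambda>zs. pt (pt_inv (zs ! 3)))"
    by (rule point_nth; use y_hints w_hints in simp)+
  have vx: "val ?b x (\<lambda>zs. pt (map2 (+) (pt_inv (zs ! 2)) (pt_inv (zs ! 3))))"
    unfolding x by (rule tuple_plus_val[OF vy vw]) (simp add: y_hints w)
  have y_in: "\<forall>\<^sub>F zs in ult ?b. pt_inv (zs ! 2) \<in> zset d (hd (zs ! 0))"
    using y unfolding E
    using internal_set_val_list[of ?b "[[e]]" "[\<lambda>zs. zs ! 0]", OF _ vy] vals by simp
  have "w \<in> hbox ext d u"
  proof -
    have "a \<in> hinterval ext (huminus ext u) u" if "a \<in> set w" for a
    proof -
      have ab: "a \<in> hints ext" "b a \<in> hints ext" "u \<in> hints ext" "hle ext (huminus ext (b a)) a" "hle ext a (b a)"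
        "hle ext (b a) u"
        using b u that U_hints by blast+
      let ?c = "[[a], [b a], [u]]"
      have c: "val ?c [a] (\<lambda>zs. pt [sc (zs ! 0)])" "val ?c [b a] (\<lambda>zs. pt [sc (zs ! 1)])"
        "val ?c [u] (\<lambda>zs. pt [sc (zs ! 2)])"
        by (rule scalar_nth; use ab in simp)+
      have "hle ext (huminus ext u) a"
        using ab(4,6) unfolding hle_int[OF huminus_int[OF c(2)] c(1)] hle_int[OF c(2,3)]
          hle_int[OF huminus_int[OF c(3)] c(1)] by eventually_elim simp
      moreover have "hle ext a u"
        using hle_trans ab by blast
      ultimately show ?thesis using ab(1) by (simp add: hinterval_def)
    qed
    then show ?thesis using w(1) by (auto simp: hbox_def tuples_def)
  qed
  then have "\<forall>\<^sub>F zs in ult ?b. near (sc (zs ! 1)) (replicate d 0) (pt_inv (zs ! 3))"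
    using hbox_val[OF vw vu] by simp
  then have "\<forall>\<^sub>F zs in ult ?b. map2 (+) (pt_inv (zs ! 2)) (pt_inv (zs ! 3)) \<in> thicken (zset d (hd (zs ! 0))) (sc (zs ! 1))"
    using y_in
  proof eventually_elim
    case (elim zs)
    then have "map2 (+) (pt_inv (zs ! 2)) (pt_inv (zs ! 3)) \<in> cube (pt_inv (zs ! 2)) (sc (zs ! 1))"
      using zset_length[OF elim(2)] by (auto simp: cube_def near_def list_all2_conv_all_nth)
    with elim(2) show ?case by (auto simp: thicken_def)
  qed
  moreover have "length x = d"
    using y_hints w by (simp add: x tuple_plus_def)
  ultimately have "x \<in> thick u"
    using thick_val[OF vals vx] by simp
  with u(1) show "x \<in> (\<Union>u\<in>U. thick u)" by blast
qed

lemma thick_subset: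
  assumes u: "u \<in> U"
  shows "thick u \<subseteq> monad_sum"
proof
  fix x assume x: "x \<in> thick u"
  then have x_hints: "length x = d" "set x \<subseteq> hints ext"
    using internal_set_hints unfolding thick_def by blast+
  let ?b = "[[e], [u], x]"
  have vals: "val ?b [e] (\<lambda>zs. zs ! 0)" "val ?b [u] (\<lambda>zs. zs ! 1)"
    using val_nth[of 0 ?b] val_nth[of 1 ?b] by auto
  have vu: "val ?b [u] (\<lambda>zs. pt [sc (zs ! 1)])"
    by (rule scalar_nth; use U_hints[OF u(1)] in simp)
  have vx: "val ?b x (\<lambda>zs. pt (pt_inv (zs ! 2)))"
    by (rule point_nth; use x_hints in simp)
  \<comment> \<open>A point of E near \<open>x\<close> has to be found internally: it is chosen in
    each instance, and the value of this standard choice function is an internal point.\<close>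
  define Y where "Y zs = (SOME y. y \<in> zset d (hd (zs ! 0)) \<and> near (sc (zs ! 1)) y (pt_inv (zs ! 2)))" for zs
  have Y: "\<forall>\<^sub>F zs in ult ?b. Y zs \<in> zset d (hd (zs ! 0)) \<and> near (sc (zs ! 1)) (Y zs) (pt_inv (zs ! 2))"
  proof -
    have "\<forall>\<^sub>F zs in ult ?b. pt_inv (zs ! 2) \<in> thicken (zset d (hd (zs ! 0))) (sc (zs ! 1))"
      using x thick_val[OF vals vx] by simp
    then show ?thesis
    proof eventually_elim
      case (elim zs)
      then have "\<exists>y. y \<in> zset d (hd (zs ! 0)) \<and> near (sc (zs ! 1)) y (pt_inv (zs ! 2))"
        by (auto simp: thicken_def cube_def)
      then show ?case unfolding Y_def by (rule someI_ex)
    qed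
  qed
  have len: "\<forall>\<^sub>F zs in ult ?b. length (Y zs) = d \<and> length (pt_inv (zs ! 2)) = d"
    using Y val_length[OF vx] by eventually_elim (auto simp: zset_length x_hints)
  let ?W = "\<lambda>zs. map2 (-) (pt_inv (zs ! 2)) (Y zs)"
  have lenY: "\<forall>\<^sub>F zs in ult ?b. length (pt (Y zs)) = d"
    and lenW: "\<forall>\<^sub>F zs in ult ?b. length (pt (?W zs)) = d"
    using len by (eventually_elim, simp)+
  obtain y where y: "length y = d" "val ?b y (\<lambda>zs. pt (Y zs))"
    by (rule val_ex[OF lenY])
  obtain w where w: "length w = d" "val ?b w (\<lambda>zs. pt (?W zs))"
    by (rule val_ex[OF lenW])
  have "\<forall>\<^sub>F zs in ult ?b. Y zs \<in> zset d (hd (zs ! 0))"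
    using Y by eventually_elim simp
  then have "y \<in> E"
    unfolding E using internal_set_val_list[of ?b "[[e]]" "[\<lambda>zs. zs ! 0]", OF _ y(2)] vals y(1) by simp
  moreover have "w \<in> tuples d (symmetrized star ext U)"
  proof -
    have "w ! i \<in> symmetrized star ext U" if i: "i < d" for i
    proof (rule symmetrizedI[OF u vu coord_val[OF w(2)]])
      show "i < length w" using i w by simp
      show "\<forall>\<^sub>F zs in ult ?b. \<bar>?W zs ! i\<bar> \<le> sc (zs ! 1)"
        using Y len by eventually_elim
          (use i in \<open>auto simp: near_def list_all2_conv_all_nth abs_minus_commute\<close>)
    qed
    then show ?thesis
      using w(1) by (auto simp: tuples_def in_set_conv_nth)
  qed
  moreover have "tuple_plus ext y w = x"
  proof (rule val_unique[OF tuple_plus_val[OF y(2) w(2)]])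
    show "length w = length y" by (simp add: w y)
    have "\<forall>\<^sub>F zs in ult ?b. pt (pt_inv (zs ! 2)) = pt (map2 (+) (Y zs) (?W zs))"
      using len by eventually_elim (auto intro: nth_equalityI)
    from val_cong[THEN iffD1, OF this vx]
    show "val ?b x (\<lambda>zs. pt (map2 (+) (Y zs) (?W zs)))" .
  qed
  ultimately show "x \<in> monad_sum"
    by (auto simp: sumset_def)
qed

lemma monad_sum_above: "v \<in> above ext U \<Longrightarrow> monad_sum \<subseteq> thick v"
  using monad_sum_subset thick_mono[OF U_hints _ hless_imp_hle] U_less_above above_hypernats U_hints by blast

lemma hyperfinite_box_at:
  assumes "length x = d" "set x \<subseteq> hints ext" "n \<in> hypernats ext"
  shows "hyperfinite d (box_at x n)"
  unfolding hyperfinite_def box_at_def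
proof (intro exI conjI)
  let ?b = "[x, [n]]"
  have v: "val ?b [n] (\<lambda>zs. pt [sc (zs ! 1)])"
    by (rule scalar_nth; use assms hypernats_hints in simp)
  have n: "\<forall>\<^sub>F zs in ult ?b. 1 \<le> sc (zs ! 1)"
    using assms(3) hypernats_int[OF v] by simp
  have "\<forall>\<^sub>F zs in ult ?b. length (zs ! 0) = d"
    using ev_nth_length[of ?b] by eventually_elim (use assms in auto)
  with n show "\<forall>\<^sub>F zs in ult ?b. finite (cube (pt_inv (zs ! 0)) (sc (zs ! 1))) \<and>
      cube (pt_inv (zs ! 0)) (sc (zs ! 1)) \<noteq> {} \<and> (\<forall>z\<in>cube (pt_inv (zs ! 0)) (sc (zs ! 1)). length z = d)"
  proof eventually_elim
    case (elim zs)
    then have "pt_inv (zs ! 0) \<in> cube (pt_inv (zs ! 0)) (sc (zs ! 1))"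
      by (simp add: cube_def near_refl)
    with elim show ?case using finite_cube cube_length by auto
  qed
qed (rule refl)

lemma thick_ratio_tendsto:
  assumes "val bss [e] f" "val bss [u] h" "val bss x p" "val bss [n] q" "length x = d"
  shows "((\<lambda>zs. cube_density (zset d (hd (f zs))) (pt_inv (p zs)) (sc (q zs)) (sc (h zs))) \<longlongrightarrow>
    loeb_ratio d (thick u \<inter> box_at x n) (box_at x n)) (ult bss)"
  unfolding cube_density_def thick_reparam[OF assms(1,2)] box_at_reparam[OF assms(3,4)] internal_set_Int
proof (rule ratio_tendsto)
  show "\<forall>\<^sub>F zs in ult bss. finite (cube (pt_inv (p zs)) (sc (q zs))) \<and>
      (\<forall>z\<in>cube (pt_inv (p zs)) (sc (q zs)). length z = d)"
    using val_length[OF assms(3)] by eventually_elim (auto simp: finite_cube assms(5) dest: cube_length)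
qed auto

lemma internal_thick_Int:
  assumes "length x = d"
  shows "internal ext d (thick u \<inter> box_at x n)"
proof -
  let ?b = "[[e], [u], x, [n]]"
  have vals: "val ?b [e] (\<lambda>zs. zs ! 0)" "val ?b [u] (\<lambda>zs. zs ! 1)" "val ?b x (\<lambda>zs. zs ! 2)" "val ?b [n] (\<lambda>zs. zs ! 3)"
    using val_nth[of 0 ?b] val_nth[of 1 ?b] val_nth[of 2 ?b] val_nth[of 3 ?b] by auto
  show ?thesis
    unfolding thick_reparam[OF vals(1,2)] box_at_reparam[OF vals(3,4)] internal_set_Int
    by (rule internal_internal_set, rule always_eventually) (auto simp: thicken_zset_length)
qed

text \<open>
  Without this, the densities in the theorem could be the junk value \<open>0\<close> that
  \<open>measure\<close> takes on sets that are not measurable.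
\<close>

lemma monad_sum_measurable:
  assumes x: "length x = d" "set x \<subseteq> hints ext" "n \<in> hypernats ext"
  shows "monad_sum \<inter> box_at x n \<in> sets (loeb star ext d (box_at x n))"
proof (rule loeb_sandwich[OF hyperfinite_box_at[OF x]])
  fix \<epsilon> :: real assume \<epsilon>: "0 < \<epsilon>"
  let ?bs = "[[e], x, [n]]"
  let ?g = "\<lambda>zs. cube_density (zset d (hd (zs ! 0))) (pt_inv (zs ! 1)) (sc (zs ! 2))"
  \<comment> \<open>The increasing function is the density of the thickenings in this one box, so
    the pair obtained here depends on \<open>x\<close> and \<open>n\<close>.\<close>
  obtain u v where uv: "u \<in> U" "v \<in> above ext U" "hle ext v H"
    "\<forall>\<^sub>F zs in ult ([[u], [v]] @ ?bs). ?g (drop 2 zs) (sc (zs ! 1)) \<le> ?g (drop 2 zs) (sc (zs ! 0)) + \<epsilon>"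
    using cube_density_nonneg cube_density_le_1 cube_density_mono \<epsilon> by (rule no_gap)
  let ?b = "[[u], [v], [e], x, [n]]"
  have vals: "val ?b [u] (\<lambda>zs. zs ! 0)" "val ?b [v] (\<lambda>zs. zs ! 1)" "val ?b [e] (\<lambda>zs. zs ! 2)"
    "val ?b x (\<lambda>zs. zs ! 3)" "val ?b [n] (\<lambda>zs. zs ! 4)"
    using val_nth[of 0 ?b] val_nth[of 1 ?b] val_nth[of 2 ?b] val_nth[of 3 ?b] val_nth[of 4 ?b] by auto
  let ?h = "\<lambda>zs. cube_density (zset d (hd (zs ! 2))) (pt_inv (zs ! 3)) (sc (zs ! 4))"
  have le: "\<forall>\<^sub>F zs in ult ?b. ?h zs (sc (zs ! 1)) \<le> ?h zs (sc (zs ! 0)) + \<epsilon>"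
    using uv(4)[simplified append_Cons append_Nil] ev_nth_length[of ?b]
    by eventually_elim simp
  have "loeb_ratio d (thick v \<inter> box_at x n) (box_at x n) \<le> loeb_ratio d (thick u \<inter> box_at x n) (box_at x n) + \<epsilon>"
    by (rule tendsto_le[OF ult_neq_bot tendsto_add[OF thick_ratio_tendsto[OF vals(3,1,4,5) x(1)] tendsto_const]
          thick_ratio_tendsto[OF vals(3,2,4,5) x(1)] le])
  then show "\<exists>I K. internal ext d I \<and> internal ext d K \<and> I \<subseteq> monad_sum \<inter> box_at x n \<and>
      monad_sum \<inter> box_at x n \<subseteq> K \<and> K \<subseteq> box_at x n \<and>
      loeb_ratio d K (box_at x n) \<le> loeb_ratio d I (box_at x n) + \<epsilon>"
    using internal_thick_Int[OF x(1)] thick_subset[OF uv(1)] monad_sum_above[OF uv(2)]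
    by (intro exI[of _ "thick u \<inter> box_at x n"] exI[of _ "thick v \<inter> box_at x n"]) blast
qed

text \<open>\<open>thick u\<close> lies inside the external sumset, so its Loeb ratio in the box is
  below \<rho> too. A strict inequality for a limit holds in almost every instance.\<close>

lemma thick_sparse:
  assumes x: "length x = d" "set x \<subseteq> hints ext" "n \<in> hypernats ext" and u: "u \<in> U"
    and less: "measure (loeb star ext d (box_at x n)) (monad_sum \<inter> box_at x n) < \<rho>"
  shows "\<forall>\<^sub>F zs in ult [[e], [u], x, [n]].
    cube_density (zset d (hd (zs ! 0))) (pt_inv (zs ! 2)) (sc (zs ! 3)) (sc (zs ! 1)) < \<rho>"
proof -
  let ?F = "box_at x n" and ?b = "[[e], [u], x, [n]]"
  note F = hyperfinite_box_at[OF x]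
  have vals: "val ?b [e] (\<lambda>zs. zs ! 0)" "val ?b [u] (\<lambda>zs. zs ! 1)" "val ?b x (\<lambda>zs. zs ! 2)" "val ?b [n] (\<lambda>zs. zs ! 3)"
    using val_nth[of 0 ?b] val_nth[of 1 ?b] val_nth[of 2 ?b] val_nth[of 3 ?b] by auto
  have int: "internal ext d (thick u \<inter> ?F)" "thick u \<inter> ?F \<subseteq> ?F"
    using internal_thick_Int[OF x(1)] by auto
  have "measure (loeb star ext d ?F) (thick u \<inter> ?F) \<le> measure (loeb star ext d ?F) (monad_sum \<inter> ?F)"
    using thick_subset[OF u] loeb_internal(1)[OF F int] loeb_fmeasurable[OF F monad_sum_measurable[OF x]]
    by (intro measure_mono_fmeasurable) (auto dest: fmeasurableD)
  with less loeb_internal(2)[OF F int] have "loeb_ratio d (thick u \<inter> ?F) ?F < \<rho>"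
    by simp
  then show ?thesis
    by (rule order_tendstoD(2)[OF thick_ratio_tendsto[OF vals x(1)]])
qed

text \<open>Lower density with the supremum and infimum unfolded. All points of the sumset in the
  box with lower density below \<rho> belong to it.\<close>

definition sparse_points :: "real \<Rightarrow> 'b list set" where
  "sparse_points \<rho> = {x \<in> monad_sum \<inter> hbox ext d H. \<forall>\<xi>\<in>above ext U. \<exists>\<nu>\<in>above ext U. hless ext \<nu> \<xi> \<and>
     measure (loeb star ext d (box_at x \<nu>)) (monad_sum \<inter> box_at x \<nu>) < \<rho>}"

lemma H_val: "i < length bss \<Longrightarrow> bss ! i = [H] \<Longrightarrow> val bss [H] (\<lambda>zs. pt [sc (zs ! i)])"
  by (rule scalar_nth) (use H hypernats_hints in auto)

lemma hbox_reparam: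
  assumes "val bss [H] f"
  shows "hbox ext d H = internal_set d (\<lambda>zs. cube (replicate d 0) (sc (f zs))) bss"
  unfolding hbox_eq[OF hypernats_hints[OF H]]
  using internal_set_reparam[of bss "[[H]]" "[f]"] assms by simp

lemma hyperfinite_hbox: "hyperfinite d (hbox ext d H)"
  unfolding hyperfinite_def
proof (intro exI conjI)
  have v: "val [[H]] [H] (\<lambda>zs. zs ! 0)" using val_nth[of 0 "[[H]]"] by simp
  show "hbox ext d H = internal_set d (\<lambda>zs. cube (replicate d 0) (sc (zs ! 0))) [[H]]"
    by (rule hbox_reparam[OF v])
  have "\<forall>\<^sub>F zs in ult [[H]]. 1 \<le> sc (zs ! 0)"
    using H hypernats_int[OF H_val[of 0 "[[H]]"]] by simp
  then show "\<forall>\<^sub>F zs in ult [[H]]. finite (cube (replicate d 0) (sc (zs ! 0))) \<and>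
      cube (replicate d 0) (sc (zs ! 0)) \<noteq> {} \<and> (\<forall>z\<in>cube (replicate d 0) (sc (zs ! 0)). length z = d)"
  proof eventually_elim
    case (elim zs)
    then have "replicate d 0 \<in> cube (replicate d 0) (sc (zs ! 0))"
      by (simp add: cube_def near_refl)
    then show ?case using finite_cube cube_length by fastforce
  qed
qed

text \<open>The pair \<open>u\<close>, \<open>v\<close> is fixed for the whole box before any point
  is considered; only the radius \<nu> and a bound \<open>u'\<close> depend on the point. Therefore
  one internal set of small measure serves all sparse points at once.\<close>

lemma sparse_points_null:
  assumes E_box: "E \<subseteq> hbox ext d H" and \<rho>: "0 < \<rho>" "\<rho> < 1"
  shows "sparse_points \<rho> \<in> null_sets (loeb star ext d (hbox ext d H))"
proof (rule loeb_null[OF hyperfinite_hbox])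
  fix \<epsilon> :: real assume "0 < \<epsilon>"
  \<comment> \<open>Solves \<open>4 ^ d * \<delta> / (1 - \<rho>) = \<epsilon>\<close>, whose left
    side is the bound of \<open>sparse_cube_bound\<close>.\<close>
  define \<delta> where "\<delta> = \<epsilon> * (1 - \<rho>) / 4 ^ d"
  have \<delta>: "0 < \<delta>" "4 ^ d * \<delta> / (1 - \<rho>) = \<epsilon>"
    using \<open>0 < \<epsilon>\<close> \<rho> by (simp_all add: \<delta>_def)
  let ?g = "\<lambda>zs. cube_density (zset d (hd (zs ! 0))) (replicate d 0) (2 * sc (zs ! 1))"
  obtain u v where u: "u \<in> U" and v: "v \<in> above ext U" "hle ext v H"
    and gap': "\<forall>\<^sub>F zs in ult ([[u], [v]] @ [[e], [H]]).
      ?g (drop 2 zs) (sc (zs ! 1)) \<le> ?g (drop 2 zs) (sc (zs ! 0)) + \<delta>"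
    using cube_density_nonneg cube_density_le_1 cube_density_mono \<delta>(1) by (rule no_gap)
  let ?b = "[[u], [v], [e], [H]]"
  let ?B = "\<lambda>zs. zset d (hd (zs ! 2))"
  have gap: "\<forall>\<^sub>F zs in ult ?b. cube_density (?B zs) (replicate d 0) (2 * sc (zs ! 3)) (sc (zs ! 1)) \<le>
      cube_density (?B zs) (replicate d 0) (2 * sc (zs ! 3)) (sc (zs ! 0)) + \<delta>"
    using gap'[simplified append_Cons append_Nil] ev_nth_length[of ?b] by eventually_elim simp
  have vals: "val ?b [u] (\<lambda>zs. zs ! 0)" "val ?b [v] (\<lambda>zs. zs ! 1)" "val ?b [e] (\<lambda>zs. zs ! 2)"
    "val ?b [H] (\<lambda>zs. zs ! 3)"
    using val_nth[of 0 ?b] val_nth[of 1 ?b] val_nth[of 2 ?b] val_nth[of 3 ?b] by auto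
  have vu: "val ?b [u] (\<lambda>zs. pt [sc (zs ! 0)])" and vv: "val ?b [v] (\<lambda>zs. pt [sc (zs ! 1)])"
    and vH: "val ?b [H] (\<lambda>zs. pt [sc (zs ! 3)])"
    by (rule scalar_nth; use u U_hints v above_hypernats H hypernats_hints in simp)+
  have u_pos: "\<forall>\<^sub>F zs in ult ?b. 1 \<le> sc (zs ! 0)"
    using U_pos[OF u vu] .
  have uv: "\<forall>\<^sub>F zs in ult ?b. sc (zs ! 0) < sc (zs ! 1)"
    using U_less_above[OF u v(1)] unfolding hless_int[OF vu vv] .
  have vh: "\<forall>\<^sub>F zs in ult ?b. sc (zs ! 1) \<le> sc (zs ! 3)"
    using v(2) unfolding hle_int[OF vv vH] .
  \<comment> \<open>The fibres of the covering set. They ask for any radius whose cube fits into the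
    larger thickening; mention of U is avoided, which keeps the set internal, and the radii above U
    that belong to sparse points satisfy the condition.\<close>
  define f where "f zs = {x \<in> cube (replicate d 0) (sc (zs ! 3)). \<exists>n\<ge>0. cube x n \<subseteq> thicken (?B zs) (sc (zs ! 1)) \<and>
      real (card (thicken (?B zs) (sc (zs ! 0)) \<inter> cube x n)) < \<rho> * real (card (cube x n))}" for zs
  let ?K = "internal_set d f ?b"
  note box = hbox_reparam[OF vals(4)]
  have f_sub: "f zs \<subseteq> cube (replicate d 0) (sc (zs ! 3))" for zs
    by (auto simp: f_def)
  then have f_len: "\<forall>\<^sub>F zs in ult ?b. \<forall>z\<in>f zs. length z = d"
    by (intro always_eventually) (auto dest!: subsetD[OF f_sub] cube_length)
  have E_sub: "\<forall>\<^sub>F zs in ult ?b. ?B zs \<subseteq> cube (replicate d 0) (sc (zs ! 3))"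
  proof -
    have "E = internal_set d ?B ?b"
      unfolding E using internal_set_reparam[of ?b "[[e]]" "[\<lambda>zs. zs ! 2]"] vals by simp
    then show ?thesis
      using E_box unfolding box by (subst internal_set_subset_iff[symmetric]) (auto simp: zset_length)
  qed
  have "internal ext d ?K" using f_len by (rule internal_internal_set)
  moreover have "?K \<subseteq> hbox ext d H"
    unfolding box internal_set_subset_iff[OF f_len] using f_sub by simp
  moreover have "loeb_ratio d ?K (hbox ext d H) \<le> \<epsilon>"
  proof (rule tendsto_upperbound)
    show "((\<lambda>zs. real (card (f zs)) / real (card (cube (replicate d 0) (sc (zs ! 3)))))
        \<longlongrightarrow> loeb_ratio d ?K (hbox ext d H)) (ult ?b)"
      unfolding box using f_sub
      by (intro ratio_tendsto always_eventually) (auto simp: finite_cube dest: cube_length)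
    show "\<forall>\<^sub>F zs in ult ?b. real (card (f zs)) / real (card (cube (replicate d 0) (sc (zs ! 3)))) \<le> \<epsilon>"
      using E_sub uv vh u_pos gap
    proof eventually_elim
      case (elim zs)
      then have "sc (zs ! 0) \<le> sc (zs ! 1)" "0 \<le> sc (zs ! 3)" by linarith+
      from sparse_cube_bound[OF elim(1) this(1) elim(3) this(2) \<rho> elim(5)]
      show ?case unfolding f_def \<delta>(2) .
    qed
  qed simp
  moreover have "sparse_points \<rho> \<subseteq> ?K"
  proof
    fix x assume "x \<in> sparse_points \<rho>"
    then have x: "x \<in> monad_sum" "x \<in> hbox ext d H"
      and dense: "\<And>\<xi>. \<xi> \<in> above ext U \<Longrightarrow> \<exists>\<nu>\<in>above ext U. hless ext \<nu> \<xi> \<and>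
        measure (loeb star ext d (box_at x \<nu>)) (monad_sum \<inter> box_at x \<nu>) < \<rho>"
      by (auto simp: sparse_points_def)
    have xh: "length x = d" "set x \<subseteq> hints ext"
      using x(2) internal_set_hints unfolding box by blast+
    \<comment> \<open>With \<nu> below half of \<open>v\<close>, there is room for \<nu> plus any
      element of U: such an element is less than \<nu>, so the sum stays below
      \<open>v\<close>.\<close>
    obtain \<xi> where \<xi>: "val ?b [\<xi>] (\<lambda>zs. pt [sc (zs ! 1) div 2])" by (rule int_val_ex)
    have \<xi>_pos: "\<forall>\<^sub>F zs in ult ?b. 1 \<le> sc (zs ! 1) div 2"
      using u_pos uv by eventually_elim linarith
    have "\<xi> \<notin> U"
    proof
      assume "\<xi> \<in> U"
      have "v \<in> U"
      \<comment> \<open>Rounding makes two summands insufficient for odd \<open>v\<close>. Three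
        suffice because \<open>v div 2\<close> is at least 1.\<close>
      proof (rule U_sum_bound[OF U_plus[OF \<open>\<xi> \<in> U\<close> \<open>\<xi> \<in> U\<close>] \<open>\<xi> \<in> U\<close> hplus_int[OF \<xi> \<xi>] \<xi> vv])
        show "\<forall>\<^sub>F zs in ult ?b. 1 \<le> sc (zs ! 1) \<and> sc (zs ! 1) \<le> sc (zs ! 1) div 2 + sc (zs ! 1) div 2 + sc (zs ! 1) div 2"
          using \<xi>_pos by eventually_elim linarith
      qed
      then show False using v(1) above_iff above_hypernats by blast
    qed
    then have "\<xi> \<in> above ext U"
      using above_iff hypernats_int[OF \<xi>] \<xi>_pos by blast
    from dense[OF this] obtain \<nu> where \<nu>: "\<nu> \<in> above ext U" "hless ext \<nu> \<xi>"
      and small: "measure (loeb star ext d (box_at x \<nu>)) (monad_sum \<inter> box_at x \<nu>) < \<rho>"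
      by blast
    \<comment> \<open>A bound for this point alone. It may exceed \<open>u\<close>, but as an
      element of U it is less than \<nu>.\<close>
    obtain u' where u': "u' \<in> U" "x \<in> thick u'"
      using x(1) monad_sum_subset by blast
    let ?c = "[[u], [v], [e], [H], x, [\<nu>], [u']]"
    have cv: "val ?c [u] (\<lambda>zs. zs ! 0)" "val ?c [v] (\<lambda>zs. zs ! 1)" "val ?c [e] (\<lambda>zs. zs ! 2)"
      "val ?c [H] (\<lambda>zs. zs ! 3)" "val ?c [u'] (\<lambda>zs. zs ! 6)"
      using val_nth[of 0 ?c] val_nth[of 1 ?c] val_nth[of 2 ?c] val_nth[of 3 ?c] val_nth[of 6 ?c] by auto
    have cx: "val ?c x (\<lambda>zs. pt (pt_inv (zs ! 4)))"
      by (rule point_nth; use xh in simp)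
    have c\<nu>: "val ?c [\<nu>] (\<lambda>zs. pt [sc (zs ! 5)])" and cu': "val ?c [u'] (\<lambda>zs. pt [sc (zs ! 6)])"
      by (rule scalar_nth; use u' U_hints \<nu> above_hypernats in simp)+
    have c\<xi>: "val ?c [\<xi>] (\<lambda>zs. pt [sc (zs ! 1) div 2])"
      using val_weaken[OF \<xi>, of "[x, [\<nu>], [u']]"] by simp
    \<comment> \<open>The positions 2, 0, 4, 5 select \<open>e\<close>, \<open>u\<close>,
      \<open>x\<close> and \<nu> from the joint list, in the order in which
      \<open>thick_sparse\<close> takes them.\<close>
    have 1: "\<forall>\<^sub>F zs in ult ?c. cube_density (?B zs) (pt_inv (zs ! 4)) (sc (zs ! 5)) (sc (zs ! 0)) < \<rho>"
      using ev_sub[of "\<lambda>zs. cube_density (zset d (hd (zs ! 0))) (pt_inv (zs ! 2)) (sc (zs ! 3)) (sc (zs ! 1)) < \<rho>"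
          ?c "[2, 0, 4, 5]"] thick_sparse[OF xh _ u small] above_hypernats[OF \<nu>(1)]
      by simp
    have 2: "\<forall>\<^sub>F zs in ult ?c. pt_inv (zs ! 4) \<in> thicken (?B zs) (sc (zs ! 6))"
      using u'(2) thick_val[OF cv(3,5) cx] by simp
    have 3: "\<forall>\<^sub>F zs in ult ?c. sc (zs ! 6) < sc (zs ! 5)"
      using U_less_above[OF u'(1) \<nu>(1)] unfolding hless_int[OF cu' c\<nu>] .
    have 4: "\<forall>\<^sub>F zs in ult ?c. sc (zs ! 5) < sc (zs ! 1) div 2"
      using \<nu>(2) unfolding hless_int[OF c\<nu> c\<xi>] .
    have 5: "\<forall>\<^sub>F zs in ult ?c. pt_inv (zs ! 4) \<in> cube (replicate d 0) (sc (zs ! 3))"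
      using x(2) unfolding hbox_reparam[OF cv(4)] by (simp add: internal_set_val[OF cx])
    have 6: "\<forall>\<^sub>F zs in ult ?c. 1 \<le> sc (zs ! 6)"
      by (rule U_pos[OF u'(1) cu'])
    have "\<forall>\<^sub>F zs in ult ?c. pt_inv (zs ! 4) \<in> f [zs ! 0, zs ! 1, zs ! 2, zs ! 3]"
      using 1 2 3 4 5 6
    proof eventually_elim
      case (elim zs)
      let ?x = "pt_inv (zs ! 4)" and ?n = "sc (zs ! 5)"
      obtain y where y: "y \<in> ?B zs" "near (sc (zs ! 6)) y ?x"
        using elim(2) by (auto simp: thicken_def cube_def)
      have "cube ?x ?n \<subseteq> thicken (?B zs) (sc (zs ! 1))"
      proof
        fix z assume "z \<in> cube ?x ?n"
        then have "near (sc (zs ! 6) + ?n) y z"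
          using near_trans[OF y(2)] by (simp add: cube_def)
        then have "near (sc (zs ! 1)) y z"
          by (rule near_mono) (use elim(3,4) in linarith)
        with y(1) show "z \<in> thicken (?B zs) (sc (zs ! 1))"
          by (auto simp: thicken_def cube_def)
      qed
      moreover have n: "0 \<le> ?n" using elim(3,6) by linarith
      moreover have "real (card (thicken (?B zs) (sc (zs ! 0)) \<inter> cube ?x ?n)) < \<rho> * real (card (cube ?x ?n))"
        using elim(1) card_cube_pos[OF n, of ?x] by (simp add: cube_density_def pos_divide_less_eq)
      ultimately show ?case
        using elim(5) by (auto simp: f_def)
    qed
    then show "x \<in> ?K"
      using internal_set_val_list[of ?c ?b "[\<lambda>zs. zs ! 0, \<lambda>zs. zs ! 1, \<lambda>zs. zs ! 2, \<lambda>zs. zs ! 3]", OF _ cx] cv xh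
      by simp
  qed
  ultimately show "\<exists>K. internal ext d K \<and> sparse_points \<rho> \<subseteq> K \<and> K \<subseteq> hbox ext d H \<and>
      loeb_ratio d K (hbox ext d H) \<le> \<epsilon>"
    by blast
qed

text \<open>A supremum strictly below 1 leaves room for a real number in between, hence for one of
  countably many levels. The offset 2 keeps every level strictly between 0 and 1.\<close>

lemma low_density_subset:
  "{x \<in> monad_sum. cut_density star ext d U E x < 1} \<inter> hbox ext d H \<subseteq>
     (\<Union>k::nat. sparse_points (1 - 1 / real (k + 2)))"
proof
  fix x assume x: "x \<in> {x \<in> monad_sum. cut_density star ext d U E x < 1} \<inter> hbox ext d H"
  have v: "val [[H]] [H] (\<lambda>zs. zs ! 0)" using val_nth[of 0 "[[H]]"] by simp
  have xh: "length x = d" "set x \<subseteq> hints ext"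
    using x internal_set_hints unfolding hbox_reparam[OF v] by blast+
  define g where "g \<nu> = measure (loeb star ext d (box_at x \<nu>)) (monad_sum \<inter> box_at x \<nu>)" for \<nu>
  have "cut_density star ext d U E x =
      (SUP \<xi>\<in>above ext U. INF \<nu>\<in>{\<nu> \<in> above ext U. hless ext \<nu> \<xi>}. ereal (g \<nu>))"
    unfolding cut_density_def cut_liminf_def Let_def g_def box_at_def
    using hbox_translate_eq[OF xh] above_hypernats by (intro SUP_cong INF_cong refl) auto
  with x have "(SUP \<xi>\<in>above ext U. INF \<nu>\<in>{\<nu> \<in> above ext U. hless ext \<nu> \<xi>}. ereal (g \<nu>)) < 1"
    by simp
  then obtain q where q: "(SUP \<xi>\<in>above ext U. INF \<nu>\<in>{\<nu> \<in> above ext U. hless ext \<nu> \<xi>}. ereal (g \<nu>)) < ereal q"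
    "ereal q < 1"
    using ereal_dense2 by blast
  then have "0 < 1 - q" by simp
  then obtain k where k: "1 / real (Suc k) < 1 - q" by (rule nat_approx_posE)
  have "1 / real (k + 2) \<le> 1 / real (Suc k)"
    by (simp add: frac_le)
  with k have qk: "q < 1 - 1 / real (k + 2)" by linarith
  have "\<exists>\<nu>\<in>above ext U. hless ext \<nu> \<xi> \<and> g \<nu> < 1 - 1 / real (k + 2)" if "\<xi> \<in> above ext U" for \<xi>
  proof -
    have "(INF \<nu>\<in>{\<nu> \<in> above ext U. hless ext \<nu> \<xi>}. ereal (g \<nu>)) < ereal q"
      using q(1) SUP_upper[OF that] by (rule le_less_trans[rotated])
    then obtain \<nu> where "\<nu> \<in> above ext U" "hless ext \<nu> \<xi>" "g \<nu> < q"
      by (auto simp: INF_less_iff)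
    with qk show ?thesis by force
  qed
  then have "x \<in> sparse_points (1 - 1 / real (k + 2))"
    using x by (auto simp: sparse_points_def g_def)
  then show "x \<in> (\<Union>k::nat. sparse_points (1 - 1 / real (k + 2)))" by blast
qed

text \<open>Completeness of the Loeb measure enters here: a subset of a countable union of null sets
  is null, however the lower density depends on the point.\<close>

lemma low_density_null:
  assumes "E \<subseteq> hbox ext d H"
  shows "{x \<in> monad_sum. cut_density star ext d U E x < 1} \<inter> hbox ext d H \<in>
    null_sets (loeb star ext d (hbox ext d H))"
proof -
  have "sparse_points (1 - 1 / real (k + 2)) \<in> null_sets (loeb star ext d (hbox ext d H))" for k :: nat
    by (rule sparse_points_null[OF assms]) simp_all
  then have "(\<Union>k::nat. sparse_points (1 - 1 / real (k + 2))) \<in> null_sets (loeb star ext d (hbox ext d H))"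
    by (rule null_sets_UN)
  then show ?thesis
    using null_sets_completion_subset[OF low_density_subset] unfolding loeb_eq by blast
qed

end

theorem theorem6p2:
  fixes star :: "entity \<Rightarrow> 'b"
    and ext :: "entity list set \<Rightarrow> 'b list set"
    and d :: nat and H :: 'b and U :: "'b set" and E :: "'b list set"
  assumes "nonstandard_universe star ext"
    and "d \<ge> 1"
    and "H \<in> hypernats ext - standard_nats star"
    and "is_cut star ext H U"
    and "internal ext d E"
    and "E \<subseteq> hbox ext d H"
  shows "{x \<in> sumset ext E (tuples d (symmetrized star ext U)). cut_density star ext d U E x < 1}
           \<inter> hbox ext d H \<in> null_sets (loeb star ext d (hbox ext d H))"
proof -
  interpret cut_of_universe star ext H U
    using assms(1,3,4) by (simp add: cut_of_universe_def cut_of_universe_axioms_def)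
  have "set x \<subseteq> hints ext" if "x \<in> E" for x
    using that assms(6) by (auto simp: hbox_def tuples_def hinterval_def)
  \<comment> \<open>A subset of the box has hyperinteger entries, so the normal form applies and the
    code of E becomes its only parameter.\<close>
  then obtain e where "E = internal_set d (\<lambda>zs. zset d (hd (zs ! 0))) [[e]]"
    using internal_imp_internal_set[OF assms(5)] by blast
  then interpret internal_set_and_cut star ext H U d e E
    by unfold_locales
  show ?thesis
    by (rule low_density_null[OF assms(6)])
qed

end
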